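(* Let $z\in\mathbb{R}$ with $z\notin\omega\mathbb{Q}$. Then the sequence $z_n=nz$ is equidistributed in $[0,\omega]$, and for every bounded real-valued function $f$ on the set of affine points $(x,\pm y(x))$, $x\in[e,\infty)$, such that $\frac{f(x,y(x))}{y(x)}$ and $\frac{f(x,-y(x))}{y(x)}$, as functions of $x$, are improper Riemann integrable on $(e,\infty)$, one has $$\lim_{N\to\infty}\frac1N\sum_{n=1}^{N}f(\wp(z_n),\wp'(z_n))=\frac1\omega\int_e^\infty\bigl(f(x,y(x))+f(x,-y(x))\bigr)\frac{dx}{y(x)}.$$
   Context: Let $g_2,g_3\in\mathbb{R}$ with $\Delta=g_2^3-27g_3^2\ne0$, let $\Lambda\subset\mathbb{C}$ be the lattice with invariants $g_2,g_3$ and $\wp$ its Weierstrass function, so $(\wp')^2=4\wp^3-g_2\wp-g_3$. Let $e$ be the largest real root of $4x^3-g_2x-g_3$ (the only real root if $\Delta<0$), let $y(x)=\sqrt{4x^3-g_2x-g_3}\ge0$ for $x\ge e$, and let $\omega>0$ be the smallest positive real element of $\Lambda$. A real sequence $(z_n)$ is equidistributed in $[0,\omega]$ if its residues modulo $\omega$ (taken in $[0,\omega)$) satisfy $\lim_{N\to\infty}\frac1N\#\{n\le N: z_n \bmod \omega\in[c,d]\}=\frac{d-c}{\omega}$ for every $[c,d]\subseteq[0,\omega]$. A function $h:(a,\infty)\to\mathbb{R}$ is improper Riemann integrable if it is Riemann integrable on every compact subinterval and $\lim_{\epsilon\to0^+,\,r\to\infty}\int_{a+\epsilon}^{r}h(x)\,dx$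 exists in $\mathbb{R}$. *)

theory Defs
  imports "HOL-Complex_Analysis.Complex_Analysis" "HOL-Library.Real_Mod"
begin

definition is_lattice :: "complex set \<Rightarrow> bool" where
  "is_lattice \<Lambda> \<longleftrightarrow>
     (\<exists>w1 w2. w1 \<noteq> w2 \<and> independent {w1, w2} \<and>
        \<Lambda> = {of_int m * w1 + of_int n * w2 | m n. True})"

definition invariant_g2 :: "complex set \<Rightarrow> complex" where
  "invariant_g2 \<Lambda> = 60 * (\<Sum>\<^sub>\<infinity>w\<in>\<Lambda> - {0}. 1 / w ^ 4)"

definition invariant_g3 :: "complex set \<Rightarrow> complex" where
  "invariant_g3 \<Lambda> = 140 * (\<Sum>\<^sub>\<infinity>w\<in>\<Lambda> - {0}. 1 / w ^ 6)"

definition weierstrass_p :: "complex set \<Rightarrow> complex \<Rightarrow> complex" where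
  "weierstrass_p \<Lambda> z = 1 / z\<^sup>2 + (\<Sum>\<^sub>\<infinity>w\<in>\<Lambda> - {0}. 1 / (z - w)\<^sup>2 - 1 / w\<^sup>2)"

definition real_period :: "complex set \<Rightarrow> real" where
  "real_period \<Lambda> = (LEAST t. 0 < t \<and> complex_of_real t \<in> \<Lambda>)"

definition largest_root :: "real \<Rightarrow> real \<Rightarrow> real" where
  "largest_root g2 g3 = Max {x. 4 * x ^ 3 - g2 * x - g3 = 0}"

definition upper_branch :: "real \<Rightarrow> real \<Rightarrow> real \<Rightarrow> real" where
  "upper_branch g2 g3 x = sqrt (4 * x ^ 3 - g2 * x - g3)"

(* The affine real points, embedded in the complex plane so that the values of the
   Weierstrass function and its derivative can be used as coordinates without coercion. *)
definition affine_points :: "real \<Rightarrow> real \<Rightarrow> (complex \<times> complex) set" where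
  "affine_points g2 g3 =
     {(complex_of_real x, complex_of_real y) | x y.
        largest_root g2 g3 \<le> x \<and> (y = upper_branch g2 g3 x \<or> y = - upper_branch g2 g3 x)}"

definition equidistributed_mod :: "real \<Rightarrow> (nat \<Rightarrow> real) \<Rightarrow> bool" where
  "equidistributed_mod \<omega> z \<longleftrightarrow>
     (\<forall>c d. 0 \<le> c \<and> c \<le> d \<and> d \<le> \<omega> \<longrightarrow>
        (\<lambda>N. real (card {n \<in> {1..N}. z n rmod \<omega> \<in> {c..d}}) / real N)
          \<longlonglongrightarrow> (d - c) / \<omega>)"

(* The library's integrability is of Henstock-Kurzweil type; here it matters that one mesh
   bound works for all taggings, since a Henstock-Kurzweil integrable function may be changed
   arbitrarily on a countable set. *)
definition has_Riemann_integral :: "(real \<Rightarrow> real) \<Rightarrow> real \<Rightarrow> real \<Rightarrow> real \<Rightarrow> bool" where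
  "has_Riemann_integral h I a b \<longleftrightarrow>
     (\<forall>\<epsilon>>0. \<exists>\<delta>>0. \<forall>D. D tagged_division_of {a..b} \<and> (\<forall>(x, K) \<in> D. measure lborel K < \<delta>) \<longrightarrow>
        \<bar>(\<Sum>(x, K) \<in> D. measure lborel K * h x) - I\<bar> < \<epsilon>)"

definition Riemann_integrable :: "(real \<Rightarrow> real) \<Rightarrow> real \<Rightarrow> real \<Rightarrow> bool" where
  "Riemann_integrable h a b \<longleftrightarrow> (\<exists>I. has_Riemann_integral h I a b)"

(* Hence the library's integral is the value of the Riemann integral whenever the latter exists. *)
lemma has_Riemann_integral_imp_has_integral:
  assumes "has_Riemann_integral h I a b"
  shows "(h has_integral I) {a..b}"
proof -
  have "\<exists>\<gamma>. gauge \<gamma> \<and> (\<forall>D. D tagged_division_of cbox a b \<and> \<gamma> fine D \<longrightarrow>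
          norm ((\<Sum>(x, k) \<in> D. measure lborel k *\<^sub>R h x) - I) < e)" if e: "e > 0" for e :: real
  proof -
    from assms[unfolded has_Riemann_integral_def, rule_format, OF e]
    obtain d where d: "d > 0"
      and *: "\<forall>D. D tagged_division_of {a..b} \<and> (\<forall>(x, K) \<in> D. measure lborel K < d) \<longrightarrow>
        \<bar>(\<Sum>(x, K) \<in> D. measure lborel K * h x) - I\<bar> < e"
      by (elim exE conjE)
    show ?thesis
    proof (intro exI conjI allI impI; (elim conjE)?)
      show "gauge (\<lambda>x. ball x (d / 2))" using d by (simp add: gauge_ball)
      fix D assume D: "D tagged_division_of cbox a b" and fine: "(\<lambda>x. ball x (d / 2)) fine D"
      have "measure lborel K < d" if xK: "(x, K) \<in> D" for x K
      proof -
        obtain u v where K: "K = cbox u v" using tagged_division_ofD(4)[OF D xK] by (elim exE)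
        have sub: "K \<subseteq> ball x (d / 2)" by (rule fineD[OF fine xK])
        show ?thesis
        proof (cases "u \<le> v")
          case True
          then have "u \<in> K" "v \<in> K" unfolding K by simp_all
          then have "dist x u < d / 2" "dist x v < d / 2" using sub by (metis mem_ball subsetD)+
          then have "v - u < d" unfolding dist_real_def by linarith
          then show ?thesis unfolding K using True by simp
        next
          case False
          then show ?thesis unfolding K using d by simp
        qed
      qed
      then have "\<forall>(x, K) \<in> D. measure lborel K < d" by fast
      with * D have "\<bar>(\<Sum>(x, K) \<in> D. measure lborel K * h x) - I\<bar> < e"
        unfolding box_real(2) by metis
      then show "norm ((\<Sum>(x, k) \<in> D. measure lborel k *\<^sub>R h x) - I) < e"
        unfolding real_norm_def real_scaleR_def .
    qed
  qed
  then have "(h has_integral I) (cbox a b)" by (simp only: has_integral) blast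
  then show ?thesis unfolding box_real(2) .
qed

definition improper_Riemann_integrable :: "(real \<Rightarrow> real) \<Rightarrow> real \<Rightarrow> bool" where
  "improper_Riemann_integrable h a \<longleftrightarrow>
     (\<forall>c d. a < c \<and> c \<le> d \<longrightarrow> Riemann_integrable h c d) \<and>
     (\<exists>L. ((\<lambda>(\<epsilon>, r). integral {a + \<epsilon>..r} h) \<longlongrightarrow> L) (at_right 0 \<times>\<^sub>F at_top))"

definition improper_Riemann_integral :: "(real \<Rightarrow> real) \<Rightarrow> real \<Rightarrow> real" where
  "improper_Riemann_integral h a =
     Lim (at_right 0 \<times>\<^sub>F at_top) (\<lambda>(\<epsilon>, r). integral {a + \<epsilon>..r} h)"

end

theory Submission
  imports Defs
begin

text \<open>
  Since \<open>z / \<omega>\<close> is irrational, the counting function of the residues of \<open>n z\<close> is additive up to a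
  bounded error in translations by multiples of \<open>z\<close>; Dirichlet approximation provides arbitrarily small
  such translations, and monotonicity then forces equidistribution.

  The invariants being real, the lattice coincides with its complex conjugate: the difference of two
  Weierstrass functions with the same invariants solves a linear equation with a regular singular point at
  \<open>0\<close>, whose indicial exponents exclude a zero of order at least 5. Hence \<open>\<wp>\<close> is real on the real axis.
  A critical point \<open>t\<close> satisfies \<open>2 t \<in> \<Lambda>\<close>, because \<open>\<wp>(2 t - u)\<close> and \<open>\<wp>(u)\<close> solve the same initial value
  problem. So \<open>\<wp>\<close> maps \<open>(\<omega>/2, \<omega>)\<close> increasingly onto \<open>(e, \<infinity>)\<close> with \<open>\<wp>' = y \<circ> \<wp>\<close>, and \<open>(0, \<omega>/2)\<close> is its mirror image
  with \<open>\<wp>' = - y \<circ> \<wp>\<close>.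

  The substitution \<open>x = \<wp>(t)\<close> turns upper and lower Riemann sums of \<open>f / y\<close> into bounds for the means over a
  compact part of each half; the remaining residues have small density and \<open>f\<close> is bounded.
\<close>

subsection \<open>Equidistribution of the multiples of an irrational number\<close>

text \<open>No zeros of elliptic functions are counted. The complement of a lattice, or of two, is
  connected because lattices are countable, so the vanishing of all Taylor coefficients at a single
  point settles a global identity. The order 5 comes from \<open>wp'' = 6 wp^2 - g2 / 2\<close>: the
  indicial equation \<open>k (k - 1) = 12\<close> has the single nonnegative root 4, so the
  coefficient of \<open>z^4\<close> is the only one that this equation leaves free, and
  \<open>g3\<close> is what fixes it. The symmetry under conjugation is obtained as an equality of
  sets, without separating rectangular from rhombic lattices.

  On the analytic side \<open>f\<close> is controlled only through \<open>f / y\<close> as a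
  function of \<open>x\<close>, and the substitution degenerates at both ends: \<open>y\<close>
  vanishes at \<open>e\<close>, which corresponds to the residue \<open>\<omega> / 2\<close>, and
  the range is unbounded near the residues 0 and \<open>\<omega>\<close>. This forces a margin at
  each end of each half before Riemann sums can enter.\<close>

lemma abs_sum_shift_diff_le:
  fixes D :: "int \<Rightarrow> real"
  assumes D: "\<And>n. 0 \<le> D n" "\<And>n. D n \<le> K"
  shows "\<bar>(\<Sum>n=1..N. D (int n + q)) - (\<Sum>n=1..N. D (int n))\<bar> \<le> \<bar>of_int q\<bar> * K"
proof -
  \<comment> \<open>Moving the window by one exchanges its first term for the one past its end, and
    both lie in \<open>[0, K]\<close>.\<close>
  have step: "\<bar>(\<Sum>n=1..N. D (int n + q + 1)) - (\<Sum>n=1..N. D (int n + q))\<bar> \<le> K" for q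
  proof -
    have "(\<Sum>n=1..N. D (int n + q + 1)) - (\<Sum>n=1..N. D (int n + q)) = D (int N + q + 1) - D (1 + q)"
      by (induction N) (auto simp: algebra_simps)
    then show ?thesis using D(1)[of "int N + q + 1"] D(2)[of "int N + q + 1"] D(1)[of "1 + q"] D(2)[of "1 + q"]
      by linarith
  qed
  show ?thesis
  proof (induction q rule: int_induct[where k = 0])
    case base
    then show ?case by simp
  next
    case (step1 i)
    then show ?case using step[of i] by (simp add: algebra_simps)
  next
    case (step2 i)
    then show ?case using step[of "i - 1"] by (simp add: algebra_simps)
  qed
qed

text \<open>For \<open>0 \<le> s \<le> 1\<close> the summand is 1 or 0 according to whether the
  fractional part of \<open>n \<alpha>\<close> is below \<open>s\<close> or not. The form with
  floors makes sense for all real \<open>s\<close>, counting with multiplicity, so that arguments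
  can be added even beyond 1.\<close>

definition floor_count :: "real \<Rightarrow> nat \<Rightarrow> real \<Rightarrow> real" where
  "floor_count \<alpha> N s = (\<Sum>n=1..N. of_int (\<lfloor>real n * \<alpha>\<rfloor> - \<lfloor>real n * \<alpha> - s\<rfloor>))"

lemma floor_count_0 [simp]: "floor_count \<alpha> N 0 = 0"
  by (simp add: floor_count_def)

lemma floor_count_1 [simp]: "floor_count \<alpha> N 1 = real N"
  by (simp add: floor_count_def)

lemma floor_count_mono: "s \<le> t \<Longrightarrow> floor_count \<alpha> N s \<le> floor_count \<alpha> N t"
  unfolding floor_count_def by (intro sum_mono) (auto intro!: floor_mono)

lemma floor_count_nonneg: "0 \<le> s \<Longrightarrow> 0 \<le> floor_count \<alpha> N s"
  using floor_count_mono[of 0 s] by simp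

text \<open>Translating by a multiple of \<open>\<alpha>\<close> merely shifts the summation range, so the counting
  function is additive up to a bounded error.\<close>

lemma floor_count_add:
  assumes t: "t = of_int q * \<alpha> + of_int p" and s: "0 \<le> s" "s \<le> 2"
  shows "\<bar>floor_count \<alpha> N (s + t) - floor_count \<alpha> N s - floor_count \<alpha> N t\<bar> \<le> 2 * \<bar>of_int q\<bar>"
proof -
  define D where "D n = real_of_int (\<lfloor>of_int n * \<alpha>\<rfloor> - \<lfloor>of_int n * \<alpha> - s\<rfloor>)" for n :: int
  have D: "0 \<le> D n" "D n \<le> (2::real)" for n
  proof -
    have "0 \<le> \<lfloor>of_int n * \<alpha>\<rfloor> - \<lfloor>of_int n * \<alpha> - s\<rfloor>" "\<lfloor>of_int n * \<alpha>\<rfloor> - \<lfloor>of_int n * \<alpha> - s\<rfloor> \<le> 2"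
      using s by linarith+
    then show "0 \<le> D n" "D n \<le> 2" unfolding D_def by linarith+
  qed
  have eq: "real_of_int (\<lfloor>real n * \<alpha> - t\<rfloor> - \<lfloor>real n * \<alpha> - (s + t)\<rfloor>) = D (int n + (- q))" for n
  proof -
    have 1: "real n * \<alpha> - t = (real_of_int (int n - q) * \<alpha>) - of_int p"
      and 2: "real n * \<alpha> - (s + t) = (real_of_int (int n - q) * \<alpha> - s) - of_int p"
      by (simp_all add: t algebra_simps)
    show ?thesis unfolding 1 2 D_def floor_diff_of_int by simp
  qed
  have "floor_count \<alpha> N (s + t) - floor_count \<alpha> N t = (\<Sum>n=1..N. D (int n + (- q)))"
    unfolding floor_count_def sum_subtractf[symmetric] eq[symmetric] by (intro sum.cong) auto
  moreover have "floor_count \<alpha> N s = (\<Sum>n=1..N. D (int n))"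
    unfolding floor_count_def D_def by simp
  ultimately show ?thesis
    using abs_sum_shift_diff_le[where D = D and K = 2 and q = "- q" and N = N, OF D] by simp
qed

text \<open>The errors of \<open>floor_count_add\<close> accumulate linearly. The range up to 2
  leaves room for the first multiple of \<open>t\<close> beyond a point of the unit
  interval.\<close>

lemma floor_count_mult:
  assumes t: "t = of_int q * \<alpha> + of_int p" "0 \<le> t" and j: "real j * t \<le> 2"
  shows "\<bar>floor_count \<alpha> N (real j * t) - real j * floor_count \<alpha> N t\<bar> \<le> real j * (2 * \<bar>of_int q\<bar>)"
  using j
proof (induction j)
  case 0
  then show ?case by simp
next
  case (Suc j)
  have le: "real j * t \<le> 2" using Suc.prems t(2) by (simp add: algebra_simps)
  have "\<bar>floor_count \<alpha> N (real j * t + t) - floor_count \<alpha> N (real j * t) - floor_count \<alpha> N t\<bar>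
      \<le> 2 * \<bar>of_int q\<bar>"
    by (rule floor_count_add[OF t(1)]) (use le t(2) in auto)
  with Suc.IH[OF le] show ?case by (simp add: algebra_simps abs_le_iff)
qed

text \<open>Monotonicity places the count at \<open>s\<close> between those at the consecutive
  multiples \<open>j * t\<close> and \<open>Suc j * t\<close>, which are known up to multiples of
  \<open>Q\<close>. The factor \<open>t\<close> allows \<open>j * t\<close> to be traded for
  \<open>s\<close> with an error of at most \<open>t\<close>.\<close>

lemma floor_count_bounds:
  fixes N :: nat
  assumes t: "t = of_int q * \<alpha> + of_int p" "0 < t" "t \<le> 1/2" and s: "0 \<le> s" "s \<le> 1"
  defines "Q \<equiv> 2 * \<bar>real_of_int q\<bar>" and "g \<equiv> floor_count \<alpha> N t"
  shows "t * floor_count \<alpha> N s \<le> (s + t) * (g + Q)"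
    and "(s - t) * g - Q \<le> t * floor_count \<alpha> N s"
proof -
  define j where "j = nat \<lfloor>s / t\<rfloor>"
  have Q: "0 \<le> Q" by (simp add: Q_def)
  have g: "0 \<le> g" using t by (simp add: g_def floor_count_nonneg)
  have fl: "real j = of_int \<lfloor>s / t\<rfloor>" using s t by (simp add: j_def)
  have jl: "real j \<le> s / t" and ju: "s / t < real j + 1" unfolding fl by linarith+
  have jl': "real j * t \<le> s" and ju': "s \<le> real (Suc j) * t" "s < real j * t + t"
    using jl ju t(2) by (auto simp: field_simps)
  have "floor_count \<alpha> N s \<le> floor_count \<alpha> N (real (Suc j) * t)"
    by (rule floor_count_mono) (rule ju')
  also have "\<dots> \<le> real (Suc j) * (g + Q)"
    using floor_count_mult[of t q \<alpha> p "Suc j" N] t s jl' unfolding g_def Q_def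
    by (simp add: algebra_simps abs_le_iff)
  finally have "t * floor_count \<alpha> N s \<le> t * (real (Suc j) * (g + Q))"
    using t(2) by (intro mult_left_mono) auto
  also have "\<dots> = (real j * t + t) * (g + Q)" by (simp add: algebra_simps)
  also have "\<dots> \<le> (s + t) * (g + Q)"
    using jl' g Q by (intro mult_right_mono) auto
  finally show "t * floor_count \<alpha> N s \<le> (s + t) * (g + Q)" .
  have "real j * (g - Q) \<le> floor_count \<alpha> N (real j * t)"
    using floor_count_mult[of t q \<alpha> p j N] t s jl' unfolding g_def Q_def
    by (simp add: algebra_simps abs_le_iff)
  also have "\<dots> \<le> floor_count \<alpha> N s"
    by (rule floor_count_mono) (rule jl')
  finally have "t * (real j * (g - Q)) \<le> t * floor_count \<alpha> N s"
    using t(2) by (intro mult_left_mono) auto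
  moreover have "(s - t) * g \<le> (real j * t) * g"
    using ju' g by (intro mult_right_mono) auto
  moreover have "(real j * t) * Q \<le> 1 * Q"
    using jl' s Q by (intro mult_right_mono) auto
  ultimately show "(s - t) * g - Q \<le> t * floor_count \<alpha> N s"
    by (simp add: algebra_simps)
qed

text \<open>At \<open>s = 1\<close> the count is exactly \<open>N\<close>, so the bounds there pin
  the count \<open>g\<close> at \<open>t\<close> to about \<open>t * N\<close>; inserting this into
  the bounds at \<open>s\<close> eliminates \<open>g\<close>. The constants are generous: it matters
  only that the coefficient of \<open>N\<close> is proportional to \<open>t\<close> and that the
  rest does not depend on \<open>N\<close>.\<close>

lemma abs_floor_count_diff_le:
  assumes t: "t = of_int q * \<alpha> + of_int p" "0 < t" "t \<le> 1/2" and s: "0 \<le> s" "s \<le> 1"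
  shows "\<bar>floor_count \<alpha> N s - s * real N\<bar> \<le> 4 * t * real N + 32 * \<bar>real_of_int q\<bar> / t"
proof -
  define Q where "Q = 2 * \<bar>real_of_int q\<bar>"
  define g where "g = floor_count \<alpha> N t"
  define S where "S = floor_count \<alpha> N s"
  have Q: "0 \<le> Q" by (simp add: Q_def)
  have g: "0 \<le> g" using t by (simp add: g_def floor_count_nonneg)
  have S: "0 \<le> S" using s by (simp add: S_def floor_count_nonneg)
  have b1: "t * real N \<le> (1 + t) * (g + Q)" "(1 - t) * g - Q \<le> t * real N"
    using floor_count_bounds[OF t, of 1 N] by (simp_all add: g_def Q_def)
  have bs: "t * S \<le> (s + t) * (g + Q)" "(s - t) * g - Q \<le> t * S"
    using floor_count_bounds[OF t s, of N] by (simp_all add: g_def Q_def S_def)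
  have up: "S \<le> s * real N + 4 * t * real N + 16 * Q / t"
  proof -
    \<comment> \<open>The factor \<open>1 - t\<close> produces \<open>(1 - t) * g\<close>, which
      \<open>b1\<close> bounds by \<open>t * N + Q\<close>. It is at least 1/2 and is cancelled at
      the end.\<close>
    have "(1 - t) * (t * S) \<le> (1 - t) * ((s + t) * (g + Q))"
      using bs(1) t by (intro mult_left_mono) auto
    also have "\<dots> = (s + t) * ((1 - t) * g + (1 - t) * Q)" by (simp add: algebra_simps)
    also have "\<dots> \<le> (s + t) * (t * real N + 2 * Q)"
    proof (intro mult_left_mono)
      have "0 \<le> t * Q" using t Q by simp
      then show "(1 - t) * g + (1 - t) * Q \<le> t * real N + 2 * Q" using b1(2) by (simp add: algebra_simps)
    qed (use s t in auto)
    finally have 1: "(1 - t) * (t * S) \<le> (s + t) * (t * real N + 2 * Q)" .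
    have 2: "(s + t) * (2 * Q) \<le> 2 * (2 * Q)" using s t Q by (intro mult_right_mono) auto
    \<comment> \<open>The slack \<open>4 * t\<close> is what makes this true: the factors differ by
      \<open>t * (2 - 4 * t) + t * (1 - s)\<close>.\<close>
    have 3: "(s + t) * (t * real N) \<le> (1 - t) * (s + 4 * t) * (t * real N)"
    proof (intro mult_right_mono)
      have "0 \<le> t * (2 - 4 * t)" "0 \<le> t * (1 - s)" using t s by (auto intro!: mult_nonneg_nonneg)
      then show "s + t \<le> (1 - t) * (s + 4 * t)" by (simp add: algebra_simps)
    qed (use t in auto)
    have 4: "4 * Q \<le> (1 - t) * (16 * Q)"
    proof -
      have "(1/2) * (16 * Q) \<le> (1 - t) * (16 * Q)" using t Q by (intro mult_right_mono) auto
      then show ?thesis using Q by simp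
    qed
    have "(1 - t) * (t * S) \<le> (1 - t) * ((s + 4 * t) * (t * real N) + 16 * Q)"
      using 1 2 3 4 by (simp add: algebra_simps)
    then have "t * S \<le> (s + 4 * t) * (t * real N) + 16 * Q"
      using t by (simp add: mult_le_cancel_left)
    then show ?thesis using t by (simp add: field_simps)
  qed
  have lo: "s * real N \<le> S + 4 * t * real N + 16 * Q / t"
  proof (cases "s \<le> t")
    case True
    then have "s * real N \<le> 4 * t * real N" using t by (intro mult_right_mono) auto
    moreover have "0 \<le> 16 * Q / t" using Q t by simp
    ultimately show ?thesis using S by simp
  next
    case False
    have "(s - t) * (t * real N) \<le> (s - t) * ((1 + t) * (g + Q))"
      using b1(1) False by (intro mult_left_mono) auto
    also have "\<dots> = (1 + t) * ((s - t) * g - Q) + (1 + t) * ((s - t) * Q + Q)"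
      by (simp add: algebra_simps)
    also have "\<dots> \<le> (1 + t) * (t * S) + (1 + t) * (2 * Q)"
    proof -
      have "(s - t) * Q \<le> 1 * Q" using s t Q by (intro mult_right_mono) auto
      then show ?thesis using bs(2) t by (intro add_mono mult_left_mono) auto
    qed
    finally have 1: "(s - t) * (t * real N) \<le> (1 + t) * (t * S + 2 * Q)" by (simp add: algebra_simps)
    have 3: "(1 + t) * (s - 4 * t) * (t * real N) \<le> (s - t) * (t * real N)"
    proof (intro mult_right_mono)
      have "t * s \<le> t * 1" using t s by (intro mult_left_mono) auto
      moreover have "0 \<le> t * t" by simp
      ultimately show "(1 + t) * (s - 4 * t) \<le> s - t" using t by (simp add: algebra_simps)
    qed (use t in auto)
    have "(1 + t) * ((s - 4 * t) * (t * real N)) \<le> (1 + t) * (t * S + 2 * Q)"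
      using 1 3 by (simp add: algebra_simps)
    then have "(s - 4 * t) * (t * real N) \<le> t * S + 2 * Q"
      using t by (simp add: mult_le_cancel_left)
    also have "\<dots> \<le> t * S + 16 * Q" using Q by simp
    finally show ?thesis using t by (simp add: field_simps)
  qed
  from up lo show ?thesis unfolding S_def[symmetric] Q_def by (simp add: abs_le_iff)
qed

lemma floor_count_tendsto:
  assumes \<alpha>: "\<alpha> \<notin> \<rat>" and s: "0 \<le> s" "s \<le> 1"
  shows "(\<lambda>N. floor_count \<alpha> N s / real N) \<longlonglongrightarrow> s"
proof (rule LIMSEQ_I)
  fix e :: real assume e: "0 < e"
  \<comment> \<open>A translation \<open>t < 1 / M\<close> then satisfies \<open>t \<le> 1/2\<close>
    and \<open>t < e / 8\<close>, so that \<open>4 * t * N\<close> uses up half of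
    \<open>e * N\<close>. The other half absorbs the constant \<open>C\<close> once \<open>N\<close>
    is large.\<close>
  define M where "M = nat \<lceil>max 2 (8 / e)\<rceil>"
  have M: "real M \<ge> 2" "real M \<ge> 8 / e" unfolding M_def by linarith+
  then have M0: "M > 0" by (cases M) auto
  obtain h k where hk: "0 < k" "\<bar>of_int k * \<alpha> - of_int h\<bar> < 1 / real M"
    using Dirichlet_approx[OF M0, of \<alpha>] by metis
  define t where "t = \<bar>of_int k * \<alpha> - of_int h\<bar>"
  have "of_int k * \<alpha> \<noteq> of_int h"
  proof
    assume "of_int k * \<alpha> = of_int h"
    then have "\<alpha> = of_int h / of_int k" using hk by (simp add: field_simps)
    then show False using \<alpha> by simp
  qed
  then have t0: "0 < t" by (simp add: t_def)
  have "1 / real M \<le> 1 / 2" using M by (simp add: field_simps)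
  then have t1: "t \<le> 1 / 2" using hk unfolding t_def by linarith
  have "1 / real M \<le> e / 8" using M e M0 by (simp add: field_simps)
  then have te: "t < e / 8" using hk unfolding t_def by linarith
  obtain q p where tq: "t = of_int q * \<alpha> + of_int p"
  proof (cases "of_int k * \<alpha> \<ge> of_int h")
    case True
    then show ?thesis using that[of k "- h"] by (simp add: t_def)
  next
    case False
    then show ?thesis using that[of "- k" h] by (simp add: t_def)
  qed
  define C where "C = 32 * \<bar>real_of_int q\<bar> / t"
  have bnd: "\<bar>floor_count \<alpha> N s - s * real N\<bar> \<le> 4 * t * real N + C" for N
    unfolding C_def by (rule abs_floor_count_diff_le[OF tq t0 t1 s])
  obtain n0 where n0: "real n0 > max 1 (2 * C / e)" using reals_Archimedean2 by blast
  show "\<exists>n0. \<forall>n\<ge>n0. norm (floor_count \<alpha> n s / real n - s) < e"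
  proof (intro exI allI impI)
    fix n assume "n0 \<le> n"
    then have n: "real n > 1" "real n > 2 * C / e" using n0 by linarith+
    have "C < e / 2 * real n" using n e by (simp add: field_simps)
    moreover have "4 * t * real n < e / 2 * real n"
      by (rule mult_strict_right_mono) (use te n in auto)
    ultimately have lt: "\<bar>floor_count \<alpha> n s - s * real n\<bar> < e * real n"
      using bnd[of n] by linarith
    have "floor_count \<alpha> n s / real n - s = (floor_count \<alpha> n s - s * real n) / real n"
      using n by (simp add: field_simps)
    then show "norm (floor_count \<alpha> n s / real n - s) < e"
      using lt n by (simp add: field_simps)
  qed
qed

section \<open>Cesaro means and indicators of intervals\<close>

definition has_mean :: "(nat \<Rightarrow> real) \<Rightarrow> real \<Rightarrow> bool" where
  "has_mean u I \<longleftrightarrow> (\<lambda>N. (\<Sum>n=1..N. u n) / real N) \<longlonglongrightarrow> I"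

lemma has_mean_add: "has_mean u I \<Longrightarrow> has_mean v J \<Longrightarrow> has_mean (\<lambda>n. u n + v n) (I + J)"
  unfolding has_mean_def sum.distrib add_divide_distrib by (rule tendsto_add)

lemma has_mean_diff: "has_mean u I \<Longrightarrow> has_mean v J \<Longrightarrow> has_mean (\<lambda>n. u n - v n) (I - J)"
  unfolding has_mean_def sum_subtractf diff_divide_distrib by (rule tendsto_diff)

lemma has_mean_cmult: "has_mean u I \<Longrightarrow> has_mean (\<lambda>n. c * u n) (c * I)"
  using tendsto_mult_left[of "\<lambda>N. (\<Sum>n=1..N. u n) / real N" I sequentially c]
  unfolding has_mean_def by (simp add: sum_distrib_left)

lemma has_mean_sum:
  "finite A \<Longrightarrow> (\<And>i. i \<in> A \<Longrightarrow> has_mean (u i) (I i)) \<Longrightarrow>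
    has_mean (\<lambda>n. \<Sum>i\<in>A. u i n) (\<Sum>i\<in>A. I i)"
proof (induction A rule: finite_induct)
  case empty
  then show ?case by (simp add: has_mean_def)
next
  case (insert x F)
  then show ?case by (simp add: has_mean_add)
qed

lemma has_mean_1: "has_mean (\<lambda>_. 1) 1"
proof -
  have "\<forall>\<^sub>F N in sequentially. 1 = (\<Sum>n=1..N. 1) / real N"
    using eventually_gt_at_top[of 0] by eventually_elim auto
  then show ?thesis unfolding has_mean_def by (rule Lim_transform_eventually[OF tendsto_const])
qed

text \<open>Floor differences yield the half-open interval \<open>{c..<d}\<close>. By irrationality
  the fractional parts of the multiples are distinct, so the endpoint \<open>d\<close> is met at
  most once and has mean 0.\<close>

lemma has_mean_indicator_frac:
  assumes \<alpha>: "\<alpha> \<notin> \<rat>" and cd: "0 \<le> c" "c \<le> d" "d \<le> 1"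
  shows "has_mean (\<lambda>n. indicator {c..d} (frac (real n * \<alpha>))) (d - c)"
proof -
  have halfopen: "(indicator {c..<d} (frac x) :: real) = of_int (\<lfloor>x\<rfloor> - \<lfloor>x - d\<rfloor>) - of_int (\<lfloor>x\<rfloor> - \<lfloor>x - c\<rfloor>)" for x
  proof -
    have f: "0 \<le> frac x" "frac x < 1" by (auto simp: frac_lt_1)
    have "\<lfloor>x - u\<rfloor> = \<lfloor>x\<rfloor> - (if frac x < u then 1 else 0)" if "0 \<le> u" "u \<le> 1" for u
    proof -
      have "frac x - u = x - u - of_int \<lfloor>x\<rfloor>" by (simp add: frac_def)
      then have "\<lfloor>x - u\<rfloor> = \<lfloor>x\<rfloor> + \<lfloor>frac x - u\<rfloor>" by (simp only: floor_diff_of_int)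
      also have "\<lfloor>frac x - u\<rfloor> = - (if frac x < u then 1 else 0)"
      proof (cases "frac x < u")
        case True
        moreover have "- 1 \<le> frac x - u" using f that by linarith
        ultimately show ?thesis by (simp add: floor_eq_iff)
      next
        case False
        moreover have "frac x - u < 1" using f that by linarith
        ultimately show ?thesis by (simp add: floor_eq_iff)
      qed
      finally show ?thesis by simp
    qed
    then show ?thesis using cd by (auto simp: indicator_def)
  qed
  have 1: "has_mean (\<lambda>n. indicator {c..<d} (frac (real n * \<alpha>))) (d - c)"
    unfolding halfopen
  proof (intro has_mean_diff)
    show "has_mean (\<lambda>n. of_int (\<lfloor>real n * \<alpha>\<rfloor> - \<lfloor>real n * \<alpha> - d\<rfloor>)) d"
      using floor_count_tendsto[OF \<alpha>, of d] cd unfolding has_mean_def floor_count_def by simp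
    show "has_mean (\<lambda>n. of_int (\<lfloor>real n * \<alpha>\<rfloor> - \<lfloor>real n * \<alpha> - c\<rfloor>)) c"
      using floor_count_tendsto[OF \<alpha>, of c] cd unfolding has_mean_def floor_count_def by simp
  qed
  have 2: "has_mean (\<lambda>n. indicator {d} (frac (real n * \<alpha>))) 0"
  proof -
    have uniq: "n = m" if "frac (real n * \<alpha>) = frac (real m * \<alpha>)" for n m
    proof (rule ccontr)
      assume "n \<noteq> m"
      have "(real n - real m) * \<alpha> = of_int (\<lfloor>real n * \<alpha>\<rfloor> - \<lfloor>real m * \<alpha>\<rfloor>)"
        using that by (simp add: frac_def algebra_simps)
      then have "\<alpha> = of_int (\<lfloor>real n * \<alpha>\<rfloor> - \<lfloor>real m * \<alpha>\<rfloor>) / (real n - real m)"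
        using \<open>n \<noteq> m\<close> by (simp add: field_simps)
      also have "\<dots> \<in> \<rat>" by (intro Rats_divide Rats_diff Rats_of_nat Rats_of_int)
      finally show False using \<alpha> by simp
    qed
    have bnd: "0 \<le> (\<Sum>n=1..N. indicator {d} (frac (real n * \<alpha>)) :: real)"
         "(\<Sum>n=1..N. indicator {d} (frac (real n * \<alpha>)) :: real) \<le> 1" for N
    proof -
      have "(\<Sum>n=1..N. indicator {d} (frac (real n * \<alpha>)) :: real) =
          real (card {n \<in> {1..N}. frac (real n * \<alpha>) = d})"
        by (simp add: indicator_def sum.If_cases Int_def)
      also have "card {n \<in> {1..N}. frac (real n * \<alpha>) = d} \<le> Suc 0"
        by (subst card_le_Suc0_iff_eq) (auto intro: uniq)
      finally show "(\<Sum>n=1..N. indicator {d} (frac (real n * \<alpha>)) :: real) \<le> 1" by simp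
    qed (auto intro!: sum_nonneg)
    show ?thesis unfolding has_mean_def
    proof (rule tendsto_sandwich[of "\<lambda>_. 0" _ _ "\<lambda>N. 1 / real N"])
      show "(\<lambda>N. 1 / real N) \<longlonglongrightarrow> 0" by (rule lim_1_over_n)
      show "\<forall>\<^sub>F N in sequentially. (\<Sum>n=1..N. indicator {d} (frac (real n * \<alpha>))) / real N \<le> 1 / real N"
        using bnd(2) by (intro always_eventually allI divide_right_mono) auto
    qed (use bnd(1) in \<open>auto intro!: always_eventually divide_nonneg_nonneg\<close>)
  qed
  have "indicator {c..<d} x + indicator {d} x = (indicator {c..d} x :: real)" for x
    using cd by (auto simp: indicator_def)
  with has_mean_add[OF 1 2] show ?thesis by simp
qed

lemma has_mean_indicator_rmod:
  assumes w: "0 < w" and z: "z \<notin> {w * q | q. q \<in> \<rat>}" and cd: "0 \<le> c" "c \<le> d" "d \<le> w"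
  shows "has_mean (\<lambda>n. indicator {c..d} ((real n * z) rmod w)) ((d - c) / w)"
proof -
  have \<alpha>: "z / w \<notin> \<rat>"
  proof
    assume "z / w \<in> \<rat>"
    moreover have "z = w * (z / w)" using w by simp
    ultimately show False using z by blast
  qed
  have "indicator {c..d} ((real n * z) rmod w) = (indicator {c / w..d / w} (frac (real n * (z / w))) :: real)" for n
    using w by (simp add: rmod_conv_frac indicator_def field_simps)
  moreover have "has_mean (\<lambda>n. indicator {c / w..d / w} (frac (real n * (z / w)))) (d / w - c / w)"
    by (rule has_mean_indicator_frac[OF \<alpha>]) (use w cd in \<open>auto simp: field_simps\<close>)
  ultimately show ?thesis by (simp add: diff_divide_distrib)
qed

lemma equidistributed_mod_multiples:
  assumes "0 < w" "z \<notin> {w * q | q. q \<in> \<rat>}"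
  shows "equidistributed_mod w (\<lambda>n. real n * z)"
  unfolding equidistributed_mod_def
proof (intro allI impI, elim conjE)
  fix c d assume "0 \<le> c" "c \<le> d" "d \<le> w"
  then have "has_mean (\<lambda>n. indicator {c..d} ((real n * z) rmod w)) ((d - c) / w)"
    by (rule has_mean_indicator_rmod[OF assms])
  moreover have "(\<Sum>n=1..N. indicator {c..d} ((real n * z) rmod w)) =
      real (card {n \<in> {1..N}. (real n * z) rmod w \<in> {c..d}})" for N
    by (simp add: indicator_def sum.If_cases Int_def)
  ultimately show "(\<lambda>N. real (card {n \<in> {1..N}. (real n * z) rmod w \<in> {c..d}}) / real N) \<longlonglongrightarrow> (d - c) / w"
    unfolding has_mean_def by simp
qed

subsection \<open>Means of Riemann integrable functions along an equidistributed sequence\<close>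

lemma tagged_division_of_partition:
  fixes x \<xi> :: "nat \<Rightarrow> real"
  assumes "0 < m" and "\<And>i. i < m \<Longrightarrow> x i < x (Suc i)" and "\<And>i. i < m \<Longrightarrow> \<xi> i \<in> {x i..x (Suc i)}"
  shows "(\<lambda>i. (\<xi> i, {x i..x (Suc i)})) ` {..<m} tagged_division_of {x 0..x m} \<and> x 0 < x m"
  using assms
proof (induction m rule: nat_induct_non_zero)
  case 1
  then show ?case by (auto simp: lessThan_Suc intro!: tagged_division_of_self_real)
next
  case (Suc n)
  have IH: "(\<lambda>i. (\<xi> i, {x i..x (Suc i)})) ` {..<n} tagged_division_of {x 0..x n}" and lt: "x 0 < x n"
    using Suc by auto
  have lt': "x n < x (Suc n)" using Suc.prems by auto
  have 2: "{(\<xi> n, {x n..x (Suc n)})} tagged_division_of {x n..x (Suc n)}"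
    by (rule tagged_division_of_self_real) (use Suc.prems in auto)
  have "((\<lambda>i. (\<xi> i, {x i..x (Suc i)})) ` {..<n} \<union> {(\<xi> n, {x n..x (Suc n)})}) tagged_division_of
      ({x 0..x n} \<union> {x n..x (Suc n)})"
    by (rule tagged_division_Un[OF IH 2]) (auto simp: interior_atLeastAtMost_real)
  moreover have "{x 0..x n} \<union> {x n..x (Suc n)} = {x 0..x (Suc n)}" using lt lt' by auto
  ultimately show ?case using lt lt' by (simp add: lessThan_Suc)
qed

lemma has_Riemann_integral_uminus:
  "has_Riemann_integral h I a b \<Longrightarrow> has_Riemann_integral (\<lambda>x. - h x) (- I) a b"
  unfolding has_Riemann_integral_def
proof (intro allI impI)
  fix e :: real
  assume h: "\<forall>\<epsilon>>0. \<exists>\<delta>>0. \<forall>D. D tagged_division_of {a..b} \<and> (\<forall>(x, K)\<in>D. measure lborel K < \<delta>) \<longrightarrow>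
      \<bar>(\<Sum>(x, K)\<in>D. measure lborel K * h x) - I\<bar> < \<epsilon>" and e: "0 < e"
  have eq: "\<bar>(\<Sum>(x, K)\<in>D. measure lborel K * - h x) - - I\<bar> = \<bar>(\<Sum>(x, K)\<in>D. measure lborel K * h x) - I\<bar>" for D
    by (simp add: case_prod_beta sum_negf)
  show "\<exists>\<delta>>0. \<forall>D. D tagged_division_of {a..b} \<and> (\<forall>(x, K)\<in>D. measure lborel K < \<delta>) \<longrightarrow>
      \<bar>(\<Sum>(x, K)\<in>D. measure lborel K * - h x) - - I\<bar> < e"
    unfolding eq by (rule h[THEN spec, THEN mp, OF e])
qed

text \<open>\<open>M i\<close> is the supremum of \<open>h\<close> on a cell. Tags that attain it up
  to \<open>\<eta>\<close> turn the upper sum into a Riemann sum with an error of at most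
  \<open>e / 2\<close>, and that Riemann sum is itself within \<open>e / 2\<close> of
  \<open>I\<close>. The one-sided form suffices, because \<open>- h\<close> takes care of lower
  sums.\<close>

lemma has_Riemann_integral_upper_sum:
  assumes h: "has_Riemann_integral h I c d" and B: "\<And>x. x \<in> {c..d} \<Longrightarrow> h x \<le> B" and e: "0 < e"
  shows "\<exists>\<delta>>0. \<forall>m x. 0 < m \<longrightarrow> x 0 = c \<longrightarrow> x m = d \<longrightarrow> (\<forall>i j. i < j \<longrightarrow> j \<le> m \<longrightarrow> x i < x j) \<longrightarrow>
      (\<forall>i<m. x (Suc i) - x i < \<delta>) \<longrightarrow>
      (\<exists>M. (\<forall>i<m. \<forall>u\<in>{x i..x (Suc i)}. h u \<le> M i) \<and> (\<Sum>i<m. M i * (x (Suc i) - x i)) < I + e)"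
proof -
  obtain \<delta> where \<delta>: "\<delta> > 0" and D: "\<And>D. D tagged_division_of {c..d} \<Longrightarrow>
      (\<forall>(x, K)\<in>D. measure lborel K < \<delta>) \<Longrightarrow> \<bar>(\<Sum>(x, K)\<in>D. measure lborel K * h x) - I\<bar> < e / 2"
    using h[unfolded has_Riemann_integral_def, rule_format, of "e / 2"] e by auto
  show ?thesis
  proof (intro exI[of _ \<delta>] conjI[OF \<delta>] allI impI)
    fix m and x :: "nat \<Rightarrow> real"
    assume m: "0 < m" and x0: "x 0 = c" and xm: "x m = d"
      and inc': "\<forall>i j. i < j \<longrightarrow> j \<le> m \<longrightarrow> x i < x j"
      and mesh': "\<forall>i<m. x (Suc i) - x i < \<delta>"
    have inc: "x i < x j" if "i < j" "j \<le> m" for i j using inc' that by blast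
    have mesh: "x (Suc i) - x i < \<delta>" if "i < m" for i using mesh' that by blast
    have step: "x i < x (Suc i)" if "i < m" for i using inc[of i "Suc i"] that by simp
    have mono: "x i \<le> x j" if "i \<le> j" "j \<le> m" for i j
      using inc[of i j] that by (cases "i = j") auto
    have sub: "{x i..x (Suc i)} \<subseteq> {c..d}" if "i < m" for i
      using mono[of 0 i] mono[of "Suc i" m] that x0 xm by auto
    define M where "M i = (SUP u\<in>{x i..x (Suc i)}. h u)" for i
    define \<eta> where "\<eta> = e / (2 * (d - c))"
    have cd: "c < d" using inc[of 0 m] m x0 xm by simp
    have \<eta>: "0 < \<eta>" using e cd by (simp add: \<eta>_def)
    have bdd: "bdd_above (h ` {x i..x (Suc i)})" if "i < m" for i
      using sub[OF that] B by (intro bdd_aboveI2[where M = B]) auto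
    have "\<exists>u\<in>{x i..x (Suc i)}. M i - \<eta> < h u" if "i < m" for i
      unfolding M_def using \<eta> step[OF that]
      by (subst less_cSUP_iff[OF _ bdd[OF that], symmetric]) auto
    then obtain \<xi> where \<xi>: "\<And>i. i < m \<Longrightarrow> \<xi> i \<in> {x i..x (Suc i)}" "\<And>i. i < m \<Longrightarrow> M i - \<eta> < h (\<xi> i)"
      by metis
    let ?D = "(\<lambda>i. (\<xi> i, {x i..x (Suc i)})) ` {..<m}"
    have "?D tagged_division_of {c..d}"
      using tagged_division_of_partition[OF m, of x \<xi>] step \<xi>(1) x0 xm by simp
    moreover have "\<forall>(x, K)\<in>?D. measure lborel K < \<delta>"
      using mesh step by (auto simp: less_imp_le)
    ultimately have "\<bar>(\<Sum>(x, K)\<in>?D. measure lborel K * h x) - I\<bar> < e / 2" by (rule D)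
    \<comment> \<open>A tagged division is a set, so a sum over indices needs distinct cells; their
      left endpoints are strictly increasing.\<close>
    moreover have "(\<Sum>(x, K)\<in>?D. measure lborel K * h x) = (\<Sum>i<m. (x (Suc i) - x i) * h (\<xi> i))"
    proof (subst sum.reindex)
      show "inj_on (\<lambda>i. (\<xi> i, {x i..x (Suc i)})) {..<m}"
      proof (rule inj_onI)
        fix i j assume ij: "i \<in> {..<m}" "j \<in> {..<m}" "(\<xi> i, {x i..x (Suc i)}) = (\<xi> j, {x j..x (Suc j)})"
        then have "x i = x j" using step[of i] step[of j] by (simp add: Icc_eq_Icc)
        then show "i = j" using inc[of i j] inc[of j i] ij by (cases i j rule: linorder_cases) auto
      qed
      show "sum ((\<lambda>(x, K). measure lborel K * h x) \<circ> (\<lambda>i. (\<xi> i, {x i..x (Suc i)}))) {..<m} =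
          (\<Sum>i<m. (x (Suc i) - x i) * h (\<xi> i))"
        using step by (intro sum.cong) (auto simp: less_imp_le)
    qed
    ultimately have 1: "(\<Sum>i<m. (x (Suc i) - x i) * h (\<xi> i)) < I + e / 2" by linarith
    have "(\<Sum>i<m. M i * (x (Suc i) - x i)) \<le> (\<Sum>i<m. (x (Suc i) - x i) * h (\<xi> i) + \<eta> * (x (Suc i) - x i))"
    proof (rule sum_mono)
      fix i assume "i \<in> {..<m}"
      then have "M i \<le> h (\<xi> i) + \<eta>" "0 \<le> x (Suc i) - x i" using \<xi>(2)[of i] step[of i] by auto
      then have "M i * (x (Suc i) - x i) \<le> (h (\<xi> i) + \<eta>) * (x (Suc i) - x i)"
        by (rule mult_right_mono)
      then show "M i * (x (Suc i) - x i) \<le> (x (Suc i) - x i) * h (\<xi> i) + \<eta> * (x (Suc i) - x i)"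
        by (simp add: algebra_simps)
    qed
    also have "\<dots> = (\<Sum>i<m. (x (Suc i) - x i) * h (\<xi> i)) + \<eta> * (x m - x 0)"
      by (simp add: sum.distrib sum_distrib_left[symmetric] sum_lessThan_telescope)
    also have "\<eta> * (x m - x 0) = e / 2" using cd by (simp add: x0 xm \<eta>_def divide_simps)
    also have "(\<Sum>i<m. (x (Suc i) - x i) * h (\<xi> i)) + e / 2 < I + e" using 1 by simp
    finally have "(\<Sum>i<m. M i * (x (Suc i) - x i)) < I + e" .
    moreover have "\<forall>i<m. \<forall>u\<in>{x i..x (Suc i)}. h u \<le> M i"
      unfolding M_def using bdd by (auto intro!: cSUP_upper)
    ultimately show "\<exists>M. (\<forall>i<m. \<forall>u\<in>{x i..x (Suc i)}. h u \<le> M i) \<and>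
        (\<Sum>i<m. M i * (x (Suc i) - x i)) < I + e" by blast
  qed
qed

text \<open>Half-open cells do not count division points twice. Each is a difference of two
  indicators of \<open>{..t i}\<close>, and these telescope.\<close>

lemma indicator_sum_partition:
  fixes t :: "nat \<Rightarrow> real"
  assumes "\<And>i. i < m \<Longrightarrow> t i \<le> t (Suc i)"
  shows "(indicator {t 0<..t m} s :: real) = (\<Sum>i<m. indicator {t i<..t (Suc i)} s)"
proof -
  have "t 0 \<le> t m" using assms by (induction m) (auto intro: order_trans)
  then have "indicator {t 0<..t m} s = (indicator {..t m} s - indicator {..t 0} s :: real)"
    by (auto simp: indicator_def)
  also have "\<dots> = (\<Sum>i<m. indicator {..t (Suc i)} s - indicator {..t i} s)"
    by (rule sum_lessThan_telescope[symmetric])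
  also have "\<dots> = (\<Sum>i<m. indicator {t i<..t (Suc i)} s)"
    using assms by (intro sum.cong) (auto simp: indicator_def, force)
  finally show ?thesis .
qed

text \<open>Stated through means of interval indicators alone, so that the residues and their
  reflection in the period are both instances.\<close>

locale equidistributed_sequence =
  fixes w :: real and s :: "nat \<Rightarrow> real"
  assumes w_pos: "0 < w"
    and mean_Icc: "\<And>c d. \<lbrakk>0 \<le> c; c \<le> d; d \<le> w\<rbrakk> \<Longrightarrow> has_mean (\<lambda>n. indicator {c..d} (s n)) ((d - c) / w)"
begin

lemma mean_Ioc:
  assumes "0 \<le> c" "c \<le> d" "d \<le> w"
  shows "has_mean (\<lambda>n. indicator {c<..d} (s n)) ((d - c) / w)"
proof -
  have "has_mean (\<lambda>n. indicator {c..d} (s n) - indicator {c..c} (s n)) ((d - c) / w - (c - c) / w)"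
    by (intro has_mean_diff mean_Icc) (use assms in auto)
  moreover have "indicator {c..d} u - indicator {c..c} u = (indicator {c<..d} u :: real)" for u
    using assms by (auto simp: indicator_def)
  ultimately show ?thesis by simp
qed

text \<open>Equal cells in \<open>t\<close> are carried by \<open>p\<close> to a fine partition in
  \<open>x\<close>, where the upper sum of \<open>h\<close> is available. This gives a step function
  in \<open>t\<close> above the given function, and equidistribution evaluates the mean of a step
  function exactly.\<close>

lemma mean_substitution_upper:
  fixes p p' h :: "real \<Rightarrow> real"
  assumes ab: "0 \<le> a" "a < b" "b \<le> w"
    and deriv: "\<And>t. t \<in> {a..b} \<Longrightarrow> (p has_real_derivative p' t) (at t)"
    and cont: "continuous_on {a..b} p'" and nonneg: "\<And>t. t \<in> {a..b} \<Longrightarrow> 0 \<le> p' t"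
    and mono: "strict_mono_on {a..b} p"
    and h: "has_Riemann_integral h I (p a) (p b)" and B: "\<And>x. x \<in> {p a..p b} \<Longrightarrow> \<bar>h x\<bar> \<le> B"
    and e: "0 < e"
  shows "\<forall>\<^sub>F N in sequentially.
    (\<Sum>n=1..N. indicator {a<..b} (s n) * (h (p (s n)) * p' (s n))) / real N < I / w + e"
proof -
  have mem: "p t \<in> {p a..p b}" if "t \<in> {a..b}" for t
    using strict_mono_on_leD[OF mono, of a t] strict_mono_on_leD[OF mono, of t b] that by auto
  have B0: "0 \<le> B" using B[of "p a"] mem[of a] ab by auto
  \<comment> \<open>Replacing \<open>p'\<close> by its value at one point of each cell costs at most
    \<open>B * \<eta> * (b - a) \<le> e * w / 2\<close>; the \<open>B + 1\<close> keeps the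
    denominator positive when \<open>B = 0\<close>.\<close>
  define \<eta> where "\<eta> = e * w / (2 * (B + 1) * (b - a))"
  have \<eta>: "0 < \<eta>" using e w_pos B0 ab by (simp add: \<eta>_def)
  have ew: "0 < e * w / 2" using e w_pos by simp
  have Bu: "\<And>x. x \<in> {p a..p b} \<Longrightarrow> h x \<le> B" using B by (auto simp: abs_le_iff)
  obtain \<delta> where \<delta>: "0 < \<delta>" and upper:
    "\<forall>m x. 0 < m \<longrightarrow> x 0 = p a \<longrightarrow> x m = p b \<longrightarrow> (\<forall>i j. i < j \<longrightarrow> j \<le> m \<longrightarrow> x i < x j) \<longrightarrow>
      (\<forall>i<m. x (Suc i) - x i < \<delta>) \<longrightarrow>
      (\<exists>M. (\<forall>i<m. \<forall>u\<in>{x i..x (Suc i)}. h u \<le> M i) \<and> (\<Sum>i<m. M i * (x (Suc i) - x i)) < I + e * w / 2)"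
    using has_Riemann_integral_upper_sum[OF h Bu ew] by blast
  have contp: "continuous_on {a..b} p"
    by (rule DERIV_continuous_on) (use deriv in \<open>auto intro: has_field_derivative_at_within\<close>)
  have "uniformly_continuous_on {a..b} p" "uniformly_continuous_on {a..b} p'"
    by (auto intro!: compact_uniformly_continuous contp cont)
  note uc = this[unfolded uniformly_continuous_on_def]
  obtain d1 where d1: "d1 > 0" "\<And>u v. \<lbrakk>u \<in> {a..b}; v \<in> {a..b}; dist v u < d1\<rbrakk> \<Longrightarrow> dist (p v) (p u) < \<delta>"
    using uc(1) \<delta> by blast
  obtain d2 where d2: "d2 > 0" "\<And>u v. \<lbrakk>u \<in> {a..b}; v \<in> {a..b}; dist v u < d2\<rbrakk> \<Longrightarrow> dist (p' v) (p' u) < \<eta>"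
    using uc(2) \<eta> by blast
  obtain m where m: "real m > max 1 ((b - a) / min d1 d2)" using reals_Archimedean2 by blast
  then have m0: "0 < m" by (cases m) auto
  define t where "t i = a + real i * ((b - a) / real m)" for i
  have t0: "t 0 = a" and tm: "t m = b" using m0 by (simp_all add: t_def)
  have gap: "t (Suc i) - t i = (b - a) / real m" for i using m0 by (simp add: t_def field_simps)
  have gap_pos: "0 < (b - a) / real m" using ab m0 by simp
  have "(b - a) / real m < min d1 d2" using m d1(1) d2(1) ab m0 by (simp add: field_simps del: min_less_iff_conj)
  then have gap_small: "(b - a) / real m < d1" "(b - a) / real m < d2" by auto
  have t_inc: "t i < t j" if "i < j" for i j
    unfolding t_def using that gap_pos by (intro add_strict_left_mono mult_strict_right_mono) auto
  have t_le: "t i \<le> t j" if "i \<le> j" for i j using t_inc[of i j] that by (cases "i = j") auto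
  have t_mem: "t i \<in> {a..b}" if "i \<le> m" for i using t_le[of 0 i] t_le[of i m] that t0 tm by auto
  have t_sub: "{t i..t (Suc i)} \<subseteq> {a..b}" if "i < m" for i
    using t_mem[of i] t_mem[of "Suc i"] that by auto
  define x where "x i = p (t i)" for i
  have "\<exists>M. (\<forall>i<m. \<forall>u\<in>{x i..x (Suc i)}. h u \<le> M i) \<and> (\<Sum>i<m. M i * (x (Suc i) - x i)) < I + e * w / 2"
  proof (intro upper[rule_format])
    show "0 < m" "x 0 = p a" "x m = p b" by (simp_all add: x_def t0 tm m0)
    show "x i < x j" if "i < j" "j \<le> m" for i j
      unfolding x_def using that by (intro strict_mono_onD[OF mono] t_mem t_inc) auto
    show "x (Suc i) - x i < \<delta>" if "i < m" for i
      using d1(2)[of "t i" "t (Suc i)"] t_mem[of i] t_mem[of "Suc i"] that gap[of i] gap_small gap_pos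
      by (auto simp: x_def dist_real_def)
  qed
  then obtain M where M: "\<And>i u. i < m \<Longrightarrow> u \<in> {x i..x (Suc i)} \<Longrightarrow> h u \<le> M i"
    and M_sum: "(\<Sum>i<m. M i * (x (Suc i) - x i)) < I + e * w / 2"
    by metis
  \<comment> \<open>With the mean value point as sample point, the length of the image cell is
    exactly \<open>p'\<close> at that point times the length of the cell, so the mean of the step
    function contains the upper sum of \<open>h\<close> without further error.\<close>
  have "\<exists>\<tau>. \<tau> \<in> {t i..t (Suc i)} \<and> x (Suc i) - x i = (t (Suc i) - t i) * p' \<tau>" if "i < m" for i
  proof -
    have "\<exists>z. z > t i \<and> z < t (Suc i) \<and> p (t (Suc i)) - p (t i) = (t (Suc i) - t i) * p' z"
      by (rule MVT2) (use t_inc[of i "Suc i"] t_sub[OF that] deriv in auto)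
    then show ?thesis by (auto simp: x_def intro: less_imp_le)
  qed
  then obtain \<tau> where \<tau>: "\<And>i. i < m \<Longrightarrow> \<tau> i \<in> {t i..t (Suc i)}"
     "\<And>i. i < m \<Longrightarrow> x (Suc i) - x i = (t (Suc i) - t i) * p' (\<tau> i)"
    by metis
  let ?J = "\<lambda>i. {t i<..t (Suc i)}"
  \<comment> \<open>The first term bounds \<open>h (p u)\<close> by \<open>M i\<close>, the second
    pays for replacing \<open>p' u\<close> by \<open>p' (\<tau> i)\<close>.\<close>
  define c where "c i = M i * p' (\<tau> i) + B * \<eta>" for i
  have pt: "h (p u) * p' u \<le> c i" if i: "i < m" and u: "u \<in> ?J i" for i u
  proof -
    have u': "u \<in> {t i..t (Suc i)}" using u by auto
    have ab': "u \<in> {a..b}" "\<tau> i \<in> {a..b}" using u' \<tau>(1)[OF i] t_sub[OF i] by auto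
    have "\<bar>u - \<tau> i\<bar> \<le> t (Suc i) - t i" using u' \<tau>(1)[OF i] by auto
    then have "dist u (\<tau> i) < d2" using gap[of i] gap_small by (simp add: dist_real_def)
    then have "\<bar>p' u - p' (\<tau> i)\<bar> \<le> \<eta>" using d2(2)[of "\<tau> i" u] ab' by (simp add: dist_real_def)
    then have "\<bar>h (p u)\<bar> * \<bar>p' u - p' (\<tau> i)\<bar> \<le> B * \<eta>"
      using B[OF mem[OF ab'(1)]] B0 by (intro mult_mono) auto
    then have 1: "h (p u) * (p' u - p' (\<tau> i)) \<le> B * \<eta>" by (simp add: abs_mult[symmetric])
    have "p (t i) \<le> p u" "p u \<le> p (t (Suc i))"
      using strict_mono_on_leD[OF mono] u' ab' t_mem[of i] t_mem[of "Suc i"] i by auto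
    then have "h (p u) \<le> M i" using M[OF i] by (auto simp: x_def)
    then have "h (p u) * p' (\<tau> i) \<le> M i * p' (\<tau> i)" using nonneg ab' by (intro mult_right_mono) auto
    with 1 show ?thesis by (simp add: c_def algebra_simps)
  qed
  have ind: "(indicator {a<..b} u :: real) = (\<Sum>i<m. indicator (?J i) u)" for u
    using indicator_sum_partition[of m t u] t_le t0 tm by simp
  have le: "indicator {a<..b} u * (h (p u) * p' u) \<le> (\<Sum>i<m. c i * indicator (?J i) u)" for u
    unfolding ind sum_distrib_right
  proof (intro sum_mono)
    fix i assume "i \<in> {..<m}"
    then show "indicator (?J i) u * (h (p u) * p' u) \<le> c i * indicator (?J i) u"
      using pt[of i u] by (cases "u \<in> ?J i") auto
  qed
  have lim: "has_mean (\<lambda>n. \<Sum>i<m. c i * indicator (?J i) (s n)) (\<Sum>i<m. c i * ((t (Suc i) - t i) / w))"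
  proof (intro has_mean_sum has_mean_cmult mean_Ioc)
    fix i assume "i \<in> {..<m}"
    then show "0 \<le> t i" "t i \<le> t (Suc i)" "t (Suc i) \<le> w"
      using t_mem[of i] t_mem[of "Suc i"] t_le[of i "Suc i"] ab by auto
  qed auto
  have "(\<Sum>i<m. c i * ((t (Suc i) - t i) / w)) = (\<Sum>i<m. M i * (x (Suc i) - x i) + B * \<eta> * (t (Suc i) - t i)) / w"
    unfolding sum_divide_distrib
    by (intro sum.cong) (auto simp: c_def \<tau>(2) algebra_simps add_divide_distrib diff_divide_distrib)
  also have "\<dots> = ((\<Sum>i<m. M i * (x (Suc i) - x i)) + B * \<eta> * (b - a)) / w"
    by (simp only: sum.distrib sum_distrib_left[symmetric] sum_lessThan_telescope t0 tm)
  also have "\<dots> < (I + e * w / 2 + e * w / 2) / w"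
  proof (rule divide_strict_right_mono[OF add_less_le_mono[OF M_sum]])
    have "B * \<eta> * (b - a) = (B / (B + 1)) * (e * w / 2)"
      using ab B0 by (simp add: \<eta>_def divide_simps)
    also have "\<dots> \<le> 1 * (e * w / 2)"
      using B0 e w_pos by (intro mult_right_mono) (auto simp: divide_simps)
    finally show "B * \<eta> * (b - a) \<le> e * w / 2" by simp
  qed (use w_pos in auto)
  also have "\<dots> = I / w + e" using w_pos by (simp add: field_simps)
  finally have "\<forall>\<^sub>F N in sequentially. (\<Sum>n=1..N. \<Sum>i<m. c i * indicator (?J i) (s n)) / real N < I / w + e"
    using lim unfolding has_mean_def by (rule order_tendstoD(2)[rotated])
  then show ?thesis
  proof eventually_elim
    case (elim N)
    have "(\<Sum>n=1..N. indicator {a<..b} (s n) * (h (p (s n)) * p' (s n))) / real N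
        \<le> (\<Sum>n=1..N. \<Sum>i<m. c i * indicator (?J i) (s n)) / real N"
      by (intro divide_right_mono sum_mono le) auto
    with elim show ?case by linarith
  qed
qed

text \<open>The upper estimate for \<open>h\<close> controls the limit from above, the same estimate
  for \<open>- h\<close> from below.\<close>

lemma mean_substitution:
  fixes p p' h :: "real \<Rightarrow> real"
  assumes ab: "0 \<le> a" "a < b" "b \<le> w"
    and deriv: "\<And>t. t \<in> {a..b} \<Longrightarrow> (p has_real_derivative p' t) (at t)"
    and cont: "continuous_on {a..b} p'" and nonneg: "\<And>t. t \<in> {a..b} \<Longrightarrow> 0 \<le> p' t"
    and mono: "strict_mono_on {a..b} p"
    and h: "has_Riemann_integral h I (p a) (p b)" and B: "\<And>x. x \<in> {p a..p b} \<Longrightarrow> \<bar>h x\<bar> \<le> B"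
  shows "has_mean (\<lambda>n. indicator {a<..b} (s n) * (h (p (s n)) * p' (s n))) (I / w)"
  unfolding has_mean_def
proof (rule order_tendstoI)
  fix y assume "I / w < y"
  then show "\<forall>\<^sub>F N in sequentially.
      (\<Sum>n=1..N. indicator {a<..b} (s n) * (h (p (s n)) * p' (s n))) / real N < y"
    using mean_substitution_upper[OF ab deriv cont nonneg mono h B, of "y - I / w"] by simp
next
  fix y assume "y < I / w"
  moreover have "\<And>x. x \<in> {p a..p b} \<Longrightarrow> \<bar>- h x\<bar> \<le> B" using B by simp
  ultimately have "\<forall>\<^sub>F N in sequentially.
      (\<Sum>n=1..N. indicator {a<..b} (s n) * (- h (p (s n)) * p' (s n))) / real N < - I / w + (I / w - y)"
    by (intro mean_substitution_upper[OF ab deriv cont nonneg mono has_Riemann_integral_uminus[OF h]]) auto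
  then show "\<forall>\<^sub>F N in sequentially.
      y < (\<Sum>n=1..N. indicator {a<..b} (s n) * (h (p (s n)) * p' (s n))) / real N"
    by eventually_elim (simp add: sum_negf)
qed

end

subsection \<open>Local analysis of holomorphic functions\<close>

text \<open>Expresses leading terms as plain limits, so that behaviour at 0 can be computed without
  Laurent series.\<close>

lemma Taylor_remainder_limit:
  assumes f: "f holomorphic_on ball z0 r" and r: "0 < r"
  shows "((\<lambda>z. (f z - (\<Sum>i<n. (deriv ^^ i) f z0 / fact i * (z - z0) ^ i)) / (z - z0) ^ n)
    \<longlongrightarrow> (deriv ^^ n) f z0 / fact n) (at z0)"
proof (rule LIM_offset_zero_cancel)
  define a where "a k = (deriv ^^ k) f z0 / fact k" for k
  have "((\<lambda>h. (f (z0 + h) - (\<Sum>i<n. a i * h ^ i)) / h ^ n) \<longlongrightarrow> a (0 + n)) (at 0)"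
  proof (rule powser_limit_0_strong[OF r])
    fix h :: complex assume h: "h \<noteq> 0" "norm h < r"
    have "(\<lambda>k. a k * h ^ k) sums f (z0 + h)"
      using holomorphic_power_series[OF f, of "z0 + h"] h by (simp add: a_def dist_norm)
    then have "(\<lambda>k. a (k + n) * h ^ (k + n) / h ^ n) sums ((f (z0 + h) - (\<Sum>i<n. a i * h ^ i)) / h ^ n)"
      by (intro sums_divide sums_split_initial_segment)
    then show "(\<lambda>k. a (k + n) * h ^ k) sums ((f (z0 + h) - (\<Sum>i<n. a i * h ^ i)) / h ^ n)"
      using h by (simp add: power_add)
  qed
  then show "((\<lambda>h. (f (z0 + h) - (\<Sum>i<n. (deriv ^^ i) f z0 / fact i * (z0 + h - z0) ^ i)) / (z0 + h - z0) ^ n)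
    \<longlongrightarrow> (deriv ^^ n) f z0 / fact n) (at 0)"
    by (simp add: a_def)
qed

text \<open>Comparing leading terms: a solution vanishing to order exactly \<open>k\<close> at the singular
  point \<open>z0\<close> must satisfy the indicial equation \<open>k (k - 1) = h z0\<close>.\<close>

lemma singular_ode_solution_eq_0:
  fixes D :: "complex \<Rightarrow> complex"
  assumes D: "D holomorphic_on S" and S: "open S" "connected S" "z0 \<in> S"
    and ode: "\<forall>\<^sub>F z in at z0. (z - z0)\<^sup>2 * (deriv ^^ 2) D z = h z * D z"
    and h: "(h \<longlongrightarrow> h0) (at z0)"
    and init: "\<And>k. k < m \<Longrightarrow> (deriv ^^ k) D z0 = 0"
    and indicial: "\<And>k. m \<le> k \<Longrightarrow> h0 \<noteq> of_nat k * (of_nat k - 1)" and m: "2 \<le> m"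
    and z: "z \<in> S"
  shows "D z = 0"
proof -
  have "(deriv ^^ n) D z0 = 0" for n
  proof (rule ccontr)
    assume "(deriv ^^ n) D z0 \<noteq> 0"
    define k where "k = (LEAST k. (deriv ^^ k) D z0 \<noteq> 0)"
    have k: "(deriv ^^ k) D z0 \<noteq> 0"
      unfolding k_def by (rule LeastI[of _ n]) fact
    have least: "(deriv ^^ i) D z0 = 0" if "i < k" for i
      using not_less_Least[of i "\<lambda>k. (deriv ^^ k) D z0 \<noteq> 0"] that unfolding k_def by blast
    have mk: "m \<le> k" using init k by (meson not_less)
    then obtain j where kj: "k = j + 2" using m by (metis add.commute le_Suc_ex order_trans)
    obtain r where r: "r > 0" "ball z0 r \<subseteq> S" using S openE by blast
    have Dr: "D holomorphic_on ball z0 r" using D r(2) by (rule holomorphic_on_subset)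
    have D2r: "(deriv ^^ 2) D holomorphic_on ball z0 r"
      by (intro holomorphic_higher_deriv Dr) auto
    have shift: "(deriv ^^ i) ((deriv ^^ 2) D) = (deriv ^^ (i + 2)) D" for i
      by (simp only: funpow_add o_apply)
    have "((\<lambda>z. (D z - (\<Sum>i<k. (deriv ^^ i) D z0 / fact i * (z - z0) ^ i)) / (z - z0) ^ k)
        \<longlongrightarrow> (deriv ^^ k) D z0 / fact k) (at z0)"
      by (rule Taylor_remainder_limit[OF Dr r(1)])
    then have lim0: "((\<lambda>z. D z / (z - z0) ^ k) \<longlongrightarrow> (deriv ^^ k) D z0 / fact k) (at z0)"
      by (simp add: least)
    have zero: "(\<Sum>i<j. (deriv ^^ i) ((deriv ^^ 2) D) z0 / fact i * (z - z0) ^ i) = 0" for z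
    proof (rule sum.neutral, safe)
      fix i assume "i < j"
      then have "(deriv ^^ i) ((deriv ^^ 2) D) z0 = 0" unfolding shift by (intro least) (simp add: kj)
      then show "(deriv ^^ i) ((deriv ^^ 2) D) z0 / fact i * (z - z0) ^ i = 0" by simp
    qed
    \<comment> \<open>\<open>D\<close> has order \<open>k\<close> with leading coefficient its
      \<open>k\<close>-th derivative over \<open>fact k\<close>; for the second derivative the order
      is \<open>j = k - 2\<close> and the same value is divided by \<open>fact j\<close>. The
      quotient \<open>fact k / fact j\<close> is the \<open>k * (k - 1)\<close> of the indicial
      equation.\<close>
    have lim2: "((\<lambda>z. (deriv ^^ 2) D z / (z - z0) ^ j) \<longlongrightarrow> (deriv ^^ k) D z0 / fact j) (at z0)"
      using Taylor_remainder_limit[OF D2r r(1), of j] unfolding zero unfolding shift kj by (simp only: diff_zero)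
    have "((\<lambda>z. h z * (D z / (z - z0) ^ k)) \<longlongrightarrow> h0 * ((deriv ^^ k) D z0 / fact k)) (at z0)"
      by (rule tendsto_mult[OF h lim0])
    moreover have "\<forall>\<^sub>F z in at z0. h z * (D z / (z - z0) ^ k) = (deriv ^^ 2) D z / (z - z0) ^ j"
      using ode eventually_neq_at_within[of z0]
    proof eventually_elim
      case (elim z)
      then have "h z * (D z / (z - z0) ^ k) = (z - z0)\<^sup>2 * (deriv ^^ 2) D z / (z - z0) ^ k"
        by (simp only: times_divide_eq_right)
      also have "\<dots> = (deriv ^^ 2) D z / (z - z0) ^ j"
        using elim(2) by (simp add: kj power2_eq_square)
      finally show ?case .
    qed
    ultimately have "((\<lambda>z. (deriv ^^ 2) D z / (z - z0) ^ j) \<longlongrightarrow> h0 * ((deriv ^^ k) D z0 / fact k)) (at z0)"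
      by (rule Lim_transform_eventually)
    from tendsto_unique[OF _ this lim2] have "h0 * ((deriv ^^ k) D z0 / fact k) = (deriv ^^ k) D z0 / fact j"
      by simp
    then have "h0 * fact j = fact k" using k by (simp add: field_simps)
    also have "(fact k :: complex) = of_nat k * (of_nat k - 1) * fact j"
      by (simp add: kj algebra_simps)
    finally have "h0 = of_nat k * (of_nat k - 1)" by simp
    with indicial[OF mk] show False by contradiction
  qed
  then show ?thesis using holomorphic_fun_eq_0_on_connected[OF D S(1,2) _ S(3) z] by blast
qed

text \<open>Only the values of the terms get a summable majorant. For holomorphic functions uniform
  convergence passes to the derivatives, here along the finite subsets of \<open>A\<close>.\<close>

lemma has_field_derivative_infsum:
  fixes f f' :: "'a \<Rightarrow> complex \<Rightarrow> complex"
  assumes r: "0 < r"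
    and deriv: "\<And>w u. w \<in> A \<Longrightarrow> u \<in> cball z r \<Longrightarrow> (f w has_field_derivative f' w u) (at u)"
    and bound: "\<And>w u. w \<in> A \<Longrightarrow> u \<in> cball z r \<Longrightarrow> norm (f w u) \<le> M w"
    and M: "M summable_on A"
  shows "((\<lambda>u. \<Sum>\<^sub>\<infinity>w\<in>A. f w u) has_field_derivative (\<Sum>\<^sub>\<infinity>w\<in>A. f' w z)) (at z)"
proof -
  have ulim: "uniform_limit (cball z r) (\<lambda>X u. \<Sum>w\<in>X. f w u) (\<lambda>u. \<Sum>\<^sub>\<infinity>w\<in>A. f w u) (finite_subsets_at_top A)"
    by (rule Weierstrass_m_test_general[OF bound M])
  have ev: "\<forall>\<^sub>F X in finite_subsets_at_top A. finite X \<and> X \<subseteq> A"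
    using eventually_finite_subsets_at_top by force
  have "\<forall>\<^sub>F X in finite_subsets_at_top A. continuous_on (cball z r) (\<lambda>u. \<Sum>w\<in>X. f w u) \<and>
      (\<forall>u\<in>ball z r. ((\<lambda>u. \<Sum>w\<in>X. f w u) has_field_derivative (\<Sum>w\<in>X. f' w u)) (at u))"
    using ev
  proof eventually_elim
    case (elim X)
    then show ?case
      by (auto intro!: continuous_on_sum DERIV_sum deriv
          intro: DERIV_continuous_on[OF has_field_derivative_at_within[OF deriv]])
  qed
  then obtain g' where g': "\<And>u. u \<in> ball z r \<Longrightarrow>
      ((\<lambda>u. \<Sum>\<^sub>\<infinity>w\<in>A. f w u) has_field_derivative g' u) (at u) \<and>
      ((\<lambda>X. \<Sum>w\<in>X. f' w u) \<longlongrightarrow> g' u) (finite_subsets_at_top A)"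
    by (rule has_complex_derivative_uniform_limit[OF _ ulim _ r]) auto
  have "((\<lambda>w. f' w z) has_sum g' z) A" using g'[of z] r by (simp add: has_sum_def)
  then have "(\<Sum>\<^sub>\<infinity>w\<in>A. f' w z) = g' z" by (rule infsumI)
  then show ?thesis using g'[of z] r by simp
qed

subsection \<open>Lattices\<close>

text \<open>The exponent 3/2 exceeds 1, and its double is the exponent 3 of the lattice sum that is
  to be compared with products of two such terms.\<close>

lemma summable_on_int_powr:
  "(\<lambda>n::int. (1 + \<bar>real_of_int n\<bar>) powr (-3/2)) summable_on UNIV"
proof -
  have "summable (\<lambda>n. real (Suc n) powr (-3/2))"
    by (subst summable_Suc_iff) (simp add: summable_real_powr_iff)
  then have nat: "(\<lambda>n::nat. (1 + real n) powr (-3/2)) summable_on UNIV"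
    by (intro summable_nonneg_imp_summable_on) (auto simp: add.commute)
  have "(\<lambda>n::int. (1 + \<bar>real_of_int n\<bar>) powr (-3/2)) summable_on range int"
    by (subst summable_on_reindex) (use nat in \<open>auto simp: o_def\<close>)
  moreover have "(\<lambda>n::int. (1 + \<bar>real_of_int n\<bar>) powr (-3/2)) summable_on range (\<lambda>n. - int n)"
    by (subst summable_on_reindex) (use nat in \<open>auto simp: o_def inj_on_def\<close>)
  ultimately have "(\<lambda>n::int. (1 + \<bar>real_of_int n\<bar>) powr (-3/2)) summable_on range int \<union> range (\<lambda>n. - int n)"
    by (rule summable_on_union)
  moreover have "range int \<union> range (\<lambda>n. - int n) = UNIV"
  proof -
    have "n \<in> range int \<union> range (\<lambda>n. - int n)" for n
      by (cases n rule: int_cases2) auto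
    then show ?thesis by blast
  qed
  ultimately show ?thesis by simp
qed

lemma summable_on_int_prod_powr:
  "(\<lambda>(m::int, n::int). (1 + \<bar>real_of_int m\<bar>) powr (-3/2) * (1 + \<bar>real_of_int n\<bar>) powr (-3/2))
    summable_on UNIV \<times> UNIV"
proof -
  let ?q = "\<lambda>n::int. (1 + \<bar>real_of_int n\<bar>) powr (-3/2)"
  have q: "(?q has_sum infsum ?q UNIV) UNIV" using summable_on_int_powr by (rule has_sum_infsum)
  show ?thesis
  proof (rule summable_on_SigmaI)
    show "((\<lambda>n. case (m, n) of (m, n) \<Rightarrow> ?q m * ?q n) has_sum ?q m * infsum ?q UNIV) UNIV" for m
      using has_sum_cmult_right[OF q, of "?q m"] by simp
    show "(\<lambda>m. ?q m * infsum ?q UNIV) summable_on UNIV"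
      by (rule summable_on_cmult_left[OF summable_on_int_powr])
  qed auto
qed

locale complex_lattice =
  fixes \<Lambda> :: "complex set"
  assumes lattice: "is_lattice \<Lambda>"
begin

text \<open>\<open>Im (cnj w1 * w2)\<close> is the oriented area of the parallelogram spanned by the
  basis: linear independence in a form by which one can divide.\<close>

lemma basis:
  obtains w1 w2 where "Im (cnj w1 * w2) \<noteq> 0" "\<Lambda> = {of_int m * w1 + of_int n * w2 | m n. True}"
proof -
  obtain w1 w2 where w: "w1 \<noteq> w2" "independent {w1, w2}"
    and \<Lambda>: "\<Lambda> = {of_int m * w1 + of_int n * w2 | m n. True}"
    using lattice unfolding is_lattice_def by blast
  have "Im (cnj w1 * w2) \<noteq> 0"
  proof
    assume "Im (cnj w1 * w2) = 0"
    then have r: "cnj w1 * w2 = of_real (Re (cnj w1 * w2))" by (simp add: complex_eq_iff)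
    have w1: "w1 \<noteq> 0" using w(2) dependent_zero[of "{w1, w2}"] by auto
    have "w2 \<in> span {w1}"
    proof -
      have "of_real ((cmod w1)\<^sup>2) * w2 = of_real (Re (cnj w1 * w2)) * w1"
        unfolding complex_norm_square r[symmetric] by (simp add: mult_ac)
      then have "w2 = (Re (cnj w1 * w2) / (cmod w1)\<^sup>2) *\<^sub>R w1"
        using w1 by (simp add: scaleR_conv_of_real field_simps)
      then show ?thesis unfolding span_singleton by blast
    qed
    then show False using w independent_insert[of w2 "{w1}"] by (simp add: insert_commute)
  qed
  then show thesis using that \<Lambda> by blast
qed

lemma zero_mem [simp]: "0 \<in> \<Lambda>"
proof -
  obtain w1 w2 where "\<Lambda> = {of_int m * w1 + of_int n * w2 | m n. True}" by (rule basis)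
  then show ?thesis by (auto intro!: exI[of _ 0])
qed

lemma add_mem: "u \<in> \<Lambda> \<Longrightarrow> v \<in> \<Lambda> \<Longrightarrow> u + v \<in> \<Lambda>"
proof -
  assume uv: "u \<in> \<Lambda>" "v \<in> \<Lambda>"
  obtain w1 w2 where \<Lambda>: "\<Lambda> = {of_int m * w1 + of_int n * w2 | m n. True}" by (rule basis)
  from uv obtain m n m' n' where "u = of_int m * w1 + of_int n * w2" "v = of_int m' * w1 + of_int n' * w2"
    unfolding \<Lambda> by blast
  then have "u + v = of_int (m + m') * w1 + of_int (n + n') * w2" by (simp add: algebra_simps)
  then show ?thesis unfolding \<Lambda> by blast
qed

lemma minus_mem: "u \<in> \<Lambda> \<Longrightarrow> - u \<in> \<Lambda>"
proof -
  assume u: "u \<in> \<Lambda>"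
  obtain w1 w2 where \<Lambda>: "\<Lambda> = {of_int m * w1 + of_int n * w2 | m n. True}" by (rule basis)
  from u obtain m n where "u = of_int m * w1 + of_int n * w2"
    unfolding \<Lambda> by blast
  then have "- u = of_int (- m) * w1 + of_int (- n) * w2" by (simp add: algebra_simps)
  then show ?thesis unfolding \<Lambda> by blast
qed

lemma minus_mem_iff [simp]: "- u \<in> \<Lambda> \<longleftrightarrow> u \<in> \<Lambda>"
  using minus_mem[of u] minus_mem[of "- u"] by auto

lemma diff_mem: "u \<in> \<Lambda> \<Longrightarrow> v \<in> \<Lambda> \<Longrightarrow> u - v \<in> \<Lambda>"
  using add_mem[of u "- v"] by simp

lemma add_mem_iff: "v \<in> \<Lambda> \<Longrightarrow> u + v \<in> \<Lambda> \<longleftrightarrow> u \<in> \<Lambda>"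
  using add_mem[of u v] diff_mem[of "u + v" v] by auto

lemma of_int_mult_mem: "u \<in> \<Lambda> \<Longrightarrow> of_int k * u \<in> \<Lambda>"
proof -
  assume u: "u \<in> \<Lambda>"
  obtain w1 w2 where \<Lambda>: "\<Lambda> = {of_int m * w1 + of_int n * w2 | m n. True}" by (rule basis)
  from u obtain m n where "u = of_int m * w1 + of_int n * w2"
    unfolding \<Lambda> by blast
  then have "of_int k * u = of_int (k * m) * w1 + of_int (k * n) * w2" by (simp add: algebra_simps)
  then show ?thesis unfolding \<Lambda> by blast
qed

text \<open>Cramer's rule: pairing a lattice point with \<open>w1\<close> or \<open>w2\<close>
  through \<open>Im (cnj _ * _)\<close> isolates one coordinate times the area, and the pairing is
  at most the product of the norms.\<close>

lemma coordinates_bounded: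
  assumes im: "Im (cnj w1 * w2) \<noteq> 0"
  obtains C where "0 < C"
    "\<And>m n. \<bar>real_of_int m\<bar> \<le> C * cmod (of_int m * w1 + of_int n * w2)"
    "\<And>m n. \<bar>real_of_int n\<bar> \<le> C * cmod (of_int m * w1 + of_int n * w2)"
proof -
  define d where "d = \<bar>Im (cnj w1 * w2)\<bar>"
  define C where "C = (cmod w1 + cmod w2) / d"
  have d: "0 < d" using im by (simp add: d_def)
  have w1: "w1 \<noteq> 0" using im by auto
  have C: "0 < C" using d w1 by (auto simp: C_def intro!: divide_pos_pos add_pos_nonneg)
  have "\<bar>real_of_int m\<bar> \<le> C * cmod (of_int m * w1 + of_int n * w2) \<and>
      \<bar>real_of_int n\<bar> \<le> C * cmod (of_int m * w1 + of_int n * w2)" for m n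
  proof
    let ?w = "of_int m * w1 + of_int n * w2"
    have "Im (cnj w1 * ?w) = real_of_int n * Im (cnj w1 * w2)" "Im (cnj w2 * ?w) = - real_of_int m * Im (cnj w1 * w2)"
      by (simp_all add: algebra_simps)
    then have e: "\<bar>Im (cnj w1 * ?w)\<bar> = \<bar>real_of_int n\<bar> * d" "\<bar>Im (cnj w2 * ?w)\<bar> = \<bar>real_of_int m\<bar> * d"
      by (simp_all add: abs_mult d_def)
    have "\<bar>real_of_int n\<bar> * d \<le> cmod w1 * cmod ?w"
      using abs_Im_le_cmod[of "cnj w1 * ?w"] unfolding e by (simp add: norm_mult)
    also have "\<dots> \<le> (cmod w1 + cmod w2) * cmod ?w" by (intro mult_right_mono) auto
    finally show "\<bar>real_of_int n\<bar> \<le> C * cmod ?w" using d by (simp add: C_def field_simps)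
    have "\<bar>real_of_int m\<bar> * d \<le> cmod w2 * cmod ?w"
      using abs_Im_le_cmod[of "cnj w2 * ?w"] unfolding e by (simp add: norm_mult)
    also have "\<dots> \<le> (cmod w1 + cmod w2) * cmod ?w" by (intro mult_right_mono) auto
    finally show "\<bar>real_of_int m\<bar> \<le> C * cmod ?w" using d by (simp add: C_def field_simps)
  qed
  then show thesis using that C by blast
qed

lemma summable_inverse_cube: "(\<lambda>w. 1 / cmod w ^ 3) summable_on \<Lambda>"
proof -
  obtain w1 w2 where im: "Im (cnj w1 * w2) \<noteq> 0" and \<Lambda>: "\<Lambda> = {of_int m * w1 + of_int n * w2 | m n. True}"
    by (rule basis)
  obtain C where C: "0 < C" and Cm: "\<And>m n. \<bar>real_of_int m\<bar> \<le> C * cmod (of_int m * w1 + of_int n * w2)"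
    and Cn: "\<And>m n. \<bar>real_of_int n\<bar> \<le> C * cmod (of_int m * w1 + of_int n * w2)"
    using coordinates_bounded[OF im] by metis
  define \<phi> where "\<phi> = (\<lambda>(m, n). of_int m * w1 + of_int n * w2)"
  have inj: "inj \<phi>"
  proof (rule injI, clarify)
    fix m n m' n' assume "\<phi> (m, n) = \<phi> (m', n')"
    then have 0: "of_int (m - m') * w1 + of_int (n - n') * w2 = 0"
      by (simp add: \<phi>_def algebra_simps)
    show "m = m' \<and> n = n'"
      using Cm[of "m - m'" "n - n'"] Cn[of "n - n'" "m - m'"] unfolding 0 by simp
  qed
  have range: "\<Lambda> = range \<phi>" unfolding \<Lambda> \<phi>_def by auto
  let ?q = "\<lambda>n::int. (1 + \<bar>real_of_int n\<bar>) powr (-3/2)"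
  have "(\<lambda>x. 1 / cmod (\<phi> x) ^ 3) summable_on UNIV \<times> UNIV"
  proof (rule summable_on_comparison_test)
    show "(\<lambda>x. (2 * C) ^ 3 * (case x of (m, n) \<Rightarrow> ?q m * ?q n)) summable_on UNIV \<times> UNIV"
      by (intro summable_on_cmult_right summable_on_int_prod_powr)
    show "0 \<le> 1 / cmod (\<phi> x) ^ 3" for x by simp
    show "1 / cmod (\<phi> x) ^ 3 \<le> (2 * C) ^ 3 * (case x of (m, n) \<Rightarrow> ?q m * ?q n)" for x
    proof -
      obtain m n where x: "x = (m, n)" by (cases x)
      show ?thesis
      proof (cases "x = (0, 0)")
        case True
        \<comment> \<open>At the origin the summand is \<open>1 / 0 = 0\<close>, which is why 0 need
          not be removed from the lattice here.\<close>
        then show ?thesis using C by (simp add: \<phi>_def)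
      next
        case False
        let ?r = "cmod (\<phi> x)"
        have "m \<noteq> 0 \<or> n \<noteq> 0" using False x by auto
        then have "1 \<le> \<bar>real_of_int m\<bar> \<or> 1 \<le> \<bar>real_of_int n\<bar>" by linarith
        moreover have m: "\<bar>real_of_int m\<bar> \<le> C * ?r" and n: "\<bar>real_of_int n\<bar> \<le> C * ?r"
          using Cm[of m n] Cn[of n m] by (simp_all add: \<phi>_def x)
        ultimately have r: "1 \<le> C * ?r" by linarith
        then have r0: "0 < ?r" using C by (metis mult_zero_right not_one_le_zero norm_ge_zero less_le)
        \<comment> \<open>Each factor is at most \<open>2 * C * ?r\<close>, so the power
          \<open>-3/2\<close> of the product splits the inverse cube evenly between the two
          coordinates.\<close>
        have "(1 + \<bar>real_of_int m\<bar>) * (1 + \<bar>real_of_int n\<bar>) \<le> (2 * C * ?r) * (2 * C * ?r)"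
          by (intro mult_mono) (use m n r in auto)
        then have "((2 * C * ?r) powr 2) powr (-3/2) \<le> ((1 + \<bar>real_of_int m\<bar>) * (1 + \<bar>real_of_int n\<bar>)) powr (-3/2)"
          using C r0 by (intro powr_mono2') (auto simp: power2_eq_square intro!: mult_pos_pos add_pos_nonneg)
        also have "\<dots> = ?q m * ?q n" by (simp add: powr_mult)
        also have "((2 * C * ?r) powr 2) powr (-3/2) = (2 * C * ?r) powr (-3)"
          by (subst powr_powr) simp
        also have "\<dots> = 1 / (2 * C * ?r) ^ 3"
        proof -
          have "0 \<le> 2 * C * ?r" using C by simp
          then show ?thesis by (simp only: powr_minus inverse_eq_divide powr_numeral)
        qed
        finally show ?thesis using C r0 by (simp add: x field_simps)
      qed
    qed
  qed
  then show ?thesis unfolding range by (subst summable_on_reindex[OF inj]) (simp add: o_def)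
qed

lemma finite_norm_le: "finite {w \<in> \<Lambda>. cmod w \<le> R}"
proof -
  obtain w1 w2 where im: "Im (cnj w1 * w2) \<noteq> 0" and \<Lambda>: "\<Lambda> = {of_int m * w1 + of_int n * w2 | m n. True}"
    by (rule basis)
  obtain C where C: "0 < C" and Cm: "\<And>m n. \<bar>real_of_int m\<bar> \<le> C * cmod (of_int m * w1 + of_int n * w2)"
    and Cn: "\<And>m n. \<bar>real_of_int n\<bar> \<le> C * cmod (of_int m * w1 + of_int n * w2)"
    using coordinates_bounded[OF im] by metis
  define K where "K = \<lceil>C * R\<rceil>"
  have "{w \<in> \<Lambda>. cmod w \<le> R} \<subseteq> (\<lambda>(m, n). of_int m * w1 + of_int n * w2) ` ({- K..K} \<times> {- K..K})"
  proof
    fix w assume "w \<in> {w \<in> \<Lambda>. cmod w \<le> R}"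
    then obtain m n where w: "w = of_int m * w1 + of_int n * w2" and R: "cmod w \<le> R" unfolding \<Lambda> by blast
    have CR: "C * cmod w \<le> C * R" using R C by (intro mult_left_mono) auto
    have "\<bar>real_of_int m\<bar> \<le> C * R" "\<bar>real_of_int n\<bar> \<le> C * R"
      using Cm[of m n] Cn[of n m] CR unfolding w by linarith+
    then have "\<bar>m\<bar> \<le> K" "\<bar>n\<bar> \<le> K" unfolding K_def by linarith+
    then show "w \<in> (\<lambda>(m, n). of_int m * w1 + of_int n * w2) ` ({- K..K} \<times> {- K..K})"
      unfolding w by (intro image_eqI[of _ _ "(m, n)"]) auto
  qed
  then show ?thesis by (rule finite_subset) auto
qed

lemma discrete:
  obtains d where "0 < d" "\<And>w. w \<in> \<Lambda> \<Longrightarrow> w \<noteq> z \<Longrightarrow> d \<le> cmod (z - w)"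
proof -
  obtain d where d: "0 < d" "\<And>w. w \<in> {w \<in> \<Lambda>. cmod w \<le> cmod z + 1} \<Longrightarrow> w \<noteq> z \<Longrightarrow> d \<le> dist z w"
    using finite_set_avoid[OF finite_norm_le] by metis
  have "min d 1 \<le> cmod (z - w)" if "w \<in> \<Lambda>" "w \<noteq> z" for w
  proof (cases "cmod w \<le> cmod z + 1")
    case True
    then show ?thesis using d(2)[of w] that by (simp add: dist_norm)
  next
    case False
    then show ?thesis using norm_triangle_ineq2[of w z] by (simp add: norm_minus_commute)
  qed
  then show thesis using that[of "min d 1"] d(1) by auto
qed

lemma closed_subset: "A \<subseteq> \<Lambda> \<Longrightarrow> closed A"
proof -
  assume A: "A \<subseteq> \<Lambda>"
  have "open (- A)"
  proof (rule openI)
    fix z assume z: "z \<in> - A"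
    obtain d where "0 < d" "\<And>w. w \<in> \<Lambda> \<Longrightarrow> w \<noteq> z \<Longrightarrow> d \<le> cmod (z - w)" using discrete[of z] by metis
    then show "\<exists>e>0. ball z e \<subseteq> - A" using A z
      by (intro exI[of _ d]) (auto simp: subset_iff dist_norm, force)
  qed
  then show ?thesis by (simp add: closed_def)
qed

lemma countable: "countable \<Lambda>"
proof -
  obtain w1 w2 where "\<Lambda> = {of_int m * w1 + of_int n * w2 | m n. True}" by (rule basis)
  then have "\<Lambda> = range (\<lambda>(m, n). of_int m * w1 + of_int n * w2)" by auto
  then show ?thesis by (metis countable_image countableI_type)
qed

lemma open_compl: "open (- \<Lambda>)" and open_compl': "open (- (\<Lambda> - {0}))"
  using closed_subset[of \<Lambda>] closed_subset[of "\<Lambda> - {0}"] by (auto simp: closed_def)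

lemma connected_compl: "connected (- \<Lambda>)"
  unfolding Compl_eq_Diff_UNIV by (rule connected_open_diff_countable) (auto simp: countable)

text \<open>The second bound compares every term near \<open>z\<close> with a power of
  \<open>cmod w\<close>; the first keeps the denominators away from 0. If
  \<open>cmod w > 2 * R\<close>, then \<open>u\<close> takes away at most half of
  \<open>cmod w\<close>; for the remaining \<open>w\<close> the second bound follows from the first.
  Excluding only nonzero lattice points allows \<open>z = 0\<close>.\<close>

lemma local_bounds:
  assumes "z \<notin> \<Lambda> - {0}"
  obtains r c where "0 < r" "0 < c"
    "\<And>u w. \<lbrakk>u \<in> cball z r; w \<in> \<Lambda> - {0}\<rbrakk> \<Longrightarrow> r \<le> cmod (u - w)"
    "\<And>u w. \<lbrakk>u \<in> cball z r; w \<in> \<Lambda> - {0}\<rbrakk> \<Longrightarrow> c * cmod w \<le> cmod (u - w)"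
proof -
  obtain d where d: "0 < d" "\<And>w. w \<in> \<Lambda> \<Longrightarrow> w \<noteq> z \<Longrightarrow> d \<le> cmod (z - w)" using discrete[of z] by metis
  define r where "r = d / 2"
  define R where "R = cmod z + r"
  define c where "c = min (1/2) (r / (2 * R))"
  have r: "0 < r" using d by (simp add: r_def)
  have R: "0 < R" using r by (simp add: R_def add_nonneg_pos)
  have c: "0 < c" using r R by (simp add: c_def)
  have 1: "r \<le> cmod (u - w)" if "u \<in> cball z r" "w \<in> \<Lambda> - {0}" for u w
  proof -
    have "d \<le> cmod (z - w)" using that assms by (intro d(2)) auto
    also have "\<dots> \<le> cmod (z - u) + cmod (u - w)" using norm_triangle_ineq[of "z - u" "u - w"] by simp
    also have "\<dots> \<le> r + cmod (u - w)" using that by (simp add: dist_norm)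
    finally show ?thesis by (simp add: r_def)
  qed
  have 2: "c * cmod w \<le> cmod (u - w)" if uw: "u \<in> cball z r" "w \<in> \<Lambda> - {0}" for u w
  proof (cases "cmod w \<le> 2 * R")
    case True
    have "c * cmod w \<le> (r / (2 * R)) * (2 * R)"
      using True r R c by (intro mult_mono) (auto simp: c_def)
    then show ?thesis using 1[OF uw] R by simp
  next
    case False
    have "cmod u \<le> cmod z + cmod (u - z)" using norm_triangle_ineq[of z "u - z"] by simp
    then have "cmod u \<le> R" using uw by (simp add: R_def dist_norm norm_minus_commute)
    moreover have "cmod w - cmod u \<le> cmod (u - w)" using norm_triangle_ineq2[of w u] by (simp add: norm_minus_commute)
    moreover have "c * cmod w \<le> (1/2) * cmod w" by (intro mult_right_mono) (auto simp: c_def)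
    ultimately show ?thesis using False by linarith
  qed
  from that[OF r c 1 2] show thesis by blast
qed

end

subsection \<open>The Weierstrass function\<close>

context complex_lattice
begin

text \<open>Without the term \<open>w = 0\<close> the sum stays holomorphic at 0, where for even
  \<open>k\<close> its value is the Eisenstein series of weight \<open>k\<close>.\<close>

definition lattice_sum :: "nat \<Rightarrow> complex \<Rightarrow> complex" where
  "lattice_sum k z = (\<Sum>\<^sub>\<infinity>w\<in>\<Lambda> - {0}. 1 / (z - w) ^ k)"

definition regular_part :: "complex \<Rightarrow> complex" where
  "regular_part z = (\<Sum>\<^sub>\<infinity>w\<in>\<Lambda> - {0}. 1 / (z - w)\<^sup>2 - 1 / w\<^sup>2)"

abbreviation wp :: "complex \<Rightarrow> complex" where
  "wp \<equiv> weierstrass_p \<Lambda>"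

definition wp' :: "complex \<Rightarrow> complex" where
  "wp' z = - 2 / z ^ 3 - 2 * lattice_sum 3 z"

definition wp'' :: "complex \<Rightarrow> complex" where
  "wp'' z = 6 / z ^ 4 + 6 * lattice_sum 4 z"

lemma wp_eq: "wp z = 1 / z\<^sup>2 + regular_part z"
  by (simp add: weierstrass_p_def regular_part_def)

lemma invariant_g2_eq: "invariant_g2 \<Lambda> = 60 * lattice_sum 4 0"
  by (simp add: invariant_g2_def lattice_sum_def)

lemma invariant_g3_eq: "invariant_g3 \<Lambda> = 140 * lattice_sum 6 0"
  by (simp add: invariant_g3_def lattice_sum_def)

lemma summable_inverse_cube': "(\<lambda>w. C * (1 / cmod w ^ 3)) summable_on \<Lambda> - {0}"
  by (intro summable_on_cmult_right summable_on_subset[OF summable_inverse_cube]) auto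

lemma lattice_sum_bound:
  assumes "z \<notin> \<Lambda> - {0}" and k: "3 \<le> k"
  obtains r C where "0 < r" "\<And>u w. \<lbrakk>u \<in> cball z r; w \<in> \<Lambda> - {0}\<rbrakk> \<Longrightarrow> u \<noteq> w"
    "\<And>u w. \<lbrakk>u \<in> cball z r; w \<in> \<Lambda> - {0}\<rbrakk> \<Longrightarrow> cmod (1 / (u - w) ^ k) \<le> C * (1 / cmod w ^ 3)"
proof -
  obtain r c where r: "0 < r" and c: "0 < c"
    and b1: "\<And>u w. \<lbrakk>u \<in> cball z r; w \<in> \<Lambda> - {0}\<rbrakk> \<Longrightarrow> r \<le> cmod (u - w)"
    and b2: "\<And>u w. \<lbrakk>u \<in> cball z r; w \<in> \<Lambda> - {0}\<rbrakk> \<Longrightarrow> c * cmod w \<le> cmod (u - w)"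
    using local_bounds[OF assms(1)] by metis
  have "cmod (1 / (u - w) ^ k) \<le> (1 / (c ^ 3 * r ^ (k - 3))) * (1 / cmod w ^ 3)"
    if uw: "u \<in> cball z r" "w \<in> \<Lambda> - {0}" for u w
  proof -
    have "0 < cmod (u - w)" using b1[OF uw] r by linarith
    then have pos: "0 < cmod ((u - w) ^ k)" by (simp only: norm_power zero_less_power)
    have "(c * cmod w) ^ 3 * r ^ (k - 3) \<le> cmod (u - w) ^ 3 * cmod (u - w) ^ (k - 3)"
      using b1[OF uw] b2[OF uw] c r by (intro mult_mono power_mono) auto
    also have "\<dots> = cmod ((u - w) ^ k)" using k by (simp add: norm_power power_add[symmetric])
    finally have "1 / cmod ((u - w) ^ k) \<le> 1 / ((c * cmod w) ^ 3 * r ^ (k - 3))"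
      using c r uw pos by (intro divide_left_mono mult_pos_pos zero_less_power) auto
    then show ?thesis by (simp add: norm_divide power_mult_distrib mult_ac)
  qed
  moreover have "u \<noteq> w" if "u \<in> cball z r" "w \<in> \<Lambda> - {0}" for u w
    using b1[OF that] r by auto
  ultimately show thesis using that r by blast
qed

lemma lattice_sum_summable:
  assumes "z \<notin> \<Lambda> - {0}" "3 \<le> k"
  shows "(\<lambda>w. 1 / (z - w) ^ k) summable_on \<Lambda> - {0}"
proof -
  obtain r C where r: "0 < r"
    and b: "\<And>u w. \<lbrakk>u \<in> cball z r; w \<in> \<Lambda> - {0}\<rbrakk> \<Longrightarrow> cmod (1 / (u - w) ^ k) \<le> C * (1 / cmod w ^ 3)"
    using lattice_sum_bound[OF assms] by metis
  show ?thesis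
    by (rule abs_summable_summable, rule summable_on_comparison_test[OF summable_inverse_cube'[of C]])
       (use b[of z] r in auto)
qed

lemma has_field_derivative_inverse_power:
  "u \<noteq> w \<Longrightarrow> ((\<lambda>u. 1 / (u - w) ^ k) has_field_derivative - of_nat k * (1 / (u - w) ^ Suc k)) (at u)"
  for u w :: complex
proof -
  assume uw: "u \<noteq> w"
  have "((\<lambda>u. (u - w) ^ k) has_field_derivative of_nat k * (u - w) ^ (k - 1)) (at u)"
    by (auto intro!: derivative_eq_intros)
  from DERIV_inverse'[OF this]
  have "((\<lambda>u. 1 / (u - w) ^ k) has_field_derivative
      - (inverse ((u - w) ^ k) * (of_nat k * (u - w) ^ (k - 1)) * inverse ((u - w) ^ k))) (at u)"
    using uw by (simp add: inverse_eq_divide)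
  also have "- (inverse ((u - w) ^ k) * (of_nat k * (u - w) ^ (k - 1)) * inverse ((u - w) ^ k)) =
      - of_nat k * (1 / (u - w) ^ Suc k)"
    using uw by (cases k) (simp_all add: divide_simps)
  finally show ?thesis .
qed

lemma lattice_sum_deriv:
  assumes "z \<notin> \<Lambda> - {0}" "3 \<le> k"
  shows "(lattice_sum k has_field_derivative - of_nat k * lattice_sum (Suc k) z) (at z)"
proof -
  obtain r C where r: "0 < r" and ne: "\<And>u w. \<lbrakk>u \<in> cball z r; w \<in> \<Lambda> - {0}\<rbrakk> \<Longrightarrow> u \<noteq> w"
    and b: "\<And>u w. \<lbrakk>u \<in> cball z r; w \<in> \<Lambda> - {0}\<rbrakk> \<Longrightarrow> cmod (1 / (u - w) ^ k) \<le> C * (1 / cmod w ^ 3)"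
    using lattice_sum_bound[OF assms] by metis
  have "((\<lambda>u. \<Sum>\<^sub>\<infinity>w\<in>\<Lambda> - {0}. 1 / (u - w) ^ k) has_field_derivative
      (\<Sum>\<^sub>\<infinity>w\<in>\<Lambda> - {0}. - of_nat k * (1 / (z - w) ^ Suc k))) (at z)"
    by (rule has_field_derivative_infsum[OF r has_field_derivative_inverse_power[OF ne] b summable_inverse_cube'])
  also have "(\<Sum>\<^sub>\<infinity>w\<in>\<Lambda> - {0}. - of_nat k * (1 / (z - w) ^ Suc k)) = - of_nat k * lattice_sum (Suc k) z"
    unfolding lattice_sum_def by (rule infsum_cmult_right) (use lattice_sum_summable[of z "Suc k"] assms in auto)
  finally show ?thesis unfolding lattice_sum_def[abs_def] by (simp add: lattice_sum_def)
qed

text \<open>The subtracted \<open>1 / w^2\<close> gains one power: locally the difference is of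
  order \<open>1 / cmod w ^ 3\<close>, which is summable, whereas \<open>1 / cmod w ^ 2\<close> is
  not.\<close>

lemma regular_part_deriv:
  assumes z: "z \<notin> \<Lambda> - {0}"
  shows "(regular_part has_field_derivative - 2 * lattice_sum 3 z) (at z)"
proof -
  obtain r c where r: "0 < r" and c: "0 < c"
    and b1: "\<And>u w. \<lbrakk>u \<in> cball z r; w \<in> \<Lambda> - {0}\<rbrakk> \<Longrightarrow> r \<le> cmod (u - w)"
    and b2: "\<And>u w. \<lbrakk>u \<in> cball z r; w \<in> \<Lambda> - {0}\<rbrakk> \<Longrightarrow> c * cmod w \<le> cmod (u - w)"
    using local_bounds[OF assms(1)] by metis
  define R where "R = cmod z + r"
  have R: "0 < R" using r by (simp add: R_def add_nonneg_pos)
  have bound: "cmod (1 / (u - w)\<^sup>2 - 1 / w\<^sup>2) \<le> (R / c\<^sup>2 + R / c) * (1 / cmod w ^ 3)"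
    if uw: "u \<in> cball z r" "w \<in> \<Lambda> - {0}" for u w
  proof -
    let ?a = "cmod (u - w)" and ?b = "cmod w"
    have b: "0 < ?b" using uw by auto
    have a: "0 < ?a" using b1[OF uw] r by linarith
    have "cmod u \<le> cmod z + cmod (u - z)" using norm_triangle_ineq[of z "u - z"] by simp
    then have u: "cmod u \<le> R" using uw by (simp add: R_def dist_norm norm_minus_commute)
    have w: "w \<noteq> 0" "u - w \<noteq> 0" using a b by auto
    \<comment> \<open>The factor \<open>2 * w - u\<close> is written as \<open>w - (u - w)\<close>
      so that its norm is bounded by the two norms that occur in the denominator.\<close>
    have "1 / (u - w)\<^sup>2 - 1 / w\<^sup>2 = u * (w - (u - w)) / ((u - w)\<^sup>2 * w\<^sup>2)"
      using w by (simp add: divide_simps) (simp add: algebra_simps power2_eq_square)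
    then have "cmod (1 / (u - w)\<^sup>2 - 1 / w\<^sup>2) = cmod u * cmod (w - (u - w)) / (?a\<^sup>2 * ?b\<^sup>2)"
      by (simp add: norm_mult norm_divide norm_power)
    also have "\<dots> \<le> R * (?b + ?a) / (?a\<^sup>2 * ?b\<^sup>2)"
      using u R norm_triangle_ineq4[of w "u - w"] by (intro divide_right_mono mult_mono) auto
    also have "\<dots> = R / (?a\<^sup>2 * ?b) + R / (?a * ?b\<^sup>2)"
      using a b by (simp add: divide_simps) (simp add: algebra_simps power2_eq_square)
    also have "\<dots> \<le> R / ((c * ?b)\<^sup>2 * ?b) + R / ((c * ?b) * ?b\<^sup>2)"
      using b2[OF uw] a b c R by (intro add_mono divide_left_mono mult_right_mono power_mono) (auto intro!: mult_pos_pos)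
    also have "\<dots> = (R / c\<^sup>2 + R / c) * (1 / ?b ^ 3)"
      using b c by (simp add: divide_simps) (simp add: algebra_simps power2_eq_square power3_eq_cube)
    finally show ?thesis .
  qed
  have deriv: "((\<lambda>u. 1 / (u - w)\<^sup>2 - 1 / w\<^sup>2) has_field_derivative - 2 * (1 / (u - w) ^ 3)) (at u)"
    if uw: "u \<in> cball z r" "w \<in> \<Lambda> - {0}" for u w
  proof -
    have "u \<noteq> w" using b1[OF uw] r by auto
    from DERIV_diff[OF has_field_derivative_inverse_power[OF this, of 2] DERIV_const] show ?thesis
      by (simp add: numeral_3_eq_3)
  qed
  have "((\<lambda>u. \<Sum>\<^sub>\<infinity>w\<in>\<Lambda> - {0}. 1 / (u - w)\<^sup>2 - 1 / w\<^sup>2) has_field_derivative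
      (\<Sum>\<^sub>\<infinity>w\<in>\<Lambda> - {0}. - 2 * (1 / (z - w) ^ 3))) (at z)"
    by (rule has_field_derivative_infsum[OF r deriv bound summable_inverse_cube'])
  also have "(\<Sum>\<^sub>\<infinity>w\<in>\<Lambda> - {0}. - 2 * (1 / (z - w) ^ 3)) = - 2 * lattice_sum 3 z"
    unfolding lattice_sum_def by (rule infsum_cmult_right) (use lattice_sum_summable[of z 3] assms in auto)
  finally show ?thesis unfolding regular_part_def[abs_def] .
qed

section \<open>Parity and Taylor coefficients at the origin\<close>

lemma lattice_sum_minus: "lattice_sum k (- z) = (- 1) ^ k * lattice_sum k z"
proof -
  have "lattice_sum k (- z) = (\<Sum>\<^sub>\<infinity>w\<in>\<Lambda> - {0}. (- 1) ^ k * (1 / (z - w) ^ k))"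
    unfolding lattice_sum_def
  proof (rule infsum_reindex_bij_witness[of _ uminus uminus])
    fix w
    have "(- z - w) ^ k = ((- 1) * (z - (- w))) ^ k" by (rule arg_cong[where f = "\<lambda>x. x ^ k"]) simp
    also have "\<dots> = (- 1) ^ k * (z - (- w)) ^ k" by (rule power_mult_distrib)
    finally show "(- 1) ^ k * (1 / (z - (- w)) ^ k) = 1 / (- z - w) ^ k" by (simp add: divide_simps)
  qed auto
  also have "\<dots> = (- 1) ^ k * lattice_sum k z" unfolding lattice_sum_def by (rule infsum_cmult_right') 
  finally show ?thesis .
qed

lemma lattice_sum_odd_0: "odd k \<Longrightarrow> lattice_sum k 0 = 0"
  using lattice_sum_minus[of k 0] by simp

lemma regular_part_minus: "regular_part (- z) = regular_part z"
  unfolding regular_part_def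
  by (rule infsum_reindex_bij_witness[of _ uminus uminus]) (auto simp: power2_eq_square algebra_simps)

lemma regular_part_0 [simp]: "regular_part 0 = 0"
  unfolding regular_part_def by simp

lemma regular_part_holomorphic: "regular_part holomorphic_on - (\<Lambda> - {0})"
  using regular_part_deriv open_compl' by (auto simp: holomorphic_on_open)

lemma lattice_sum_holomorphic: "3 \<le> k \<Longrightarrow> lattice_sum k holomorphic_on - (\<Lambda> - {0})"
  using lattice_sum_deriv open_compl' by (auto simp: holomorphic_on_open)

lemma deriv_iterate:
  assumes "open S" "\<And>z. z \<in> S \<Longrightarrow> (deriv ^^ n) f z = g z" "z \<in> S" "(g has_field_derivative d) (at z)"
  shows "(deriv ^^ Suc n) f z = d"
proof -
  have "((deriv ^^ n) f has_field_derivative d) (at z)"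
    by (rule has_field_derivative_transform_within_open[OF assms(4,1,3)]) (simp add: assms(2))
  then show ?thesis by (simp add: DERIV_imp_deriv)
qed

lemma lattice_sum_higher_deriv:
  assumes z: "z \<notin> \<Lambda> - {0}" and k: "3 \<le> k"
  shows "(deriv ^^ n) (lattice_sum k) z = (- 1) ^ n * pochhammer (of_nat k) n * lattice_sum (k + n) z"
  using z
proof (induction n arbitrary: z)
  case 0
  then show ?case by simp
next
  case (Suc n)
  show ?case
  proof (rule deriv_iterate[OF open_compl'])
    show "((\<lambda>z. (- 1) ^ n * pochhammer (of_nat k) n * lattice_sum (k + n) z) has_field_derivative
        (- 1) ^ Suc n * pochhammer (of_nat k) (Suc n) * lattice_sum (k + Suc n) z) (at z)"
      using lattice_sum_deriv[OF Suc.prems, of "k + n"] k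
      by (auto intro!: derivative_eq_intros simp: pochhammer_Suc algebra_simps)
  qed (use Suc in auto)
qed

lemma regular_part_higher_deriv:
  assumes z: "z \<notin> \<Lambda> - {0}"
  shows "(deriv ^^ Suc n) regular_part z = - 2 * (deriv ^^ n) (lattice_sum 3) z"
  using z
proof (induction n arbitrary: z)
  case 0
  then show ?case using DERIV_imp_deriv[OF regular_part_deriv] by simp
next
  case (Suc n)
  have "(deriv ^^ n) (lattice_sum 3) holomorphic_on - (\<Lambda> - {0})"
    by (intro holomorphic_higher_deriv lattice_sum_holomorphic open_compl') simp
  then have "((deriv ^^ n) (lattice_sum 3) has_field_derivative deriv ((deriv ^^ n) (lattice_sum 3)) z) (at z)"
    using Suc.prems by (intro holomorphic_derivI[OF _ open_compl']) auto
  then have "((\<lambda>z. - 2 * (deriv ^^ n) (lattice_sum 3) z) has_field_derivative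
      - 2 * (deriv ^^ Suc n) (lattice_sum 3) z) (at z)"
    by (auto intro!: derivative_eq_intros)
  from deriv_iterate[OF open_compl' _ _ this] show ?case using Suc by blast
qed

text \<open>In other words, with \<open>G\<close> for \<open>lattice_sum\<close> at 0, the regular
  part begins \<open>3 G4 z^2 + 5 G6 z^4\<close>. These terms carry the two invariants, and the
  differential equations as well as the comparison of two lattices need nothing beyond them.\<close>

lemma regular_part_derivs_0:
  "(deriv ^^ 0) regular_part 0 = 0" "(deriv ^^ 1) regular_part 0 = 0"
  "(deriv ^^ 2) regular_part 0 = 6 * lattice_sum 4 0" "(deriv ^^ 3) regular_part 0 = 0"
  "(deriv ^^ 4) regular_part 0 = 120 * lattice_sum 6 0"
proof -
  have odd: "lattice_sum 3 0 = 0" "lattice_sum 5 0 = 0" by (simp_all add: lattice_sum_odd_0)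
  have R: "(deriv ^^ Suc n) regular_part 0 = - 2 * ((- 1) ^ n * pochhammer 3 n * lattice_sum (3 + n) 0)" for n
    using regular_part_higher_deriv[of 0 n] lattice_sum_higher_deriv[of 0 3 n] by (simp del: funpow.simps)
  have p: "pochhammer (3::complex) 1 = 3" "pochhammer (3::complex) 2 = 12" "pochhammer (3::complex) 3 = 60"
    by (simp_all add: eval_nat_numeral pochhammer_Suc)
  show "(deriv ^^ 0) regular_part 0 = 0" by simp
  show "(deriv ^^ 1) regular_part 0 = 0" using R[of 0] odd by simp
  show "(deriv ^^ 2) regular_part 0 = 6 * lattice_sum 4 0" using R[of 1] p(1) by (simp add: numeral_2_eq_2)
  show "(deriv ^^ 3) regular_part 0 = 0" using R[of 2] odd by simp
  show "(deriv ^^ 4) regular_part 0 = 120 * lattice_sum 6 0" using R[of 3] p(3) by simp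
qed

lemma wp_deriv: "z \<notin> \<Lambda> \<Longrightarrow> (wp has_field_derivative wp' z) (at z)"
proof -
  assume z: "z \<notin> \<Lambda>"
  then have "z \<noteq> 0" using zero_mem by metis
  then have "((\<lambda>z. 1 / z\<^sup>2 + regular_part z) has_field_derivative wp' z) (at z)"
    using DERIV_add[OF has_field_derivative_inverse_power[of z 0 2] regular_part_deriv[of z]] z
    by (simp add: wp'_def)
  then show ?thesis by (simp add: wp_eq[abs_def])
qed

lemma wp'_deriv: "z \<notin> \<Lambda> \<Longrightarrow> (wp' has_field_derivative wp'' z) (at z)"
proof -
  assume z: "z \<notin> \<Lambda>"
  then have "z \<noteq> 0" using zero_mem by metis
  then have "((\<lambda>z. - 2 * (1 / (z - 0) ^ 3) - 2 * lattice_sum 3 z) has_field_derivative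
      - 2 * (- of_nat 3 * (1 / (z - 0) ^ Suc 3)) - 2 * (- of_nat 3 * lattice_sum (Suc 3) z)) (at z)"
    using z by (intro DERIV_diff DERIV_cmult has_field_derivative_inverse_power lattice_sum_deriv) auto
  then show ?thesis by (simp add: wp'_def[abs_def] wp''_def)
qed

lemma deriv_wp: "z \<notin> \<Lambda> \<Longrightarrow> deriv wp z = wp' z"
  by (rule DERIV_imp_deriv[OF wp_deriv])

lemma wp_holomorphic: "wp holomorphic_on - \<Lambda>" and wp'_holomorphic: "wp' holomorphic_on - \<Lambda>"
  using wp_deriv wp'_deriv open_compl by (auto simp: holomorphic_on_open)

lemma deriv2_wp: "z \<notin> \<Lambda> \<Longrightarrow> (deriv ^^ 2) wp z = wp'' z"
  using deriv_iterate[OF open_compl, of 1 wp wp' z "wp'' z"] wp'_deriv[of z] deriv_wp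
  by (simp add: numeral_2_eq_2)

lemma wp''_holomorphic: "wp'' holomorphic_on - \<Lambda>"
proof (rule holomorphic_transform)
  show "(deriv ^^ 2) wp holomorphic_on - \<Lambda>" by (intro holomorphic_higher_deriv wp_holomorphic open_compl)
qed (use deriv2_wp in auto)

lemma wp_minus: "wp (- z) = wp z"
  by (simp add: wp_eq regular_part_minus)

lemma wp'_minus: "wp' (- z) = - wp' z"
  by (simp add: wp'_def lattice_sum_minus power3_eq_cube)

section \<open>Periodicity and reflection\<close>

lemma infsum_lattice_eq:
  assumes "z \<notin> \<Lambda>" "3 \<le> k"
  shows "(\<Sum>\<^sub>\<infinity>w\<in>\<Lambda>. 1 / (z - w) ^ k) = 1 / z ^ k + lattice_sum k z"
proof -
  have "\<Lambda> = insert 0 (\<Lambda> - {0})" using zero_mem by blast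
  then have "(\<Sum>\<^sub>\<infinity>w\<in>\<Lambda>. 1 / (z - w) ^ k) = (\<Sum>\<^sub>\<infinity>w\<in>insert 0 (\<Lambda> - {0}). 1 / (z - w) ^ k)" by simp
  also have "\<dots> = 1 / z ^ k + lattice_sum k z"
    by (subst infsum_insert) (use lattice_sum_summable[of z k] assms in \<open>auto simp: lattice_sum_def\<close>)
  finally show ?thesis .
qed

text \<open>With the term \<open>w = 0\<close> restored, translation by a lattice point merely
  reindexes the sum.\<close>

lemma infsum_lattice_shift:
  assumes "a \<in> \<Lambda>"
  shows "(\<Sum>\<^sub>\<infinity>w\<in>\<Lambda>. 1 / (z + a - w) ^ k) = (\<Sum>\<^sub>\<infinity>w\<in>\<Lambda>. 1 / (z - w) ^ k)"
  by (rule infsum_reindex_bij_witness[of _ "\<lambda>w. w + a" "\<lambda>w. w - a"])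
     (use assms add_mem diff_mem in \<open>auto simp: algebra_simps\<close>)

lemma wp'_eq_infsum: "z \<notin> \<Lambda> \<Longrightarrow> wp' z = - 2 * (\<Sum>\<^sub>\<infinity>w\<in>\<Lambda>. 1 / (z - w) ^ 3)"
  by (simp add: infsum_lattice_eq wp'_def)

lemma wp''_eq_infsum: "z \<notin> \<Lambda> \<Longrightarrow> wp'' z = 6 * (\<Sum>\<^sub>\<infinity>w\<in>\<Lambda>. 1 / (z - w) ^ 4)"
  by (simp add: infsum_lattice_eq wp''_def)

lemma wp'_periodic: "z \<notin> \<Lambda> \<Longrightarrow> a \<in> \<Lambda> \<Longrightarrow> wp' (z + a) = wp' z"
  by (simp add: wp'_eq_infsum infsum_lattice_shift add_mem_iff)

lemma wp''_periodic: "z \<notin> \<Lambda> \<Longrightarrow> a \<in> \<Lambda> \<Longrightarrow> wp'' (z + a) = wp'' z"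
  by (simp add: wp''_eq_infsum infsum_lattice_shift add_mem_iff)

text \<open>The terms \<open>1 / w^2\<close> in the series of \<open>wp\<close> do not move with a
  translation, so periodicity is taken from \<open>wp'\<close>: the increment
  \<open>wp (z + a) - wp z\<close> has derivative 0 on the connected complement of the lattice and
  is constant there.\<close>

lemma wp_periodic:
  assumes z: "z \<notin> \<Lambda>" and a: "a \<in> \<Lambda>"
  shows "wp (z + a) = wp z"
proof -
  have deriv: "((\<lambda>z. wp (z + a) - wp z) has_field_derivative 0) (at u)" if "u \<in> - \<Lambda>" for u
  proof -
    have "u + a \<notin> \<Lambda>" using that a add_mem_iff by auto
    from DERIV_shift[THEN iffD1, OF wp_deriv[OF this]]
    have "((\<lambda>z. wp (z + a)) has_field_derivative wp' u) (at u)"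
      using wp'_periodic[of u a] that a by simp
    then show ?thesis using wp_deriv[of u] that by (auto intro!: derivative_eq_intros)
  qed
  then have cont: "continuous_on (- \<Lambda>) (\<lambda>z. wp (z + a) - wp z)"
    by (rule DERIV_continuous_on[OF has_field_derivative_at_within])
  obtain c where c: "\<And>u. u \<in> - \<Lambda> \<Longrightarrow> wp (u + a) - wp u = c"
    by (rule DERIV_zero_connected_constant[OF connected_compl open_compl finite.emptyI cont]) (use deriv in auto)
  txt \<open>Evaluating at \<open>- z - a\<close> and using that \<open>wp\<close> is even turns \<open>c\<close> into \<open>- c\<close>.\<close>
  have "- z - a \<in> - \<Lambda>" using z a add_mem_iff[of a z] minus_mem_iff[of "z + a"] by simp
  then have "wp (- z - a + a) - wp (- z - a) = c" by (rule c)
  moreover have "wp (- z - a) = wp (z + a)" using wp_minus[of "z + a"] by simp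
  ultimately have "wp z - wp (z + a) = c" by (simp add: wp_minus)
  with c[of z] z show ?thesis by (simp add: algebra_simps)
qed

lemma wp_reflect: "z \<notin> \<Lambda> \<Longrightarrow> a \<in> \<Lambda> \<Longrightarrow> wp (a - z) = wp z"
  using wp_periodic[of "- z" a] by (simp add: wp_minus)

lemma wp'_reflect: "z \<notin> \<Lambda> \<Longrightarrow> a \<in> \<Lambda> \<Longrightarrow> wp' (a - z) = - wp' z"
  using wp'_periodic[of "- z" a] by (simp add: wp'_minus)

lemma eventually_notin: "\<forall>\<^sub>F z in at a. z \<notin> \<Lambda>"
proof -
  obtain d where "0 < d" "\<And>w. w \<in> \<Lambda> \<Longrightarrow> w \<noteq> a \<Longrightarrow> d \<le> cmod (a - w)" using discrete[of a] by metis
  then show ?thesis unfolding eventually_at by (auto simp: dist_norm norm_minus_commute intro!: exI[of _ d], force)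
qed

lemma wp_tendsto_infinity:
  assumes a: "a \<in> \<Lambda>"
  shows "filterlim wp at_infinity (at a)"
proof -
  have "isCont regular_part 0" using regular_part_deriv[of 0] DERIV_isCont by blast
  then have "regular_part \<midarrow>0\<rightarrow> 0" by (simp add: isCont_def)
  moreover have "filterlim (\<lambda>z::complex. 1 / z\<^sup>2) at_infinity (at 0)"
    using filterlim_compose[OF filterlim_power_at_infinity[of 2] filterlim_inverse_at_infinity]
    by (simp add: inverse_eq_divide power_divide)
  ultimately have "filterlim (\<lambda>z. regular_part z + 1 / z\<^sup>2) at_infinity (at 0)"
    by (rule tendsto_add_filterlim_at_infinity)
  then have wp0: "filterlim wp at_infinity (at 0)" by (simp add: wp_eq[abs_def] add.commute)
  have "\<forall>\<^sub>F z in at 0. wp (z + a) = wp z"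
    using eventually_notin[of 0] by eventually_elim (rule wp_periodic[OF _ a])
  then have "filterlim (\<lambda>z. wp (z + a)) at_infinity (at 0)"
    using wp0 by (subst filterlim_cong[OF refl refl]) auto
  then show ?thesis by (subst filterlim_at_to_0)
qed

section \<open>Liouville's theorem for elliptic functions\<close>

lemma fundamental_parallelogram:
  "\<exists>P. compact P \<and> (\<forall>z. \<exists>p\<in>P. z - p \<in> \<Lambda>)"
proof -
  obtain w1 w2 where im: "Im (cnj w1 * w2) \<noteq> 0" and \<Lambda>: "\<Lambda> = {of_int m * w1 + of_int n * w2 | m n. True}"
    by (rule basis)
  define P where "P = (\<lambda>(s, t). complex_of_real s * w1 + complex_of_real t * w2) ` ({0..1} \<times> {0..1})"
  have "compact P" unfolding P_def
    by (intro compact_continuous_image compact_Times)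
       (auto simp: case_prod_beta intro!: continuous_intros)
  moreover have "\<exists>p\<in>P. z - p \<in> \<Lambda>" for z
  proof -
    define D where "D = Im (cnj w1 * w2)"
    \<comment> \<open>Cramer's rule gives the real coordinates of \<open>z\<close>; their fractional
      parts give its representative in the parallelogram.\<close>
    define s where "s = - Im (cnj w2 * z) / D"
    define t where "t = Im (cnj w1 * z) / D"
    have z: "z = of_real s * w1 + of_real t * w2"
    proof -
      have D: "D \<noteq> 0" using im by (simp add: D_def)
      then have sD: "- Im (cnj w2 * z) = s * D" and tD: "Im (cnj w1 * z) = t * D"
        by (simp_all add: s_def t_def)
      have "of_real D * z = of_real (- Im (cnj w2 * z)) * w1 + of_real (Im (cnj w1 * z)) * w2"
        unfolding D_def by (simp add: complex_eq_iff algebra_simps)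
      then have "of_real D * z = of_real D * (of_real s * w1 + of_real t * w2)"
        unfolding sD tD by (simp add: algebra_simps)
      then show ?thesis using D by simp
    qed
    show ?thesis
    proof
      show "of_real (frac s) * w1 + of_real (frac t) * w2 \<in> P"
        unfolding P_def by (intro image_eqI[of _ _ "(frac s, frac t)"]) (auto simp: less_imp_le frac_lt_1)
      have "z - (of_real (frac s) * w1 + of_real (frac t) * w2) = of_int \<lfloor>s\<rfloor> * w1 + of_int \<lfloor>t\<rfloor> * w2"
        by (subst z) (simp add: frac_def algebra_simps)
      then show "z - (of_real (frac s) * w1 + of_real (frac t) * w2) \<in> \<Lambda>" unfolding \<Lambda> by blast
    qed
  qed
  ultimately show ?thesis by blast
qed

text \<open>A finite limit removes the singularity at 0, periodicity does the same at all other
  lattice points, and the resulting entire function takes all its values on a compact parallelogram.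
  Each differential equation is thereby reduced to one limit at 0.\<close>

lemma elliptic_Liouville:
  assumes F: "F holomorphic_on - \<Lambda>" and per: "\<And>z a. z \<notin> \<Lambda> \<Longrightarrow> a \<in> \<Lambda> \<Longrightarrow> F (z + a) = F z"
    and lim: "(F \<longlongrightarrow> l) (at 0)" and z: "z \<notin> \<Lambda>"
  shows "F z = l"
proof -
  define G where "G z = (if z \<in> \<Lambda> then l else F z)" for z
  have G_per: "G (z + a) = G z" if "a \<in> \<Lambda>" for z a
    using that per add_mem_iff by (simp add: G_def)
  have G_compl: "G holomorphic_on - \<Lambda>"
    by (rule holomorphic_transform[OF F]) (simp add: G_def)
  have G_lim: "(G \<longlongrightarrow> l) (at a)" if a: "a \<in> \<Lambda>" for a
  proof -
    have "\<forall>\<^sub>F z in at 0. F z = G (z + a)"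
      using eventually_notin[of 0] by eventually_elim (simp add: G_per[OF a], simp add: G_def)
    with lim have "((\<lambda>z. G (z + a)) \<longlongrightarrow> l) (at 0)" by (rule Lim_transform_eventually)
    then show ?thesis by (subst filterlim_at_to_0)
  qed
  have "G field_differentiable at a" for a
  proof (cases "a \<in> \<Lambda>")
    case False
    then show ?thesis using holomorphic_on_imp_differentiable_at[OF G_compl open_compl] by simp
  next
    case True
    obtain d where d: "0 < d" "\<And>w. w \<in> \<Lambda> \<Longrightarrow> w \<noteq> a \<Longrightarrow> d \<le> cmod (a - w)" using discrete[of a] by metis
    have "G holomorphic_on ball a d"
    proof (rule no_isolated_singularity'[of "{a}"])
      show "(G \<longlongrightarrow> G b) (at b within ball a d)" if "b \<in> {a}" for b
        using G_lim[OF True] that True by (auto intro: tendsto_within_subset simp: G_def[of a])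
      show "G holomorphic_on ball a d - {a}"
        by (rule holomorphic_on_subset[OF G_compl]) (use d in \<open>force simp: dist_norm\<close>)
    qed auto
    then show ?thesis using d(1) by (intro holomorphic_on_imp_differentiable_at[of _ "ball a d"]) auto
  qed
  then have G_hol: "G holomorphic_on UNIV" by (simp add: holomorphic_on_def)
  obtain P where P: "compact P" "\<And>z. \<exists>p\<in>P. z - p \<in> \<Lambda>"
    using fundamental_parallelogram by blast
  have "range G \<subseteq> G ` P"
  proof
    fix y assume "y \<in> range G"
    then obtain z where y: "y = G z" by blast
    obtain p where p: "p \<in> P" "z - p \<in> \<Lambda>" using P(2) by blast
    have "G z = G p" using G_per[OF p(2), of p] by simp
    then show "y \<in> G ` P" using p y by blast
  qed
  moreover have "bounded (G ` P)"
    by (intro compact_imp_bounded compact_continuous_image P(1))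
       (use G_hol in \<open>auto intro: holomorphic_on_imp_continuous_on holomorphic_on_subset\<close>)
  ultimately have "G constant_on UNIV"
    by (intro Liouville_theorem G_hol) (rule bounded_subset)
  then have "G z = G 0" by (auto simp: constant_on_def)
  then show ?thesis using z by (simp add: G_def)
qed

section \<open>The differential equations of the Weierstrass function\<close>

lemma ball_compl:
  obtains r where "0 < r" "ball 0 r \<subseteq> - (\<Lambda> - {0})"
  using openE[OF open_compl', of 0] by auto

lemma regular_part_expansion2:
  "((\<lambda>z. regular_part z / z\<^sup>2) \<longlongrightarrow> 3 * lattice_sum 4 0) (at 0)"
proof -
  obtain r where r: "0 < r" "ball 0 r \<subseteq> - (\<Lambda> - {0})" by (rule ball_compl)
  have "(\<Sum>i<2. f i) = f 0 + f 1" for f :: "nat \<Rightarrow> complex" by (simp add: eval_nat_numeral)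
  from Taylor_remainder_limit[OF holomorphic_on_subset[OF regular_part_holomorphic r(2)] r(1), of 2, unfolded this]
  show ?thesis by (simp only: regular_part_derivs_0) simp
qed

lemma regular_part_expansion4:
  "((\<lambda>z. (regular_part z - 3 * lattice_sum 4 0 * z\<^sup>2) / z ^ 4) \<longlongrightarrow> 5 * lattice_sum 6 0) (at 0)"
proof -
  obtain r where r: "0 < r" "ball 0 r \<subseteq> - (\<Lambda> - {0})" by (rule ball_compl)
  have "(\<Sum>i<4. f i) = f 0 + f 1 + f 2 + f 3" for f :: "nat \<Rightarrow> complex" by (simp add: eval_nat_numeral)
  from Taylor_remainder_limit[OF holomorphic_on_subset[OF regular_part_holomorphic r(2)] r(1), of 4, unfolded this]
  show ?thesis by (simp only: regular_part_derivs_0) (simp add: fact_numeral)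
qed

lemma lattice_sum_3_expansion:
  "((\<lambda>z. (lattice_sum 3 z + 3 * lattice_sum 4 0 * z) / z ^ 3) \<longlongrightarrow> - 10 * lattice_sum 6 0) (at 0)"
proof -
  obtain r where r: "0 < r" "ball 0 r \<subseteq> - (\<Lambda> - {0})" by (rule ball_compl)
  have *: "(\<Sum>i<3. f i) = f 0 + f 1 + f 2" for f :: "nat \<Rightarrow> complex" by (simp add: eval_nat_numeral)
  have odd: "lattice_sum 3 0 = 0" "lattice_sum 5 0 = 0" by (simp_all add: lattice_sum_odd_0)
  have p: "pochhammer (3::complex) 1 = 3" "pochhammer (3::complex) 2 = 12" "pochhammer (3::complex) 3 = 60"
    by (simp_all add: eval_nat_numeral pochhammer_Suc)
  have d: "(deriv ^^ 0) (lattice_sum 3) 0 = 0" "(deriv ^^ 1) (lattice_sum 3) 0 = - 3 * lattice_sum 4 0"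
    "(deriv ^^ 2) (lattice_sum 3) 0 = 0" "(deriv ^^ 3) (lattice_sum 3) 0 = - 60 * lattice_sum 6 0"
    using lattice_sum_higher_deriv[of 0 3 0] lattice_sum_higher_deriv[of 0 3 1]
      lattice_sum_higher_deriv[of 0 3 2] lattice_sum_higher_deriv[of 0 3 3]
    by (simp_all add: odd p(2,3) del: funpow.simps)
  have "lattice_sum 3 holomorphic_on ball 0 r"
    by (rule holomorphic_on_subset[OF lattice_sum_holomorphic r(2)]) simp
  from Taylor_remainder_limit[OF this r(1), of 3, unfolded *]
  show ?thesis by (simp only: d) (simp add: fact_numeral)
qed

lemma lattice_sum_4_tendsto: "(lattice_sum 4 \<longlongrightarrow> lattice_sum 4 0) (at 0)"
proof -
  have "isCont (lattice_sum 4) 0" by (rule DERIV_isCont[OF lattice_sum_deriv]) auto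
  then show ?thesis by (simp add: isCont_def)
qed

theorem wp''_ode:
  assumes "z \<notin> \<Lambda>"
  shows "wp'' z = 6 * (wp z)\<^sup>2 - invariant_g2 \<Lambda> / 2"
proof -
  have "(\<lambda>z. wp'' z - 6 * (wp z)\<^sup>2 + invariant_g2 \<Lambda> / 2) z = 0"
  proof (rule elliptic_Liouville[OF _ _ _ assms])
    show "(\<lambda>z. wp'' z - 6 * (wp z)\<^sup>2 + invariant_g2 \<Lambda> / 2) holomorphic_on - \<Lambda>"
      by (intro holomorphic_intros wp''_holomorphic wp_holomorphic)
    show "wp'' (z + a) - 6 * (wp (z + a))\<^sup>2 + invariant_g2 \<Lambda> / 2 = wp'' z - 6 * (wp z)\<^sup>2 + invariant_g2 \<Lambda> / 2"
      if "z \<notin> \<Lambda>" "a \<in> \<Lambda>" for z a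
      using that by (simp add: wp_periodic wp''_periodic)
    \<comment> \<open>The poles \<open>6 / z^4\<close> have been cancelled. The limit is
      \<open>(6 - 36 + 30) * lattice_sum 4 0 = 0\<close>, where 30 is half the factor 60 of
      \<open>invariant_g2\<close>.\<close>
    let ?f = "\<lambda>z. 6 * lattice_sum 4 z - 12 * (regular_part z / z\<^sup>2) - 6 * (z\<^sup>2 * (regular_part z / z\<^sup>2))\<^sup>2 + invariant_g2 \<Lambda> / 2"
    have "(?f \<longlongrightarrow> 6 * lattice_sum 4 0 - 12 * (3 * lattice_sum 4 0) - 6 * (0\<^sup>2 * (3 * lattice_sum 4 0))\<^sup>2 + invariant_g2 \<Lambda> / 2) (at 0)"
      by (intro tendsto_intros lattice_sum_4_tendsto regular_part_expansion2)
    then have "(?f \<longlongrightarrow> 0) (at 0)" by (simp add: invariant_g2_eq)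
    moreover have "\<forall>\<^sub>F z in at 0. ?f z = wp'' z - 6 * (wp z)\<^sup>2 + invariant_g2 \<Lambda> / 2"
      using eventually_neq_at_within[of 0]
    proof eventually_elim
      case (elim z)
      then show ?case by (simp add: wp''_def wp_eq field_simps power2_eq_square power4_eq_xxxx)
    qed
    ultimately show "((\<lambda>z. wp'' z - 6 * (wp z)\<^sup>2 + invariant_g2 \<Lambda> / 2) \<longlongrightarrow> 0) (at 0)"
      by (rule Lim_transform_eventually)
  qed
  then show ?thesis by (simp add: algebra_simps)
qed

theorem wp'_ode:
  assumes "z \<notin> \<Lambda>"
  shows "(wp' z)\<^sup>2 = 4 * wp z ^ 3 - invariant_g2 \<Lambda> * wp z - invariant_g3 \<Lambda>"
proof -
  let ?g2 = "invariant_g2 \<Lambda>" and ?g3 = "invariant_g3 \<Lambda>"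
  have "(\<lambda>z. (wp' z)\<^sup>2 - 4 * wp z ^ 3 + ?g2 * wp z + ?g3) z = 0"
  proof (rule elliptic_Liouville[OF _ _ _ assms])
    show "(\<lambda>z. (wp' z)\<^sup>2 - 4 * wp z ^ 3 + ?g2 * wp z + ?g3) holomorphic_on - \<Lambda>"
      by (intro holomorphic_intros wp'_holomorphic wp_holomorphic)
    show "(wp' (z + a))\<^sup>2 - 4 * wp (z + a) ^ 3 + ?g2 * wp (z + a) + ?g3 = (wp' z)\<^sup>2 - 4 * wp z ^ 3 + ?g2 * wp z + ?g3"
      if "z \<notin> \<Lambda>" "a \<in> \<Lambda>" for z a
      using that by (simp add: wp_periodic wp'_periodic)
    define G where "G = lattice_sum 4 0"
    \<comment> \<open>\<open>A\<close> and \<open>B\<close> are the Taylor remainders scaled to have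
      finite limits at 0, which makes \<open>wp\<close> and \<open>wp'\<close> polynomials in
      \<open>z\<close>, \<open>1 / z\<close>, \<open>A z\<close>, \<open>B z\<close> and
      \<open>G\<close>.\<close>
    define A where "A z = (regular_part z - 3 * G * z\<^sup>2) / z ^ 4" for z
    define B where "B z = (lattice_sum 3 z + 3 * G * z) / z ^ 3" for z
    have lim: "(A \<longlongrightarrow> 5 * lattice_sum 6 0) (at 0)" "(B \<longlongrightarrow> - 10 * lattice_sum 6 0) (at 0)"
      using regular_part_expansion4 lattice_sum_3_expansion unfolding A_def B_def G_def .
    let ?v = "\<lambda>z. 3 * G + A z * z\<^sup>2"
    \<comment> \<open>What is left after the poles of orders 6 and 2 have cancelled; its limit is
      \<open>(- 80 - 60 + 140) * lattice_sum 6 0 = 0\<close>.\<close>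
    let ?f = "\<lambda>z. 8 * B z - 12 * A z + (6 * G * z - 2 * B z * z ^ 3)\<^sup>2 - 12 * (z * ?v z)\<^sup>2 -
        4 * (z\<^sup>2 * ?v z) ^ 3 + 60 * G * (z\<^sup>2 * ?v z) + ?g3"
    have "(?f \<longlongrightarrow> 8 * (- 10 * lattice_sum 6 0) - 12 * (5 * lattice_sum 6 0)
        + (6 * G * 0 - 2 * (- 10 * lattice_sum 6 0) * 0 ^ 3)\<^sup>2
        - 12 * (0 * (3 * G + 5 * lattice_sum 6 0 * 0\<^sup>2))\<^sup>2
        - 4 * (0\<^sup>2 * (3 * G + 5 * lattice_sum 6 0 * 0\<^sup>2)) ^ 3
        + 60 * G * (0\<^sup>2 * (3 * G + 5 * lattice_sum 6 0 * 0\<^sup>2)) + ?g3) (at 0)"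
      by (intro tendsto_intros lim)
    then have "(?f \<longlongrightarrow> 0) (at 0)" by (simp add: invariant_g3_eq)
    moreover have "\<forall>\<^sub>F z in at 0. ?f z = (wp' z)\<^sup>2 - 4 * wp z ^ 3 + ?g2 * wp z + ?g3"
      using eventually_neq_at_within[of 0]
    proof eventually_elim
      case (elim z)
      \<comment> \<open>Naming the reciprocal turns the claim into a polynomial identity modulo
        \<open>z * i = 1\<close>.\<close>
      define i where "i = 1 / z"
      have zi: "z * i = 1" using elim by (simp add: i_def)
      have wp: "wp z = i\<^sup>2 + z\<^sup>2 * ?v z"
        using elim by (simp add: wp_eq A_def i_def power_divide divide_simps) (simp add: algebra_simps eval_nat_numeral)
      have wp': "wp' z = - 2 * i ^ 3 + 6 * G * z - 2 * B z * z ^ 3"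
        using elim by (simp add: wp'_def B_def i_def power_divide)
      have g2: "?g2 = 60 * G" by (simp add: invariant_g2_eq G_def)
      show ?case unfolding wp wp' g2 using zi by algebra
    qed
    ultimately show "((\<lambda>z. (wp' z)\<^sup>2 - 4 * wp z ^ 3 + ?g2 * wp z + ?g3) \<longlongrightarrow> 0) (at 0)"
      by (rule Lim_transform_eventually)
  qed
  then show ?thesis by (simp add: algebra_simps)
qed

end

subsection \<open>A lattice is determined by its invariants\<close>

context complex_lattice
begin

lemma isCont_wp: "z \<notin> \<Lambda> \<Longrightarrow> isCont wp z"
  by (rule DERIV_isCont[OF wp_deriv])

text \<open>Comparing the regular parts keeps the difference holomorphic at the common pole 0. Once
  it vanishes, a point of \<open>\<Lambda>'\<close> outside \<open>\<Lambda>\<close> would be a pole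
  of one function and a regular point of the other.\<close>

lemma subset_of_invariants_eq:
  assumes "complex_lattice \<Lambda>'" and g2: "invariant_g2 \<Lambda> = invariant_g2 \<Lambda>'"
    and g3: "invariant_g3 \<Lambda> = invariant_g3 \<Lambda>'"
  shows "\<Lambda>' \<subseteq> \<Lambda>"
proof -
  interpret B: complex_lattice \<Lambda>' by fact
  define S where "S = - (\<Lambda> - {0}) \<inter> - (\<Lambda>' - {0})"
  define D where "D z = regular_part z - B.regular_part z" for z
  have S_open: "open S" unfolding S_def using open_compl' B.open_compl' by (rule open_Int)
  have S_eq: "S = UNIV - (\<Lambda> \<union> \<Lambda>' - {0})" by (auto simp: S_def)
  have S_conn: "connected S" unfolding S_eq
    by (rule connected_open_diff_countable) (auto simp: countable B.countable)
  have S0: "0 \<in> S" by (simp add: S_def)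
  have hol: "regular_part holomorphic_on S" "B.regular_part holomorphic_on S"
    using regular_part_holomorphic B.regular_part_holomorphic
    by (auto simp: S_def elim!: holomorphic_on_subset)
  have D_hol: "D holomorphic_on S" unfolding D_def by (intro holomorphic_intros hol)
  have D_deriv: "(deriv ^^ n) D z = (deriv ^^ n) regular_part z - (deriv ^^ n) B.regular_part z" if "z \<in> S" for n z
    unfolding D_def by (rule higher_deriv_diff[OF hol S_open that])
  have D2: "(deriv ^^ 2) D z = 6 * lattice_sum 4 z - 6 * B.lattice_sum 4 z" if "z \<in> S" for z
  proof -
    have z: "z \<notin> \<Lambda> - {0}" "z \<notin> \<Lambda>' - {0}" using that by (auto simp: S_def)
    show ?thesis
      using regular_part_higher_deriv[OF z(1), of 1] lattice_sum_higher_deriv[OF z(1), of 3 1]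
        B.regular_part_higher_deriv[OF z(2), of 1] B.lattice_sum_higher_deriv[OF z(2), of 3 1]
      unfolding D_deriv[OF that] by (simp add: numeral_2_eq_2)
  qed
  have D_eq: "D z = 0" if "z \<in> S" for z
  proof (rule singular_ode_solution_eq_0[OF D_hol S_open S_conn S0 _ _ _ _ _ that])
    \<comment> \<open>Subtracting the two equations of second order gives a linear equation whose
      coefficient is 6 times the sum of the two functions; their two double poles contribute
      \<open>6 * 2 = 12\<close> at 0.\<close>
    let ?h = "\<lambda>z. 12 + 6 * z\<^sup>2 * (regular_part z + B.regular_part z)"
    have "\<forall>\<^sub>F z in at 0. z \<in> S" by (rule eventually_at_in_open'[OF S_open S0])
    then show "\<forall>\<^sub>F z in at 0. (z - 0)\<^sup>2 * (deriv ^^ 2) D z = ?h z * D z"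
      using eventually_neq_at_within[of 0]
    proof eventually_elim
      case (elim z)
      then have z: "z \<notin> \<Lambda>" "z \<notin> \<Lambda>'" by (auto simp: S_def)
      define i where "i = 1 / z"
      have zi: "z * i = 1" using elim by (simp add: i_def)
      have "6 * i ^ 4 + 6 * lattice_sum 4 z = 6 * (i\<^sup>2 + regular_part z)\<^sup>2 - invariant_g2 \<Lambda> / 2"
        using wp''_ode[OF z(1)] by (simp add: wp''_def wp_eq i_def power_divide)
      moreover have "6 * i ^ 4 + 6 * B.lattice_sum 4 z = 6 * (i\<^sup>2 + B.regular_part z)\<^sup>2 - invariant_g2 \<Lambda> / 2"
        using B.wp''_ode[OF z(2)] by (simp add: B.wp''_def B.wp_eq i_def power_divide g2)
      ultimately have "6 * lattice_sum 4 z - 6 * B.lattice_sum 4 z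
          = 6 * (i\<^sup>2 + regular_part z)\<^sup>2 - 6 * (i\<^sup>2 + B.regular_part z)\<^sup>2"
        by algebra
      then have "(deriv ^^ 2) D z = 6 * (2 * i\<^sup>2 + regular_part z + B.regular_part z) * D z"
        unfolding D2[OF elim(1)] D_def by (simp add: algebra_simps power2_eq_square)
      then show ?case using zi by algebra
    qed
    have "regular_part \<midarrow>0\<rightarrow> 0" "B.regular_part \<midarrow>0\<rightarrow> 0"
      using DERIV_isCont[OF regular_part_deriv[of 0]] DERIV_isCont[OF B.regular_part_deriv[of 0]]
      by (simp_all add: isCont_def)
    then have "?h \<midarrow>0\<rightarrow> 12 + 6 * 0\<^sup>2 * (0 + 0)" by (intro tendsto_intros)
    then show "?h \<midarrow>0\<rightarrow> 12" by simp
    show "(deriv ^^ k) D 0 = 0" if "k < 5" for k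
    proof -
      have eq: "lattice_sum 4 0 = B.lattice_sum 4 0" "lattice_sum 6 0 = B.lattice_sum 6 0"
        using g2 g3 by (simp_all add: invariant_g2_eq B.invariant_g2_eq invariant_g3_eq B.invariant_g3_eq)
      have "k = 0 \<or> k = 1 \<or> k = 2 \<or> k = 3 \<or> k = 4" using that by linarith
      then show ?thesis unfolding D_deriv[OF S0]
        by (elim disjE) (simp_all only: regular_part_derivs_0 B.regular_part_derivs_0 eq diff_self)
    qed
    \<comment> \<open>The exponent 4, with \<open>4 * 3 = 12\<close>, is ruled out by the five
      initial conditions; from 5 on the product is at least 20.\<close>
    show "(12::complex) \<noteq> of_nat k * (of_nat k - 1)" if "5 \<le> k" for k
    proof
      assume "(12::complex) = of_nat k * (of_nat k - 1)"
      then have "of_nat 12 = (of_nat (k * (k - 1)) :: complex)" using that by (simp add: of_nat_diff)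
      then have "12 = k * (k - 1)" by (simp only: of_nat_eq_iff)
      moreover have "5 * 4 \<le> k * (k - 1)" by (rule mult_le_mono) (use that in auto)
      ultimately show False by simp
    qed
  qed auto
  show ?thesis
  proof
    fix w assume w: "w \<in> \<Lambda>'"
    show "w \<in> \<Lambda>"
    proof (rule ccontr)
      assume nw: "w \<notin> \<Lambda>"
      have "wp \<midarrow>w\<rightarrow> wp w" using isCont_wp[OF nw] by (simp add: isCont_def)
      moreover have "\<forall>\<^sub>F z in at w. wp z = B.wp z"
        using eventually_notin[of w] B.eventually_notin[of w]
      proof eventually_elim
        case (elim z)
        then have "z \<in> S" by (auto simp: S_def)
        then show ?case using D_eq[of z] by (simp add: wp_eq B.wp_eq D_def)
      qed
      ultimately have "B.wp \<midarrow>w\<rightarrow> wp w" by (rule Lim_transform_eventually)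
      with B.wp_tendsto_infinity[OF w] show False
        using not_tendsto_and_filterlim_at_infinity[of "at w"] by (metis trivial_limit_at)
    qed
  qed
qed

text \<open>If \<open>wp' z = 0\<close>, then \<open>wp\<close> and its reflection \<open>wp (2 * z - u)\<close> solve the same second-order
  initial value problem at \<open>z\<close>, so \<open>2 * z\<close> is a pole like \<open>0\<close>.\<close>

lemma double_mem_of_wp'_eq_0:
  assumes z: "z \<notin> \<Lambda>" and crit: "wp' z = 0"
  shows "2 * z \<in> \<Lambda>"
proof (rule ccontr)
  assume n2z: "2 * z \<notin> \<Lambda>"
  define S where "S = - \<Lambda> \<inter> (\<lambda>u. 2 * z - u) -` (- \<Lambda>)"
  define D where "D u = wp u - wp (2 * z - u)" for u
  have V_open: "open ((\<lambda>u. 2 * z - u) -` (- \<Lambda>))"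
    by (rule open_vimage[OF open_compl]) (intro continuous_intros)
  have S_open: "open S" unfolding S_def using open_compl V_open by (rule open_Int)
  have S_eq: "S = UNIV - (\<Lambda> \<union> (\<lambda>u. 2 * z - u) ` \<Lambda>)"
  proof -
    have "2 * z - u \<in> \<Lambda> \<longleftrightarrow> u \<in> (\<lambda>u. 2 * z - u) ` \<Lambda>" for u
      by (auto intro: image_eqI[of _ _ "2 * z - u"])
    then show ?thesis by (auto simp: S_def)
  qed
  have S_conn: "connected S" unfolding S_eq
    by (rule connected_open_diff_countable) (auto simp: countable)
  have Sz: "z \<in> S" using z by (simp add: S_def)
  have refl: "((\<lambda>u. g (2 * z - u)) has_field_derivative - d) (at u)"
    if "(g has_field_derivative d) (at (2 * z - u))" for g d u
  proof -
    have "((\<lambda>u. 2 * z - u) has_field_derivative - 1) (at u)" by (auto intro!: derivative_eq_intros)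
    from DERIV_chain2[OF that this] show ?thesis by simp
  qed
  have D1: "(D has_field_derivative wp' u + wp' (2 * z - u)) (at u)" if "u \<in> S" for u
  proof -
    have u: "u \<notin> \<Lambda>" "2 * z - u \<notin> \<Lambda>" using that by (auto simp: S_def)
    show ?thesis using DERIV_diff[OF wp_deriv[OF u(1)] refl[OF wp_deriv[OF u(2)]]] by (simp add: D_def[abs_def])
  qed
  have D_hol: "D holomorphic_on S" using D1 S_open by (auto simp: holomorphic_on_open)
  have D1': "(deriv ^^ 1) D u = wp' u + wp' (2 * z - u)" if "u \<in> S" for u
    using DERIV_imp_deriv[OF D1[OF that]] by simp
  have D2: "(deriv ^^ 2) D u = wp'' u - wp'' (2 * z - u)" if "u \<in> S" for u
  proof -
    have u: "u \<notin> \<Lambda>" "2 * z - u \<notin> \<Lambda>" using that by (auto simp: S_def)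
    have "((\<lambda>u. wp' u + wp' (2 * z - u)) has_field_derivative wp'' u + - wp'' (2 * z - u)) (at u)"
      by (rule DERIV_add[OF wp'_deriv[OF u(1)] refl[OF wp'_deriv[OF u(2)]]])
    from deriv_iterate[OF S_open D1' that this] show ?thesis by (simp add: numeral_2_eq_2)
  qed
  have D_eq: "D u = 0" if "u \<in> S" for u
  proof (rule singular_ode_solution_eq_0[OF D_hol S_open S_conn Sz _ _ _ _ _ that])
    \<comment> \<open>Here \<open>z\<close> is an ordinary point. The factor
      \<open>(u - z)^2\<close> makes the coefficient vanish at \<open>z\<close>, the exponents
      become 0 and 1, and they are excluded because \<open>D\<close> vanishes at \<open>z\<close> by
      symmetry and its derivative there is \<open>2 * wp' z = 0\<close>.\<close>
    let ?h = "\<lambda>u. (u - z)\<^sup>2 * (6 * (wp u + wp (2 * z - u)))"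
    have "\<forall>\<^sub>F u in at z. u \<in> S" by (rule eventually_at_in_open'[OF S_open Sz])
    then show "\<forall>\<^sub>F u in at z. (u - z)\<^sup>2 * (deriv ^^ 2) D u = ?h u * D u"
    proof eventually_elim
      case (elim u)
      then have u: "u \<notin> \<Lambda>" "2 * z - u \<notin> \<Lambda>" by (auto simp: S_def)
      have "(deriv ^^ 2) D u = 6 * (wp u + wp (2 * z - u)) * D u"
        unfolding D2[OF elim] wp''_ode[OF u(1)] wp''_ode[OF u(2)] D_def
        by (simp add: algebra_simps power2_eq_square)
      then show ?case by simp
    qed
    have "wp \<midarrow>z\<rightarrow> wp z" using isCont_wp[OF z] by (simp add: isCont_def)
    moreover have "isCont (\<lambda>u. wp (2 * z - u)) z"
      by (rule DERIV_isCont[OF refl[OF wp_deriv]]) (use z in simp)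
    then have "(\<lambda>u. wp (2 * z - u)) \<midarrow>z\<rightarrow> wp z" by (simp add: isCont_def)
    ultimately have "?h \<midarrow>z\<rightarrow> (z - z)\<^sup>2 * (6 * (wp z + wp z))" by (intro tendsto_intros)
    then show "?h \<midarrow>z\<rightarrow> 0" by simp
    show "(deriv ^^ k) D z = 0" if "k < 2" for k
    proof -
      have "k = 0 \<or> k = 1" using that by linarith
      then show ?thesis using D1'[OF Sz] crit by (auto simp: D_def)
    qed
    show "(0::complex) \<noteq> of_nat k * (of_nat k - 1)" if "2 \<le> k" for k
      using that of_nat_eq_iff[of k 1, where ?'a = complex] by auto
  qed auto
  have "isCont (\<lambda>u. wp (2 * z - u)) 0"
    by (rule DERIV_isCont[OF refl[OF wp_deriv]]) (use n2z in simp)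
  then have "(\<lambda>u. wp (2 * z - u)) \<midarrow>0\<rightarrow> wp (2 * z)" by (simp add: isCont_def)
  moreover have "\<forall>\<^sub>F u in at 0. u \<in> (\<lambda>u. 2 * z - u) -` (- \<Lambda>)"
    by (rule eventually_at_in_open'[OF V_open]) (use n2z in auto)
  then have "\<forall>\<^sub>F u in at 0. wp (2 * z - u) = wp u"
    using eventually_notin[of 0]
  proof eventually_elim
    case (elim u)
    then have "u \<in> S" by (auto simp: S_def)
    then show ?case using D_eq[of u] by (simp add: D_def)
  qed
  ultimately have "wp \<midarrow>0\<rightarrow> wp (2 * z)" by (rule Lim_transform_eventually)
  with wp_tendsto_infinity[OF zero_mem] show False
    using not_tendsto_and_filterlim_at_infinity[of "at 0"] by (metis trivial_limit_at)
qed

lemma is_lattice_cnj: "is_lattice (cnj ` \<Lambda>)"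
proof -
  obtain w1 w2 where w: "w1 \<noteq> w2" "independent {w1, w2}"
    and \<Lambda>: "\<Lambda> = {of_int m * w1 + of_int n * w2 | m n. True}"
    using lattice unfolding is_lattice_def by blast
  have "linear cnj" by (rule bounded_linear.linear[OF bounded_linear_cnj])
  then have "independent (cnj ` {w1, w2})"
    using w(2) by (rule linear_independent_injective_image) (auto simp: inj_on_def)
  then have "independent {cnj w1, cnj w2}" by simp
  moreover have "cnj ` \<Lambda> = {of_int m * cnj w1 + of_int n * cnj w2 | m n. True}"
  proof -
    have eq: "cnj (of_int m * w1 + of_int n * w2) = of_int m * cnj w1 + of_int n * cnj w2" for m n by simp
    show ?thesis unfolding \<Lambda> eq[symmetric] by blast
  qed
  ultimately show ?thesis using w(1) unfolding is_lattice_def by (intro exI[of _ "cnj w1"] exI[of _ "cnj w2"]) auto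
qed

end

lemma infsum_power_cnj:
  "(\<Sum>\<^sub>\<infinity>w\<in>cnj ` \<Lambda> - {0}. 1 / w ^ k) = cnj (\<Sum>\<^sub>\<infinity>w\<in>\<Lambda> - {0}. 1 / w ^ k)"
  unfolding infsum_cnj[symmetric]
  by (rule infsum_reindex_bij_witness[of _ cnj cnj]) auto

subsection \<open>The Weierstrass function on the real axis\<close>

locale real_lattice = complex_lattice +
  fixes g2 g3 :: real
  assumes g2: "invariant_g2 \<Lambda> = complex_of_real g2" and g3: "invariant_g3 \<Lambda> = complex_of_real g3"
begin

text \<open>Conjugating a lattice conjugates its invariants, which are real; the inclusion for equal
  invariants then applies in both directions.\<close>

lemma cnj_image: "cnj ` \<Lambda> = \<Lambda>"
proof -
  interpret C: complex_lattice "cnj ` \<Lambda>" by unfold_locales (rule is_lattice_cnj)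
  have eq: "invariant_g2 (cnj ` \<Lambda>) = invariant_g2 \<Lambda>" "invariant_g3 (cnj ` \<Lambda>) = invariant_g3 \<Lambda>"
    using g2 g3 unfolding invariant_g2_def invariant_g3_def infsum_power_cnj
    by (metis complex_cnj_complex_of_real complex_cnj_mult complex_cnj_numeral)+
  show ?thesis
    using subset_of_invariants_eq[OF C.complex_lattice_axioms] C.subset_of_invariants_eq[OF complex_lattice_axioms] eq
    by auto
qed

lemma cnj_mem_iff [simp]: "cnj z \<in> \<Lambda> \<longleftrightarrow> z \<in> \<Lambda>"
  using cnj_image by (metis complex_cnj_cnj image_eqI)

lemma wp_cnj: "wp (cnj z) = cnj (wp z)"
proof -
  have "regular_part (cnj z) = cnj (regular_part z)"
    unfolding regular_part_def infsum_cnj[symmetric]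
    by (rule infsum_reindex_bij_witness[of _ cnj cnj]) auto
  then show ?thesis by (simp add: wp_eq)
qed

lemma wp'_cnj: "wp' (cnj z) = cnj (wp' z)"
proof -
  have "lattice_sum 3 (cnj z) = cnj (lattice_sum 3 z)"
    unfolding lattice_sum_def infsum_cnj[symmetric]
    by (rule infsum_reindex_bij_witness[of _ cnj cnj]) auto
  then show ?thesis by (simp add: wp'_def)
qed

definition p :: "real \<Rightarrow> real" where "p t = Re (wp (of_real t))"

definition p' :: "real \<Rightarrow> real" where "p' t = Re (wp' (of_real t))"

definition \<omega> :: real where "\<omega> = real_period \<Lambda>"

lemma wp_of_real: "wp (of_real t) = of_real (p t)"
  using wp_cnj[of "of_real t"] by (simp add: p_def complex_eq_iff)

lemma wp'_of_real: "wp' (of_real t) = of_real (p' t)"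
  using wp'_cnj[of "of_real t"] by (simp add: p'_def complex_eq_iff)

text \<open>\<open>w + cnj w\<close> is a real lattice point, nonzero when \<open>w\<close> is off
  the imaginary axis, and two independent basis vectors cannot both lie on that axis.\<close>

lemma real_period_exists: "\<exists>t>0. complex_of_real t \<in> \<Lambda>"
proof -
  obtain w1 w2 where im: "Im (cnj w1 * w2) \<noteq> 0" and \<Lambda>: "\<Lambda> = {of_int m * w1 + of_int n * w2 | m n. True}"
    by (rule basis)
  have "w1 = of_int 1 * w1 + of_int 0 * w2" "w2 = of_int 0 * w1 + of_int 1 * w2" by simp_all
  then have mem: "w1 \<in> \<Lambda>" "w2 \<in> \<Lambda>" unfolding \<Lambda> by blast+
  have "Re w1 \<noteq> 0 \<or> Re w2 \<noteq> 0" using im by auto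
  then obtain w where w: "w \<in> \<Lambda>" "Re w \<noteq> 0" using mem by blast
  have "w + cnj w \<in> \<Lambda>" using w by (intro add_mem) auto
  then have 1: "complex_of_real (2 * Re w) \<in> \<Lambda>" by (simp add: complex_add_cnj)
  then have 2: "complex_of_real (- (2 * Re w)) \<in> \<Lambda>" unfolding of_real_minus by (rule minus_mem)
  show ?thesis
  proof (cases "Re w > 0")
    case True
    then show ?thesis using 1 by (intro exI[of _ "2 * Re w"]) auto
  next
    case False
    then show ?thesis using 2 w by (intro exI[of _ "- (2 * Re w)"]) auto
  qed
qed

text \<open>A \<open>LEAST\<close> over the reals has its intended meaning only if the minimum is
  attained: by discreteness only finitely many positive real lattice points lie below a given
  one.\<close>

lemma period: "0 < \<omega>" "of_real \<omega> \<in> \<Lambda>" "\<And>t. 0 < t \<Longrightarrow> of_real t \<in> \<Lambda> \<Longrightarrow> \<omega> \<le> t"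
proof -
  obtain t0 where t0: "0 < t0" "complex_of_real t0 \<in> \<Lambda>" using real_period_exists by blast
  define T where "T = {t. 0 < t \<and> complex_of_real t \<in> \<Lambda> \<and> t \<le> t0}"
  have "complex_of_real ` T \<subseteq> {w \<in> \<Lambda>. cmod w \<le> t0}" by (auto simp: T_def)
  then have "finite (complex_of_real ` T)" using finite_norm_le finite_subset by blast
  then have fin: "finite T" by (rule finite_imageD) (auto simp: inj_on_def)
  have ne: "T \<noteq> {}" using t0 by (auto simp: T_def)
  have min: "Min T \<in> T" by (rule Min_in[OF fin ne])
  have le: "Min T \<le> t" if "0 < t" "complex_of_real t \<in> \<Lambda>" for t
  proof (cases "t \<le> t0")
    case True
    then show ?thesis using that by (intro Min_le[OF fin]) (auto simp: T_def)
  next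
    case False
    then show ?thesis using min by (auto simp: T_def)
  qed
  have eq: "\<omega> = Min T"
    unfolding \<omega>_def real_period_def
    by (rule Least_equality) (use min le in \<open>auto simp: T_def\<close>)
  show "0 < \<omega>" "of_real \<omega> \<in> \<Lambda>" "\<And>t. 0 < t \<Longrightarrow> of_real t \<in> \<Lambda> \<Longrightarrow> \<omega> \<le> t"
    unfolding eq using min le by (auto simp: T_def)
qed

lemma notin_lattice: "0 < t \<Longrightarrow> t < \<omega> \<Longrightarrow> complex_of_real t \<notin> \<Lambda>"
  using period(3)[of t] by auto

lemma of_int_mult_period: "complex_of_real (of_int k * \<omega>) \<in> \<Lambda>"
  using of_int_mult_mem[OF period(2), of k] by simp

lemma real_lattice_point:
  assumes "complex_of_real t \<in> \<Lambda>"
  obtains k :: int where "t = of_int k * \<omega>"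
proof -
  define u where "u = t - of_int \<lfloor>t / \<omega>\<rfloor> * \<omega>"
  have "u = frac (t / \<omega>) * \<omega>" using period(1) by (simp add: u_def frac_def field_simps)
  moreover have "0 \<le> frac (t / \<omega>)" "frac (t / \<omega>) < 1" by (simp_all add: frac_lt_1)
  ultimately have u: "0 \<le> u" "u < \<omega>" using period(1) by (simp_all add: mult_less_cancel_right2)
  have "complex_of_real u \<in> \<Lambda>"
    unfolding u_def of_real_diff using assms of_int_mult_period by (rule diff_mem)
  then have "\<not> 0 < u" using notin_lattice[of u] u(2) by blast
  then have "u = 0" using u(1) by simp
  then show thesis using that by (simp add: u_def)
qed

lemma p_deriv: "complex_of_real t \<notin> \<Lambda> \<Longrightarrow> (p has_real_derivative p' t) (at t)"
  unfolding p_def[abs_def] p'_def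
  by (intro has_field_derivative_Re has_vector_derivative_real_field wp_deriv)

lemma isCont_p: "complex_of_real t \<notin> \<Lambda> \<Longrightarrow> isCont p t"
  by (rule DERIV_isCont[OF p_deriv])

lemma isCont_p': "complex_of_real t \<notin> \<Lambda> \<Longrightarrow> isCont p' t"
  unfolding p'_def[abs_def]
  by (rule DERIV_isCont[OF has_field_derivative_Re[OF has_vector_derivative_real_field[OF wp'_deriv]]])

lemma p_reflect: "complex_of_real t \<notin> \<Lambda> \<Longrightarrow> p (\<omega> - t) = p t"
  and p'_reflect: "complex_of_real t \<notin> \<Lambda> \<Longrightarrow> p' (\<omega> - t) = - p' t"
  using wp_reflect[of "of_real t" "of_real \<omega>"] wp'_reflect[of "of_real t" "of_real \<omega>"] period(2)
  by (simp_all add: p_def p'_def)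

lemma p'_square:
  assumes "complex_of_real t \<notin> \<Lambda>"
  shows "(p' t)\<^sup>2 = 4 * p t ^ 3 - g2 * p t - g3"
proof -
  have "complex_of_real ((p' t)\<^sup>2) = of_real (4 * p t ^ 3 - g2 * p t - g3)"
    using wp'_ode[OF assms] by (simp add: wp_of_real wp'_of_real g2 g3)
  then show ?thesis by (simp only: of_real_eq_iff)
qed

lemma p_at_right_0: "filterlim p at_top (at_right 0)"
proof -
  have p_eq: "p t = Re (regular_part (complex_of_real t)) + 1 / t\<^sup>2" for t
  proof -
    have "1 / (complex_of_real t)\<^sup>2 = complex_of_real (1 / t\<^sup>2)" by simp
    then show ?thesis unfolding p_def wp_eq by (simp only: plus_complex.simps Re_complex_of_real add.commute)
  qed
  have "(regular_part has_field_derivative - 2 * lattice_sum 3 0) (at (of_real 0))"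
    using regular_part_deriv[of 0] by simp
  from DERIV_isCont[OF has_field_derivative_Re[OF has_vector_derivative_real_field[OF this]]]
  have "isCont (\<lambda>t. Re (regular_part (complex_of_real t))) 0" .
  then have "((\<lambda>t. Re (regular_part (complex_of_real t))) \<longlongrightarrow> 0) (at_right 0)"
    by (simp add: isCont_def filterlim_at_split)
  moreover have "filterlim (\<lambda>t::real. 1 / t\<^sup>2) at_top (at_right 0)"
    using filterlim_pow_at_top[OF _ filterlim_inverse_at_top_right, of 2]
    by (simp add: inverse_eq_divide power_divide)
  ultimately have "filterlim (\<lambda>t. Re (regular_part (complex_of_real t)) + 1 / t\<^sup>2) at_top (at_right 0)"
    by (rule filterlim_tendsto_add_at_top)
  then show ?thesis unfolding p_eq[abs_def] .
qed

section \<open>Monotonicity between the half period and the period\<close>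

lemma half_period: "complex_of_real (\<omega> / 2) \<notin> \<Lambda>"
  by (rule notin_lattice) (use period(1) in auto)

lemma p'_half_period: "p' (\<omega> / 2) = 0"
  using p'_reflect[OF half_period] by simp

text \<open>A critical point would make \<open>2 * t - \<omega>\<close> a real lattice point
  strictly between 0 and \<open>\<omega>\<close>.\<close>

lemma p'_neq_0:
  assumes "\<omega> / 2 < t" "t < \<omega>"
  shows "p' t \<noteq> 0"
proof
  assume "p' t = 0"
  moreover have "complex_of_real t \<notin> \<Lambda>" using assms period(1) by (intro notin_lattice) auto
  ultimately have "complex_of_real (2 * t) \<in> \<Lambda>"
    using double_mem_of_wp'_eq_0[of "of_real t"] by (simp add: wp'_of_real)
  then have "complex_of_real (2 * t - \<omega>) \<in> \<Lambda>" unfolding of_real_diff using period(2) by (rule diff_mem)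
  then show False using notin_lattice[of "2 * t - \<omega>"] assms by simp
qed

text \<open>Values just below the period are reflections of those just above 0, where the pole makes
  \<open>p\<close> arbitrarily large.\<close>

lemma p_large:
  assumes "t < \<omega>"
  obtains s where "t < s" "\<omega> / 2 < s" "s < \<omega>" "x < p s"
proof -
  have "\<forall>\<^sub>F u in at_right 0. x < p u"
    using p_at_right_0 unfolding filterlim_at_top_dense by blast
  moreover have "\<forall>\<^sub>F u in at_right 0. u < min (\<omega> - t) (\<omega> / 2)"
    by (rule eventually_at_right_less[THEN eventually_rev_mp]) (use assms period(1) in \<open>auto simp: eventually_at_right_field intro!: exI[of _ "min (\<omega> - t) (\<omega> / 2)"]\<close>)
  moreover have "\<forall>\<^sub>F u in at_right 0. (0::real) < u" by (rule eventually_at_right_less)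
  ultimately have "\<forall>\<^sub>F u in at_right 0. x < p u \<and> u < min (\<omega> - t) (\<omega> / 2) \<and> 0 < u"
    by eventually_elim blast
  then obtain u where u: "x < p u" "u < \<omega> - t" "u < \<omega> / 2" "0 < u"
    using eventually_happens'[of "at_right (0::real)"] by auto
  have "p (\<omega> - u) = p u" using u by (intro p_reflect notin_lattice) auto
  then show thesis using u by (intro that[of "\<omega> - u"]) auto
qed

text \<open>If \<open>p'\<close> were negative at \<open>t\<close>, the later growth of
  \<open>p\<close> would force a positive value of \<open>p'\<close> further right, and a zero in
  between.\<close>

lemma p'_pos:
  assumes t: "\<omega> / 2 < t" "t < \<omega>"
  shows "0 < p' t"
proof (rule ccontr)
  assume "\<not> 0 < p' t"
  then have neg: "p' t < 0" using p'_neq_0[OF t] by simp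
  obtain s where s: "t < s" "s < \<omega>" "p t < p s" by (rule p_large[OF t(2)])
  have notin: "complex_of_real u \<notin> \<Lambda>" if "t \<le> u" "u \<le> s" for u
    using that t s period(1) by (intro notin_lattice) auto
  have "\<exists>\<xi>>t. \<xi> < s \<and> p s - p t = (s - t) * p' \<xi>"
    by (rule MVT2[OF s(1)]) (use p_deriv notin in auto)
  then obtain \<xi> where \<xi>: "t < \<xi>" "\<xi> < s" "p s - p t = (s - t) * p' \<xi>" by blast
  then have "0 < p' \<xi>" using s by (metis diff_gt_0_iff_gt zero_less_mult_pos)
  then have "\<exists>u\<ge>t. u \<le> \<xi> \<and> p' u = 0"
    using \<xi> s neg notin by (intro IVT) (auto intro!: isCont_p')
  then show False using p'_neq_0 \<xi> s t by force
qed

lemma p_strict_mono: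
  assumes "\<omega> / 2 \<le> a" "b < \<omega>"
  shows "strict_mono_on {a..b} p"
proof (rule strict_mono_onI)
  fix u v assume uv: "u \<in> {a..b}" "v \<in> {a..b}" "u < v"
  show "p u < p v"
  proof (rule DERIV_pos_imp_increasing_open[OF uv(3)])
    show "\<exists>y. DERIV p x :> y \<and> 0 < y" if "u < x" "x < v" for x
      using that uv assms period(1) by (intro exI[of _ "p' x"] conjI p_deriv notin_lattice p'_pos) auto
    show "continuous_on {u..v} p"
      by (intro continuous_at_imp_continuous_on ballI isCont_p notin_lattice) (use uv assms period(1) in auto)
  qed
qed

lemma p_surj:
  assumes x: "p (\<omega> / 2) < x"
  obtains t where "\<omega> / 2 < t" "t < \<omega>" "p t = x"
proof -
  have "\<omega> / 2 < \<omega>" using period(1) by simp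
  then obtain s where s: "\<omega> / 2 < s" "s < \<omega>" "x < p s" using p_large by metis
  have "\<exists>t\<ge>\<omega> / 2. t \<le> s \<and> p t = x"
    by (intro IVT allI impI isCont_p notin_lattice) (use s x period(1) in auto)
  then obtain t where t: "\<omega> / 2 \<le> t" "t \<le> s" "p t = x" by blast
  then have "t \<noteq> \<omega> / 2" using x by (metis less_irrefl)
  then show thesis using that[of t] t s by auto
qed

text \<open>Every \<open>x\<close> above \<open>p (\<omega> / 2)\<close> is a value
  \<open>p t\<close> with \<open>p' t \<noteq> 0\<close>, so the cubic, being
  \<open>(p' t)^2\<close>, does not vanish there.\<close>

lemma largest_root_eq: "largest_root g2 g3 = p (\<omega> / 2)"
  unfolding largest_root_def
proof (rule Max_eqI)
  have "{x. 4 * x ^ 3 - g2 * x - g3 = 0} = {x. poly [:- g3, - g2, 0, 4:] x = 0}"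
    by (auto simp: algebra_simps power3_eq_cube)
  then show "finite {x. 4 * x ^ 3 - g2 * x - g3 = 0}"
    by (simp only:) (rule poly_roots_finite, simp)
  show "p (\<omega> / 2) \<in> {x. 4 * x ^ 3 - g2 * x - g3 = 0}"
    using p'_square[OF half_period] by (simp add: p'_half_period)
  fix x assume x: "x \<in> {x. 4 * x ^ 3 - g2 * x - g3 = 0}"
  show "x \<le> p (\<omega> / 2)"
  proof (rule ccontr)
    assume "\<not> x \<le> p (\<omega> / 2)"
    then obtain t where t: "\<omega> / 2 < t" "t < \<omega>" "p t = x" using p_surj[of x] by auto
    have "complex_of_real t \<notin> \<Lambda>" using t period(1) by (intro notin_lattice) auto
    from p'_square[OF this] have "p' t = 0" using x t by simp
    then show False using p'_neq_0[OF t(1,2)] by simp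
  qed
qed

lemma upper_branch_p:
  assumes "\<omega> / 2 \<le> t" "t < \<omega>"
  shows "upper_branch g2 g3 (p t) = p' t"
proof -
  have notin: "complex_of_real t \<notin> \<Lambda>" using assms period(1) by (intro notin_lattice) auto
  have "0 \<le> p' t" using p'_pos[of t] p'_half_period assms by (metis less_eq_real_def)
  then show ?thesis unfolding upper_branch_def p'_square[OF notin, symmetric] by simp
qed

end

subsection \<open>Means along the orbit\<close>

context real_lattice
begin

context
  fixes z :: real
  assumes irr: "z \<notin> {\<omega> * q | q. q \<in> \<rat>}"
begin

definition residue_seq :: "nat \<Rightarrow> real" where
  "residue_seq n = (real n * z) rmod \<omega>"

lemma multiple_notin:
  assumes "0 < n"
  shows "complex_of_real (real n * z) \<notin> \<Lambda>"
proof
  assume "complex_of_real (real n * z) \<in> \<Lambda>"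
  then obtain k :: int where "real n * z = of_int k * \<omega>" by (rule real_lattice_point)
  then have "z = \<omega> * (of_int k / of_nat n)" using assms by (simp add: field_simps)
  moreover have "of_int k / of_nat n \<in> (\<rat> :: real set)" by simp
  ultimately show False using irr by blast
qed

lemma residue_seq_eq:
  obtains k :: int where "real n * z = residue_seq n + of_int k * \<omega>"
  using that[of "\<lfloor>real n * z / \<omega>\<rfloor>"] period(1) by (simp add: residue_seq_def rmod_def)

text \<open>A residue 0 would put \<open>n z\<close> on the lattice and a residue
  \<open>\<omega> / 2\<close> would put \<open>2 n z\<close> there; both contradict irrationality.
  Hence each residue lies strictly inside one of the two halves.\<close>

lemma residue_seq:
  assumes n: "0 < n"
  shows "0 < residue_seq n" "residue_seq n < \<omega>" "residue_seq n \<noteq> \<omega> / 2"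
    and "wp (of_real (real n * z)) = of_real (p (residue_seq n))"
    and "wp' (of_real (real n * z)) = of_real (p' (residue_seq n))"
proof -
  obtain k where k: "real n * z = residue_seq n + of_int k * \<omega>" by (rule residue_seq_eq)
  have eq: "complex_of_real (real n * z) = of_real (residue_seq n) + of_real (of_int k * \<omega>)"
    unfolding k by simp
  have notin: "complex_of_real (residue_seq n) \<notin> \<Lambda>"
    using multiple_notin[OF n] add_mem_iff[OF of_int_mult_period] unfolding eq by blast
  then have "residue_seq n \<noteq> 0" using zero_mem by (metis of_real_0)
  moreover have "0 \<le> residue_seq n" using period(1) by (simp add: residue_seq_def rmod_nonneg)
  ultimately show "0 < residue_seq n" by simp
  show "residue_seq n < \<omega>" using period(1) by (simp add: residue_seq_def rmod_less)
  show "residue_seq n \<noteq> \<omega> / 2"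
  proof
    assume "residue_seq n = \<omega> / 2"
    then have "real (2 * n) * z = of_int (2 * k + 1) * \<omega>" using k by (simp add: algebra_simps)
    then have "complex_of_real (real (2 * n) * z) \<in> \<Lambda>" using of_int_mult_period by metis
    then show False using multiple_notin[of "2 * n"] n by simp
  qed
  show "wp (of_real (real n * z)) = of_real (p (residue_seq n))"
    unfolding eq wp_periodic[OF notin of_int_mult_period] by (rule wp_of_real)
  show "wp' (of_real (real n * z)) = of_real (p' (residue_seq n))"
    unfolding eq wp'_periodic[OF notin of_int_mult_period] by (rule wp'_of_real)
qed

lemma equidistributed_residues: "equidistributed_sequence \<omega> residue_seq"
  unfolding residue_seq_def[abs_def]
  by unfold_locales (use period(1) irr has_mean_indicator_rmod in auto)

text \<open>Reflection carries the lower half of the period, where \<open>p\<close> decreases, to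
  the upper half, so one increasing substitution serves both branches.\<close>

lemma equidistributed_reflected: "equidistributed_sequence \<omega> (\<lambda>n. \<omega> - residue_seq n)"
proof
  show "0 < \<omega>" by (rule period(1))
  fix c d assume "0 \<le> c" "c \<le> d" "d \<le> \<omega>"
  then have "has_mean (\<lambda>n. indicator {\<omega> - d..\<omega> - c} (residue_seq n)) (((\<omega> - c) - (\<omega> - d)) / \<omega>)"
    by (intro equidistributed_sequence.mean_Icc[OF equidistributed_residues]) auto
  moreover have "indicator {\<omega> - d..\<omega> - c} u = (indicator {c..d} (\<omega> - u) :: real)" for u
    by (auto simp: indicator_def)
  ultimately show "has_mean (\<lambda>n. indicator {c..d} (\<omega> - residue_seq n)) ((d - c) / \<omega>)" by simp
qed

lemma upper_branch_pos:
  assumes "largest_root g2 g3 < x"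
  shows "0 < upper_branch g2 g3 x"
proof -
  obtain t where "\<omega> / 2 < t" "t < \<omega>" "p t = x" using p_surj[of x] assms largest_root_eq by auto
  then show ?thesis using upper_branch_p[of t] p'_pos[of t] by simp
qed

text \<open>As \<open>upper_branch\<close> composed with \<open>p\<close> is \<open>p'\<close>, the
  factor of the substitution cancels the denominator and leaves \<open>g (p (s n))\<close>. Strictly
  inside the half, the denominator has a positive minimum, at \<open>x0\<close>, which bounds the
  quotient.\<close>

lemma mean_branch:
  assumes s: "equidistributed_sequence \<omega> s" and ab: "\<omega> / 2 < a" "a < b" "b < \<omega>"
    and g: "\<And>x. largest_root g2 g3 \<le> x \<Longrightarrow> \<bar>g x\<bar> \<le> B"
    and int: "Riemann_integrable (\<lambda>x. g x / upper_branch g2 g3 x) (p a) (p b)"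
  shows "has_mean (\<lambda>n. indicator {a<..b} (s n) * g (p (s n)))
    (integral {p a..p b} (\<lambda>x. g x / upper_branch g2 g3 x) / \<omega>)"
proof -
  let ?y = "upper_branch g2 g3" and ?h = "\<lambda>x. g x / upper_branch g2 g3 x"
  interpret equidistributed_sequence \<omega> s by fact
  obtain I where I: "has_Riemann_integral ?h I (p a) (p b)" using int unfolding Riemann_integrable_def by blast
  then have I_eq: "integral {p a..p b} ?h = I"
    by (intro integral_unique has_Riemann_integral_imp_has_integral)
  have mono: "strict_mono_on {\<omega> / 2..b} p" by (rule p_strict_mono) (use ab in auto)
  have pa: "largest_root g2 g3 < p a" "p a < p b"
    unfolding largest_root_eq using ab by (auto intro!: strict_mono_onD[OF mono])
  have notin: "complex_of_real t \<notin> \<Lambda>" if "t \<in> {a..b}" for t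
    using that ab period(1) by (intro notin_lattice) auto
  have cont_y: "continuous_on {p a..p b} ?y"
    unfolding upper_branch_def[abs_def] by (intro continuous_intros)
  have pos: "0 < ?y x" if "x \<in> {p a..p b}" for x
    using that pa by (intro upper_branch_pos) auto
  obtain x0 where x0: "x0 \<in> {p a..p b}" "\<And>x. x \<in> {p a..p b} \<Longrightarrow> ?y x0 \<le> ?y x"
    using continuous_attains_inf[OF compact_Icc _ cont_y] pa by auto
  have "has_mean (\<lambda>n. indicator {a<..b} (s n) * (?h (p (s n)) * p' (s n))) (I / \<omega>)"
  proof (rule mean_substitution[where h = ?h and p = p and p' = p' and B = "B / ?y x0"])
    show "0 \<le> a" "a < b" "b \<le> \<omega>" using ab period(1) by auto
    show "(p has_real_derivative p' t) (at t)" if "t \<in> {a..b}" for t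
      by (rule p_deriv[OF notin[OF that]])
    show "continuous_on {a..b} p'"
      by (intro continuous_at_imp_continuous_on ballI isCont_p' notin)
    show "0 \<le> p' t" if "t \<in> {a..b}" for t using p'_pos[of t] that ab by auto
    show "strict_mono_on {a..b} p" by (rule p_strict_mono) (use ab in auto)
    show "has_Riemann_integral ?h I (p a) (p b)" by (rule I)
    show "\<bar>?h x\<bar> \<le> B / ?y x0" if "x \<in> {p a..p b}" for x
    proof -
      have gx: "\<bar>g x\<bar> \<le> B" using that pa by (intro g) auto
      then have "\<bar>g x\<bar> / ?y x \<le> B / ?y x0"
        using x0(2)[OF that] pos[OF x0(1)] by (intro frac_le) auto
      then show ?thesis using pos[OF that] by (simp add: abs_divide)
    qed
  qed
  moreover have "indicator {a<..b} u * (?h (p u) * p' u) = indicator {a<..b} u * g (p u)" for u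
  proof (cases "u \<in> {a<..b}")
    case True
    then have "?y (p u) = p' u" "0 < p' u" using ab by (auto intro!: upper_branch_p p'_pos)
    then show ?thesis by simp
  qed simp
  ultimately show ?thesis by (simp add: I_eq)
qed

text \<open>A margin \<open>\<delta>\<close> is removed at both ends of both halves, so the
  discarded residues have density \<open>4 * \<delta> / \<omega>\<close>. The margin is chosen from
  \<open>\<epsilon>\<close> before \<open>N\<close> grows.\<close>

lemma mean_wp:
  fixes f :: "complex \<times> complex \<Rightarrow> real"
  defines "e \<equiv> largest_root g2 g3" and "y \<equiv> upper_branch g2 g3"
  defines "fu \<equiv> \<lambda>x. f (complex_of_real x, complex_of_real (y x))"
    and "fl \<equiv> \<lambda>x. f (complex_of_real x, complex_of_real (- y x))"
  assumes bdd: "bounded (f ` affine_points g2 g3)"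
    and int: "\<And>c d. e < c \<Longrightarrow> c \<le> d \<Longrightarrow> Riemann_integrable (\<lambda>x. fu x / y x) c d"
      "\<And>c d. e < c \<Longrightarrow> c \<le> d \<Longrightarrow> Riemann_integrable (\<lambda>x. fl x / y x) c d"
    and lim: "((\<lambda>(\<epsilon>, r). integral {e + \<epsilon>..r} (\<lambda>x. fu x / y x)) \<longlongrightarrow> Lu) (at_right 0 \<times>\<^sub>F at_top)"
      "((\<lambda>(\<epsilon>, r). integral {e + \<epsilon>..r} (\<lambda>x. fl x / y x)) \<longlongrightarrow> Ll) (at_right 0 \<times>\<^sub>F at_top)"
  shows "has_mean (\<lambda>n. f (wp (of_real (real n * z)), wp' (of_real (real n * z)))) ((Lu + Ll) / \<omega>)"
proof -
  let ?v = "\<lambda>n. f (wp (of_real (real n * z)), wp' (of_real (real n * z)))"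
  let ?t = residue_seq and ?s = "\<lambda>n. \<omega> - residue_seq n"
  obtain B where B: "\<And>P. P \<in> affine_points g2 g3 \<Longrightarrow> \<bar>f P\<bar> \<le> B"
    using bdd unfolding bounded_iff by auto
  have bnd: "\<bar>fu x\<bar> \<le> B" "\<bar>fl x\<bar> \<le> B" if "largest_root g2 g3 \<le> x" for x
    unfolding fu_def fl_def using that by (auto intro!: B simp: affine_points_def y_def)
  have B0: "0 \<le> B" using bnd(1)[of "largest_root g2 g3"] by auto
  have val: "(\<omega> / 2 < ?t n \<longrightarrow> ?v n = fu (p (?t n))) \<and> (?t n < \<omega> / 2 \<longrightarrow> ?v n = fl (p (?s n)))"
    if n: "0 < n" for n
  proof (intro conjI impI)
    assume "\<omega> / 2 < ?t n"
    then show "?v n = fu (p (?t n))"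
      unfolding residue_seq(4,5)[OF n] fu_def y_def using residue_seq(2)[OF n]
      by (simp add: upper_branch_p)
  next
    assume lt: "?t n < \<omega> / 2"
    have notin: "complex_of_real (?t n) \<notin> \<Lambda>" using residue_seq(1,2)[OF n] by (rule notin_lattice)
    have "upper_branch g2 g3 (p (?s n)) = p' (?s n)"
      using lt residue_seq(1)[OF n] by (intro upper_branch_p) auto
    then have "y (p (?s n)) = - p' (?t n)" by (simp add: y_def p'_reflect[OF notin])
    then show "?v n = fl (p (?s n))"
      unfolding residue_seq(4,5)[OF n] fl_def by (simp add: p_reflect[OF notin])
  qed
  have v_bnd: "\<bar>?v n\<bar> \<le> B" if n: "0 < n" for n
  proof (cases "\<omega> / 2 < ?t n")
    case True
    then have "p (\<omega> / 2) < p (?t n)"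
      using residue_seq(2)[OF n] by (intro strict_mono_onD[OF p_strict_mono[of "\<omega> / 2" "?t n"]]) auto
    then show ?thesis using val[OF n] True bnd(1)[of "p (?t n)"] by (simp add: largest_root_eq)
  next
    case False
    then have lt: "?t n < \<omega> / 2" using residue_seq(3)[OF n] by simp
    then have "p (\<omega> / 2) < p (?s n)"
      using residue_seq(1)[OF n] by (intro strict_mono_onD[OF p_strict_mono[of "\<omega> / 2" "?s n"]]) auto
    then show ?thesis using val[OF n] lt bnd(2)[of "p (?s n)"] by (simp add: largest_root_eq)
  qed
  let ?Iu = "\<lambda>\<delta>. integral {p (\<omega> / 2 + \<delta>)..p (\<omega> - \<delta>)} (\<lambda>x. fu x / y x)"
  let ?Il = "\<lambda>\<delta>. integral {p (\<omega> / 2 + \<delta>)..p (\<omega> - \<delta>)} (\<lambda>x. fl x / y x)"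
  have ev_small: "\<forall>\<^sub>F \<delta> in at_right 0. 0 < \<delta> \<and> \<delta> < c" if "0 < c" for c :: real
    using that by (auto simp: eventually_at_right_field)
  \<comment> \<open>One shrinking margin moves both limits of integration: the lower one tends to
    \<open>e\<close> from above, the upper one to infinity. Along this path the double limit becomes
    a limit in \<open>\<delta>\<close> alone.\<close>
  have path: "filterlim (\<lambda>\<delta>. (p (\<omega> / 2 + \<delta>) - e, p (\<omega> - \<delta>))) (at_right 0 \<times>\<^sub>F at_top) (at_right 0)"
  proof (rule filterlim_Pair)
    have "(\<lambda>\<delta>. p (\<omega> / 2 + \<delta>)) \<midarrow>0\<rightarrow> p (\<omega> / 2)"
      using isCont_p[OF half_period] unfolding isCont_def by (rule LIM_offset_zero)
    then have "(\<lambda>\<delta>. p (\<omega> / 2 + \<delta>) - e) \<midarrow>0\<rightarrow> e - e"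
      unfolding e_def largest_root_eq by (intro tendsto_diff tendsto_const)
    then have "((\<lambda>\<delta>. p (\<omega> / 2 + \<delta>) - e) \<longlongrightarrow> 0) (at_right 0)"
      unfolding diff_self by (rule tendsto_within_subset) simp
    moreover have "\<forall>\<^sub>F \<delta> in at_right 0. 0 < p (\<omega> / 2 + \<delta>) - e"
      using ev_small[OF half_gt_zero[OF period(1)]]
    proof eventually_elim
      case (elim \<delta>)
      then have "p (\<omega> / 2) < p (\<omega> / 2 + \<delta>)"
        by (intro strict_mono_onD[OF p_strict_mono[of "\<omega> / 2" "\<omega> / 2 + \<delta>"]]) auto
      then show ?case by (simp add: e_def largest_root_eq)
    qed
    ultimately show "filterlim (\<lambda>\<delta>. p (\<omega> / 2 + \<delta>) - e) (at_right 0) (at_right 0)"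
      by (auto simp: filterlim_at elim!: eventually_mono)
    have "\<forall>\<^sub>F \<delta> in at_right 0. p \<delta> = p (\<omega> - \<delta>)"
      using ev_small[OF period(1)]
      by eventually_elim (simp add: p_reflect notin_lattice)
    from filterlim_cong[OF refl refl this] p_at_right_0
    show "filterlim (\<lambda>\<delta>. p (\<omega> - \<delta>)) at_top (at_right 0)" by simp
  qed
  have limu: "(?Iu \<longlongrightarrow> Lu) (at_right 0)" and liml: "(?Il \<longlongrightarrow> Ll) (at_right 0)"
    using filterlim_compose[OF lim(1) path] filterlim_compose[OF lim(2) path] by simp_all
  have limr: "((\<lambda>\<delta>. B * (4 * \<delta> / \<omega>)) \<longlongrightarrow> B * (4 * 0 / \<omega>)) (at_right 0)"
    by (intro tendsto_intros) (use period(1) in auto)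
  have lim_all: "((\<lambda>\<delta>. \<bar>(?Iu \<delta> + ?Il \<delta>) / \<omega> - (Lu + Ll) / \<omega>\<bar> + B * (4 * \<delta> / \<omega>))
      \<longlongrightarrow> \<bar>(Lu + Ll) / \<omega> - (Lu + Ll) / \<omega>\<bar> + B * (4 * 0 / \<omega>)) (at_right 0)"
    by (intro tendsto_add tendsto_rabs tendsto_diff tendsto_divide limu liml limr tendsto_const)
       (use period(1) in auto)
  have approx: "\<forall>\<^sub>F N in sequentially. \<bar>(\<Sum>n=1..N. ?v n) / real N - (Lu + Ll) / \<omega>\<bar> < \<epsilon>"
    if \<epsilon>: "0 < \<epsilon>" for \<epsilon>
  proof -
    have "\<forall>\<^sub>F \<delta> in at_right 0.
        \<bar>(?Iu \<delta> + ?Il \<delta>) / \<omega> - (Lu + Ll) / \<omega>\<bar> + B * (4 * \<delta> / \<omega>) < \<epsilon>"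
      by (rule order_tendstoD(2)[OF lim_all]) (use \<epsilon> in simp)
    moreover have "\<forall>\<^sub>F \<delta> in at_right 0. 0 < \<delta> \<and> \<delta> < \<omega> / 4"
      by (rule ev_small) (use period(1) in simp)
    ultimately have "\<forall>\<^sub>F \<delta> in at_right 0. (0 < \<delta> \<and> \<delta> < \<omega> / 4) \<and>
        \<bar>(?Iu \<delta> + ?Il \<delta>) / \<omega> - (Lu + Ll) / \<omega>\<bar> + B * (4 * \<delta> / \<omega>) < \<epsilon>"
      by eventually_elim blast
    then obtain \<delta> where \<delta>: "0 < \<delta>" "\<delta> < \<omega> / 4"
      and small: "\<bar>(?Iu \<delta> + ?Il \<delta>) / \<omega> - (Lu + Ll) / \<omega>\<bar> + B * (4 * \<delta> / \<omega>) < \<epsilon>"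
      using eventually_happens'[of "at_right (0::real)"] by auto
    define a where "a = \<omega> / 2 + \<delta>"
    define b where "b = \<omega> - \<delta>"
    have ab: "\<omega> / 2 < a" "a < b" "b < \<omega>" using \<delta> by (simp_all add: a_def b_def)
    have pab: "e < p a" "p a \<le> p b"
      using strict_mono_onD[OF p_strict_mono[of "\<omega> / 2" b], of "\<omega> / 2" a]
        strict_mono_onD[OF p_strict_mono[of "\<omega> / 2" b], of a b] ab
      by (auto simp: e_def largest_root_eq)
    let ?u = "\<lambda>n. indicator {a<..b} (?t n) * fu (p (?t n)) + indicator {a<..b} (?s n) * fl (p (?s n))"
    \<comment> \<open>\<open>B\<close> times the indicator of the residues in neither kept part. The
      kept parts are disjoint, because \<open>a > \<omega> / 2\<close> and a residue and its
      reflection add up to \<open>\<omega>\<close>.\<close>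
    let ?r = "\<lambda>n. B * (1 - indicator {a<..b} (?t n) - indicator {a<..b} (?s n))"
    have "has_mean ?u (?Iu \<delta> / \<omega> + ?Il \<delta> / \<omega>)"
      unfolding a_def[symmetric] b_def[symmetric] y_def
      by (intro has_mean_add mean_branch[OF equidistributed_residues ab bnd(1)]
            mean_branch[OF equidistributed_reflected ab bnd(2)] int[unfolded y_def] pab)
    moreover have "has_mean ?r (B * (1 - (b - a) / \<omega> - (b - a) / \<omega>))"
      by (intro has_mean_cmult has_mean_diff has_mean_1
            equidistributed_sequence.mean_Ioc[OF equidistributed_residues]
            equidistributed_sequence.mean_Ioc[OF equidistributed_reflected])
         (use ab period(1) in auto)
    moreover have "1 - (b - a) / \<omega> - (b - a) / \<omega> = 4 * \<delta> / \<omega>"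
      using period(1) by (simp add: a_def b_def field_simps)
    ultimately have u: "has_mean ?u ((?Iu \<delta> + ?Il \<delta>) / \<omega>)" and r: "has_mean ?r (B * (4 * \<delta> / \<omega>))"
      by (simp_all add: add_divide_distrib)
    have diff: "\<bar>?v n - ?u n\<bar> \<le> ?r n" if n: "0 < n" for n
    proof -
      consider "?t n \<in> {a<..b}" "?s n \<notin> {a<..b}" | "?t n \<notin> {a<..b}" "?s n \<in> {a<..b}"
        | "?t n \<notin> {a<..b}" "?s n \<notin> {a<..b}"
        using ab by fastforce
      then show ?thesis
      proof cases
        case 1
        then have "?v n = fu (p (?t n))" using val[OF n] ab by auto
        then show ?thesis using 1 by simp
      next
        case 2
        then have "?v n = fl (p (?s n))" using val[OF n] ab by auto
        then show ?thesis using 2 by simp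
      next
        case 3
        then show ?thesis using v_bnd[OF n] by simp
      qed
    qed
    have "((\<lambda>N. \<bar>(\<Sum>n=1..N. ?u n) / real N - (Lu + Ll) / \<omega>\<bar> + (\<Sum>n=1..N. ?r n) / real N)
        \<longlongrightarrow> \<bar>(?Iu \<delta> + ?Il \<delta>) / \<omega> - (Lu + Ll) / \<omega>\<bar> + B * (4 * \<delta> / \<omega>)) sequentially"
      by (rule tendsto_add[OF tendsto_rabs[OF tendsto_diff[OF u[unfolded has_mean_def] tendsto_const]]
            r[unfolded has_mean_def]])
    then have "\<forall>\<^sub>F N in sequentially.
        \<bar>(\<Sum>n=1..N. ?u n) / real N - (Lu + Ll) / \<omega>\<bar> + (\<Sum>n=1..N. ?r n) / real N < \<epsilon>"
      using small by (rule order_tendstoD(2))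
    then show ?thesis
    proof eventually_elim
      case (elim N)
      have "\<bar>(\<Sum>n=1..N. ?v n) - (\<Sum>n=1..N. ?u n)\<bar> \<le> (\<Sum>n=1..N. \<bar>?v n - ?u n\<bar>)"
        unfolding sum_subtractf[symmetric] by (rule sum_abs)
      also have "\<dots> \<le> (\<Sum>n=1..N. ?r n)" by (intro sum_mono diff) auto
      finally have "\<bar>((\<Sum>n=1..N. ?v n) - (\<Sum>n=1..N. ?u n)) / real N\<bar> \<le> (\<Sum>n=1..N. ?r n) / real N"
        unfolding abs_divide by (simp add: divide_right_mono)
      then show ?case using elim unfolding diff_divide_distrib by linarith
    qed
  qed
  show ?thesis unfolding has_mean_def
    by (rule tendstoI) (use approx in \<open>simp add: dist_real_def\<close>)
qed

end

end

section \<open>Additivity of the improper integral and conclusion\<close>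

lemma improper_Riemann_integral_add:
  assumes int: "\<And>c d. a < c \<Longrightarrow> c \<le> d \<Longrightarrow> Riemann_integrable g c d"
      "\<And>c d. a < c \<Longrightarrow> c \<le> d \<Longrightarrow> Riemann_integrable h c d"
    and lim: "((\<lambda>(\<epsilon>, r). integral {a + \<epsilon>..r} g) \<longlongrightarrow> L) (at_right 0 \<times>\<^sub>F at_top)"
      "((\<lambda>(\<epsilon>, r). integral {a + \<epsilon>..r} h) \<longlongrightarrow> M) (at_right 0 \<times>\<^sub>F at_top)"
  shows "improper_Riemann_integral (\<lambda>x. g x + h x) a = L + M"
  unfolding improper_Riemann_integral_def
proof (rule tendsto_Lim)
  \<comment> \<open>\<open>Lim\<close> is determined by convergence only along a nontrivial
    filter.\<close>
  show "(at_right (0::real) \<times>\<^sub>F (at_top :: real filter)) \<noteq> bot"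
    by (simp add: prod_filter_eq_bot)
  have integrable: "k integrable_on {c..d}" if "Riemann_integrable k c d" for k c d
    using that has_Riemann_integral_imp_has_integral unfolding Riemann_integrable_def by blast
  have "\<forall>\<^sub>F \<epsilon> in at_right (0::real). 0 < \<epsilon>" by (rule eventually_at_right_less)
  then have "\<forall>\<^sub>F (\<epsilon>, r) in at_right (0::real) \<times>\<^sub>F (at_top :: real filter). 0 < \<epsilon>"
    by (subst eventually_prod1) auto
  then have "\<forall>\<^sub>F x in at_right 0 \<times>\<^sub>F at_top.
      (case x of (\<epsilon>, r) \<Rightarrow> integral {a + \<epsilon>..r} g) + (case x of (\<epsilon>, r) \<Rightarrow> integral {a + \<epsilon>..r} h)
      = (case x of (\<epsilon>, r) \<Rightarrow> integral {a + \<epsilon>..r} (\<lambda>x. g x + h x))"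
  proof eventually_elim
    case (elim x)
    obtain \<epsilon> r where x: "x = (\<epsilon>, r)" by (cases x)
    show ?case
    proof (cases "a + \<epsilon> \<le> r")
      case True
      then show ?thesis using elim x
        by (simp add: integral_add integrable int)
    next
      case False
      \<comment> \<open>The interval is empty, so all three integrals are 0.\<close>
      then show ?thesis using x by simp
    qed
  qed
  with tendsto_add[OF lim]
  show "((\<lambda>(\<epsilon>, r). integral {a + \<epsilon>..r} (\<lambda>x. g x + h x)) \<longlongrightarrow> L + M) (at_right 0 \<times>\<^sub>F at_top)"
    by (rule Lim_transform_eventually)
qed

theorem theorem10:
  fixes g2 g3 z :: real and \<Lambda> :: "complex set"
  defines "e \<equiv> largest_root g2 g3"
    and "y \<equiv> upper_branch g2 g3"
    and "\<omega> \<equiv> real_period \<Lambda>"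
  assumes "g2 ^ 3 - 27 * g3\<^sup>2 \<noteq> 0"
    and "is_lattice \<Lambda>"
    and "invariant_g2 \<Lambda> = complex_of_real g2"
    and "invariant_g3 \<Lambda> = complex_of_real g3"
    and "z \<notin> {\<omega> * q | q. q \<in> \<rat>}"
  shows "equidistributed_mod \<omega> (\<lambda>n. real n * z) \<and>
    (\<forall>f :: complex \<times> complex \<Rightarrow> real.
       bounded (f ` affine_points g2 g3) \<longrightarrow>
       improper_Riemann_integrable
         (\<lambda>x. f (complex_of_real x, complex_of_real (y x)) / y x) e \<longrightarrow>
       improper_Riemann_integrable
         (\<lambda>x. f (complex_of_real x, complex_of_real (- y x)) / y x) e \<longrightarrow>
       (\<lambda>N. (\<Sum>n = 1..N. f (weierstrass_p \<Lambda> (complex_of_real (real n * z)),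
                            deriv (weierstrass_p \<Lambda>) (complex_of_real (real n * z)))) / real N)
         \<longlonglongrightarrow>
       1 / \<omega> * improper_Riemann_integral
         (\<lambda>x. (f (complex_of_real x, complex_of_real (y x)) +
               f (complex_of_real x, complex_of_real (- y x))) / y x) e)"
proof -
  interpret R: real_lattice \<Lambda> g2 g3 by unfold_locales fact+
  have \<omega>: "\<omega> = R.\<omega>" by (simp add: \<omega>_def R.\<omega>_def)
  have irr: "z \<notin> {R.\<omega> * q | q. q \<in> \<rat>}" using assms(8) unfolding \<omega> .
  show ?thesis
  proof (intro conjI allI impI)
    show "equidistributed_mod \<omega> (\<lambda>n. real n * z)"
      unfolding \<omega> by (rule equidistributed_mod_multiples[OF R.period(1) irr])
    fix f :: "complex \<times> complex \<Rightarrow> real"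
    assume bdd: "bounded (f ` affine_points g2 g3)"
      and u: "improper_Riemann_integrable (\<lambda>x. f (complex_of_real x, complex_of_real (y x)) / y x) e"
      and l: "improper_Riemann_integrable (\<lambda>x. f (complex_of_real x, complex_of_real (- y x)) / y x) e"
    obtain Lu where Lu: "((\<lambda>(\<epsilon>, r). integral {e + \<epsilon>..r}
        (\<lambda>x. f (complex_of_real x, complex_of_real (y x)) / y x)) \<longlongrightarrow> Lu) (at_right 0 \<times>\<^sub>F at_top)"
      using u unfolding improper_Riemann_integrable_def by blast
    obtain Ll where Ll: "((\<lambda>(\<epsilon>, r). integral {e + \<epsilon>..r}
        (\<lambda>x. f (complex_of_real x, complex_of_real (- y x)) / y x)) \<longlongrightarrow> Ll) (at_right 0 \<times>\<^sub>F at_top)"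
      using l unfolding improper_Riemann_integrable_def by blast
    have iu: "Riemann_integrable (\<lambda>x. f (complex_of_real x, complex_of_real (y x)) / y x) c d"
      if "e < c" "c \<le> d" for c d
      using u that unfolding improper_Riemann_integrable_def by blast
    have il: "Riemann_integrable (\<lambda>x. f (complex_of_real x, complex_of_real (- y x)) / y x) c d"
      if "e < c" "c \<le> d" for c d
      using l that unfolding improper_Riemann_integrable_def by blast
    have "has_mean (\<lambda>n. f (weierstrass_p \<Lambda> (of_real (real n * z)), R.wp' (of_real (real n * z))))
        ((Lu + Ll) / R.\<omega>)"
      using R.mean_wp[OF irr bdd] iu il Lu Ll unfolding e_def y_def by blast
    \<comment> \<open>The sum starts at \<open>n = 1\<close>, and positive multiples of
      \<open>z\<close> stay off the lattice, where \<open>wp'\<close> is the derivative of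
      \<open>wp\<close>.\<close>
    moreover have "(\<Sum>n = 1..N. f (weierstrass_p \<Lambda> (of_real (real n * z)), R.wp' (of_real (real n * z)))) =
        (\<Sum>n = 1..N. f (weierstrass_p \<Lambda> (complex_of_real (real n * z)),
          deriv (weierstrass_p \<Lambda>) (complex_of_real (real n * z))))" for N
      by (intro sum.cong refl, subst R.deriv_wp[OF R.multiple_notin[OF irr]]) auto
    ultimately have "(\<lambda>N. (\<Sum>n = 1..N. f (weierstrass_p \<Lambda> (complex_of_real (real n * z)),
        deriv (weierstrass_p \<Lambda>) (complex_of_real (real n * z)))) / real N) \<longlonglongrightarrow> (Lu + Ll) / R.\<omega>"
      unfolding has_mean_def by (simp only:)
    moreover have "improper_Riemann_integral
         (\<lambda>x. (f (complex_of_real x, complex_of_real (y x)) +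
               f (complex_of_real x, complex_of_real (- y x))) / y x) e = Lu + Ll"
      unfolding add_divide_distrib by (rule improper_Riemann_integral_add[OF iu il Lu Ll])
    ultimately show "(\<lambda>N. (\<Sum>n = 1..N. f (weierstrass_p \<Lambda> (complex_of_real (real n * z)),
        deriv (weierstrass_p \<Lambda>) (complex_of_real (real n * z)))) / real N) \<longlonglongrightarrow>
       1 / \<omega> * improper_Riemann_integral
         (\<lambda>x. (f (complex_of_real x, complex_of_real (y x)) +
               f (complex_of_real x, complex_of_real (- y x))) / y x) e"
      by (simp add: \<omega>)
  qed
qed

end
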